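(* Let $n\ge1$, $p\ge0$, let $m_1,\dots,m_p$ be non-negative integers and let $a_1,\dots,a_{n+1}$, $b_1,\dots,b_{n+1}$, $c_1,\dots,c_p$, $z_1,\dots,z_n$ be complex parameters such that no denominators below vanish and $\operatorname{Re}(|b|-|a|)>n+|m|$. Then \begin{multline*} \sum_{y_1,\dots,y_n=-\infty}^\infty \frac{\Delta(z+y)}{\Delta(z)} \prod_{\substack{1\leq k\leq n\\1\leq i\leq p}}\frac{(c_i+z_k+m_i)_{y_k}} {(c_i+z_k)_{y_k}}\prod_{\substack{1\leq k\leq n\\1\leq i\leq n+1}} \frac{(a_i+z_k)_{y_k}}{(b_i+z_k)_{y_k}}\\ =(-1)^{|m|}\frac{\Gamma(|b|-|a|-|m|-n) }{\prod_{i,k=1}^{n+1}\Gamma(b_i-a_k)\prod_{i,k=1}^n\Gamma(1+z_k-z_i)} \prod_{\substack{1\leq k\leq n\\1\leq i\leq n+1}} \Gamma(1-a_i-z_k)\,\Gamma(b_i+z_k) \prod_{i=1}^p \frac{\prod_{k=1}^{n+1}(1+c_i-b_k)_{m_i}} {\prod_{k=1}^{n}(c_i+z_k)_{m_i}}\\ \times\sum_{x_1,\dots,x_p=0}^{m_1,\dots,m_p}\frac{\Delta(c+x)}{\Delta(c)} \prod_{\substack{1\leq k\leq n+1\\1\leq i\leq p}}\frac{(c_i-a_k)_{x_i}} {(1+c_i-b_k)_{x_i}}\prod_{i,k=1}^p\frac{(c_i-c_k-m_k)_{x_i}} {(1+c_i-c_k)_{x_i}}. \end{multline*}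
   Context: Here $(a)_k=\Gamma(a+k)/\Gamma(a)$, i.e. $(a)_k=a(a+1)\cdots(a+k-1)$ for $k\ge0$ and $(a)_k=1/\big((a-1)(a-2)\cdots(a+k)\big)$ for $k<0$. For a vector $v$, $|v|$ denotes the sum of its coordinates (so $|a|=a_1+\dots+a_{n+1}$, $|b|=b_1+\dots+b_{n+1}$, $|m|=m_1+\dots+m_p$). $\frac{\Delta(z+y)}{\Delta(z)}=\prod_{1\le i<j\le n}\frac{z_i+y_i-z_j-y_j}{z_i-z_j}$ and $\frac{\Delta(c+x)}{\Delta(c)}=\prod_{1\le i<j\le p}\frac{c_i+x_i-c_j-x_j}{c_i-c_j}$. The sum $\sum_{x_1,\dots,x_p=0}^{m_1,\dots,m_p}$ runs over integers $0\le x_i\le m_i$. *)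

theory Defs
  imports "HOL-Analysis.Analysis"
begin

definition poch_int :: "complex \<Rightarrow> int \<Rightarrow> complex" where
  "poch_int a k = (if 0 \<le> k then pochhammer a (nat k)
                   else 1 / (\<Prod>j = 1..nat (- k). (a - of_nat j)))"

definition vdm_ratio :: "nat \<Rightarrow> (nat \<Rightarrow> complex) \<Rightarrow> (nat \<Rightarrow> complex) \<Rightarrow> complex" where
  "vdm_ratio n z y = (\<Prod>j<n. \<Prod>i<j. (z i + y i - z j - y j) / (z i - z j))"

end

theory Submission
  imports Defs "HOL-Complex_Analysis.Complex_Analysis" "HOL-Real_Asymp.Real_Asymp"
    "Jordan_Normal_Form.Determinant"
begin

text \<open>
  Up to nonzero factors the summand is \<open>vand n (z + y)\<close> times a product over \<open>k\<close> of
  \<open>w (z k + y k) * R (z k + y k)\<close>, where \<open>w\<close> is the weight given by reciprocal Gamma functions and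
  \<open>R\<close> is the polynomial with roots \<open>- c i - t\<close> for \<open>t < m i\<close>. Expanding the Vandermonde
  determinant turns the \<open>n\<close>-fold sum into a determinant of one-dimensional bilateral sums.

  These one-dimensional sums vanish on the image of a difference operator \<open>D\<close>, since there they telescope.
  Bordering the determinant with evaluations at the roots of \<open>R\<close> and changing the polynomial basis to the powers
  below \<open>n\<close> followed by the polynomials \<open>D s^k\<close> factors it into the case \<open>p = 0\<close> and a finite
  determinant with entries \<open>D s^k\<close> at the roots. Row expansion of the latter into Vandermonde determinants gives
  the sum over \<open>x\<close>.

  For \<open>p = 0\<close> (Gustafson's extension of Dougall's sum) a Liouville argument shows that the bilateral sums are
  trigonometric polynomials in the base point, so the determinant is \<open>C\<close> times a product of sines with \<open>C\<close>
  independent of \<open>z\<close>. The factorisation with one root gives the dependence of \<open>C\<close> on integer shifts of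
  \<open>a n\<close>, and \<open>C\<close> is found at \<open>z k = - a k\<close> by letting \<open>a n\<close> tend to minus infinity.
\<close>

section \<open>Ratios of Gamma functions\<close>

text \<open>The condition Re(|b|-|a|) > n+|m| enters twice. Bordering by the |m| roots of
  \<open>R\<close> uses moments up to order n+|m|-1, and the condition makes them absolutely
  convergent. It also keeps the coefficient n+1+k-(|b|-|a|) of degree n+k in \<open>D\<close> s^k
  away from zero for k < |m|, so that these polynomials do complete the powers below n to a basis.

  With reciprocal Gamma functions every term is entire in the base point and in the parameters, so
  no poles have to be avoided in the Liouville argument or in the limits. The price is a bound on
  the weight over the whole plane, including the strip around the imaginary axis, and locally
  uniform in the parameters for the perturbation of \<open>a\<close>.

  The Liouville argument has to be sharp. Exponential growth alone would leave n+2 Fourier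
  coefficients; an extra power decay in the imaginary direction removes the two extreme ones. Then
  the n moments of order below n have a square matrix of coefficients, and their determinant at the
  points \<open>z k\<close> splits into a Vandermonde determinant in exp (2 pi i z_k) and a
  constant.\<close>

lemma norm_one_plus_le: "norm (1 + w :: complex) \<le> exp (Re w + (norm w)\<^sup>2 / 2)"
proof (rule power2_le_imp_le)
  have "(norm (1 + w))\<^sup>2 = 1 + (2 * Re w + (norm w)\<^sup>2)"
    unfolding cmod_power2 by (simp add: power2_eq_square algebra_simps)
  also have "\<dots> \<le> exp (2 * Re w + (norm w)\<^sup>2)"
    by (rule exp_ge_add_one_self)
  also have "\<dots> = (exp (Re w + (norm w)\<^sup>2 / 2))\<^sup>2"
    by (simp add: exp_double [symmetric] algebra_simps)
  finally show "(norm (1 + w))\<^sup>2 \<le> (exp (Re w + (norm w)\<^sup>2 / 2))\<^sup>2" .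
qed simp

lemma sum_inverse_squares_bounded: "(\<Sum>j<N. 1 / (1 + real j)\<^sup>2) \<le> pi\<^sup>2 / 6"
proof -
  have "(\<lambda>n. 1 / (1 + real n)\<^sup>2) sums (pi\<^sup>2 / 6)"
    using inverse_squares_sums by (simp add: add.commute)
  then show ?thesis
    by (intro sum_le_suminf[of _ "{..<N}", THEN order_trans]) (auto simp: sums_iff add_ac)
qed

lemma norm_ge_Re_plus:
  assumes "2 \<le> Re w"
  shows "1 + real j + 1 \<le> norm (w + of_nat j)"
proof -
  have "1 + real j + 1 \<le> Re (w + of_nat j)" using assms by simp
  also have "\<dots> \<le> norm (w + of_nat j)" by (rule complex_Re_le_cmod)
  finally show ?thesis .
qed

text \<open>Telescoping the logarithm leaves 1/u - Ln (1 + 1/u) at each u = w + j, which is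
  quadratically small. The bound 4 is absolute because Re w >= 2 gives |u| >= 1 + j and |1/u| <=
  1/2, and twice the sum of the inverse squares is pi^2/3.\<close>

lemma harmonic_vs_Ln:
  assumes "2 \<le> Re w"
  shows "norm ((\<Sum>j<N. 1 / (w + of_nat j)) - (Ln (w + of_nat N) - Ln w)) \<le> 4"
proof -
  have step: "norm (1 / (w + of_nat j) - (Ln (w + of_nat (Suc j)) - Ln (w + of_nat j))) \<le> 2 * (1 / (1 + real j)\<^sup>2)"
    for j
  proof -
    define u where "u = w + of_nat j"
    have u: "2 \<le> norm u" "1 + real j \<le> norm u" "0 < Re u" "u \<noteq> 0"
      using norm_ge_Re_plus[OF assms, of j] assms by (auto simp: u_def complex_eq_iff)
    have "norm (1 / u) \<le> 1 / 2" using u by (simp add: norm_divide field_simps)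
    \<comment> \<open>Both factors lie in the right half-plane, so their angles are below pi/2 and
      the principal logarithm is additive.\<close>
    have ax: "Ln (u * (1 + 1 / u)) = Ln u + Ln (1 + 1 / u)"
    proof (rule Ln_times_simple)
      have r1: "0 < Re (1 + 1 / u)" "0 < Re u"
        using u by (auto simp: Re_divide intro: add_pos_nonneg)
      then show "1 + 1 / u \<noteq> 0" "u \<noteq> 0" by (metis less_irrefl zero_complex.sel(1))+
      have "\<bar>Im (Ln u)\<bar> < pi / 2" "\<bar>Im (Ln (1 + 1 / u))\<bar> < pi / 2"
        using r1 by (metis Re_Ln_pos_lt_imp)+
      then show "- pi < Im (Ln u) + Im (Ln (1 + 1 / u))" "Im (Ln u) + Im (Ln (1 + 1 / u)) \<le> pi"
        by linarith+
    qed
    have "u * (1 + 1 / u) = w + of_nat (Suc j)" using u by (simp add: u_def field_simps)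
    with ax have "norm (1 / u - (Ln (w + of_nat (Suc j)) - Ln u)) = norm (Ln (1 + 1 / u) - 1 / u)"
      by (simp add: norm_minus_commute)
    also have "\<dots> \<le> (norm (1 / u))\<^sup>2 / (1 - norm (1 / u))"
      using \<open>norm (1 / u) \<le> 1 / 2\<close> by (intro Ln_approx_linear) linarith
    also have "\<dots> \<le> (norm (1 / u))\<^sup>2 / (1 / 2)"
      using \<open>norm (1 / u) \<le> 1 / 2\<close> by (intro divide_left_mono) (auto intro!: mult_pos_pos)
    also have "\<dots> = 2 * (norm (1 / u))\<^sup>2" by simp
    also have "\<dots> \<le> 2 * (1 / (1 + real j)\<^sup>2)"
      using u by (simp add: norm_divide power_divide) (intro divide_left_mono, auto intro!: power_mono)
    finally show ?thesis by (simp add: u_def)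
  qed
  have "(\<Sum>j<N. 1 / (w + of_nat j)) - (Ln (w + of_nat N) - Ln w) =
        (\<Sum>j<N. 1 / (w + of_nat j) - (Ln (w + of_nat (Suc j)) - Ln (w + of_nat j)))"
    using sum_lessThan_telescope[of "\<lambda>j. Ln (w + of_nat j)" N] by (simp add: sum_subtractf)
  also have "norm \<dots> \<le> (\<Sum>j<N. 2 * (1 / (1 + real j)\<^sup>2))"
    by (rule sum_norm_le) (use step in auto)
  also have "\<dots> \<le> 2 * (pi\<^sup>2 / 6)"
    unfolding sum_distrib_left[symmetric] using sum_inverse_squares_bounded[of N] by linarith
  also have "\<dots> \<le> 4"
  proof -
    have "pi\<^sup>2 \<le> 3.2\<^sup>2" using pi_less_4 pi_approx by (intro power_mono) auto
    then show ?thesis by (simp add: power2_eq_square)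
  qed
  finally show ?thesis .
qed

text \<open>Each factor is 1 + v with v = d/(w+j). Bounding its modulus by exp (Re v + |v|^2/2)
  takes no logarithm, so a factor may vanish. The linear terms are handled by
  \<open>harmonic_vs_Ln\<close>, the quadratic ones converge, and no constant depends on
  \<open>N\<close>, which allows the limit in the Gamma quotient.\<close>

lemma norm_pochhammer_ratio_le:
  assumes "2 \<le> Re w"
  shows "norm (pochhammer (w + d) N / pochhammer w N) \<le>
    exp (Re (d * (Ln (w + of_nat N) - Ln w)) + 4 * norm d + (norm d)\<^sup>2)"
proof -
  have nz: "w + of_nat j \<noteq> 0" for j using norm_ge_Re_plus[OF assms, of j] by auto
  have "norm (pochhammer (w + d) N / pochhammer w N) = (\<Prod>j<N. norm (1 + d / (w + of_nat j)))"
    unfolding pochhammer_prod prod_dividef[symmetric] prod_norm[symmetric] atLeast0LessThan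
    using nz by (intro prod.cong refl) (simp add: field_simps)
  also have "\<dots> \<le> (\<Prod>j<N. exp (Re (d / (w + of_nat j)) + (norm (d / (w + of_nat j)))\<^sup>2 / 2))"
    by (intro prod_mono conjI norm_one_plus_le) auto
  also have "\<dots> = exp (Re (d * (\<Sum>j<N. 1 / (w + of_nat j))) + (\<Sum>j<N. (norm (d / (w + of_nat j)))\<^sup>2 / 2))"
    by (simp add: exp_sum [symmetric] sum.distrib sum_distrib_left)
  also have "\<dots> \<le> exp (Re (d * (Ln (w + of_nat N) - Ln w)) + 4 * norm d + (norm d)\<^sup>2)"
  proof -
    have "Re (d * (\<Sum>j<N. 1 / (w + of_nat j))) - Re (d * (Ln (w + of_nat N) - Ln w)) =
      Re (d * ((\<Sum>j<N. 1 / (w + of_nat j)) - (Ln (w + of_nat N) - Ln w)))"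
      by (simp add: algebra_simps)
    also have "\<dots> \<le> norm (d * ((\<Sum>j<N. 1 / (w + of_nat j)) - (Ln (w + of_nat N) - Ln w)))"
      by (rule complex_Re_le_cmod)
    also have "\<dots> \<le> norm d * 4"
      unfolding norm_mult by (intro mult_left_mono harmonic_vs_Ln assms) auto
    finally have 1: "Re (d * (\<Sum>j<N. 1 / (w + of_nat j))) \<le> Re (d * (Ln (w + of_nat N) - Ln w)) + 4 * norm d"
      by simp
    have "(\<Sum>j<N. (norm (d / (w + of_nat j)))\<^sup>2 / 2) \<le> (\<Sum>j<N. (norm d)\<^sup>2 / 2 * (1 / (1 + real j)\<^sup>2))"
    proof (intro sum_mono)
      fix j
      have "(norm (d / (w + of_nat j)))\<^sup>2 / 2 = (norm d)\<^sup>2 / 2 * (1 / (norm (w + of_nat j))\<^sup>2)"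
        by (simp add: norm_divide power_divide)
      also have "\<dots> \<le> (norm d)\<^sup>2 / 2 * (1 / (1 + real j)\<^sup>2)"
        using norm_ge_Re_plus[OF assms, of j] nz[of j]
        by (intro mult_left_mono divide_left_mono power_mono) auto
      finally show "(norm (d / (w + of_nat j)))\<^sup>2 / 2 \<le> (norm d)\<^sup>2 / 2 * (1 / (1 + real j)\<^sup>2)" .
    qed
    also have "\<dots> \<le> (norm d)\<^sup>2 / 2 * (pi\<^sup>2 / 6)"
      unfolding sum_distrib_left[symmetric] by (intro mult_left_mono sum_inverse_squares_bounded) auto
    also have "\<dots> \<le> (norm d)\<^sup>2 / 2 * 2"
    proof -
      have "pi\<^sup>2 \<le> 3.2\<^sup>2" using pi_less_4 pi_approx by (intro power_mono) auto
      then show ?thesis by (intro mult_left_mono) (auto simp: power2_eq_square)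
    qed
    finally show ?thesis using 1 by simp
  qed
  finally show ?thesis .
qed

text \<open>An explicit substitute for Stirling's formula for a quotient of two Gamma functions,
  obtained as the limit of the Pochhammer bound along \<open>rGamma_series\<close>. Half of 8 |d|
  comes from \<open>harmonic_vs_Ln\<close>; the other half absorbs Im d times the argument of
  \<open>w\<close>.\<close>

lemma norm_Gamma_mult_rGamma_le:
  assumes "2 \<le> Re w"
  shows "norm (Gamma w * rGamma (w + d)) \<le> norm w powr (- Re d) * exp (8 * norm d + (norm d)\<^sup>2)"
proof -
  have w0: "w \<notin> \<int>\<^sub>\<le>\<^sub>0" using assms by (auto elim!: nonpos_Ints_cases)
  have "w \<noteq> 0" using assms by auto
  define B where "B = 4 * norm d + (norm d)\<^sup>2"
  have lim1: "(\<lambda>n. norm (rGamma_series (w + d) n / rGamma_series w n)) \<longlonglongrightarrow> norm (rGamma (w + d) / rGamma w)"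
    by (intro tendsto_intros) (use w0 in \<open>auto simp: rGamma_eq_zero_iff\<close>)
  \<comment> \<open>The power n^(-d) from \<open>rGamma_series\<close> is merged into the logarithm,
    whose argument then tends to 1.\<close>
  have lim2: "(\<lambda>n. exp (Re (d * (Ln ((w + of_nat (Suc n)) / of_nat n) - Ln w)) + B))
      \<longlonglongrightarrow> exp (Re (d * (Ln 1 - Ln w)) + B)"
  proof -
    have "(\<lambda>n. (w + of_nat (Suc n)) / of_nat n) \<longlonglongrightarrow> 1"
    proof -
      have "(\<lambda>n. 1 + (w + 1) * (1 / of_nat n)) \<longlonglongrightarrow> 1 + (w + 1) * 0"
        by (intro tendsto_intros lim_1_over_n)
      then have "(\<lambda>n. 1 + (w + 1) * (1 / of_nat n)) \<longlonglongrightarrow> 1" by simp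
      moreover have "eventually (\<lambda>n. 1 + (w + 1) * (1 / of_nat n) = (w + of_nat (Suc n)) / of_nat n) sequentially"
        using eventually_gt_at_top[of 0] by eventually_elim (simp add: field_simps)
      ultimately show ?thesis using tendsto_cong by fast
    qed
    then show ?thesis by (intro tendsto_intros) auto
  qed
  have "norm (rGamma (w + d) / rGamma w) \<le> exp (Re (d * (Ln 1 - Ln w)) + B)"
  proof (rule tendsto_le[OF _ lim2 lim1])
    show "eventually (\<lambda>n. norm (rGamma_series (w + d) n / rGamma_series w n) \<le>
        exp (Re (d * (Ln ((w + of_nat (Suc n)) / of_nat n) - Ln w)) + B)) sequentially"
      using eventually_gt_at_top[of 0]
    proof eventually_elim
      case (elim n)
      have e: "exp ((w + d) * of_real (ln (of_nat n))) = exp (w * of_real (ln (of_nat n))) * exp (d * of_real (ln (of_nat n)))"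
        by (simp add: algebra_simps exp_add)
      have "rGamma_series (w + d) n / rGamma_series w n =
        pochhammer (w + d) (Suc n) / pochhammer w (Suc n) * exp (- d * of_real (ln (of_nat n)))"
        unfolding rGamma_series_def e by (simp add: exp_minus field_simps)
      then have "norm (rGamma_series (w + d) n / rGamma_series w n) =
        norm (pochhammer (w + d) (Suc n) / pochhammer w (Suc n)) * exp (- Re d * ln (of_nat n))"
        by (simp only: norm_mult norm_exp_eq_Re) simp
      also have "\<dots> \<le> exp (Re (d * (Ln (w + of_nat (Suc n)) - Ln w)) + B) * exp (- Re d * ln (of_nat n))"
        unfolding B_def add.assoc[symmetric]
        by (intro mult_right_mono norm_pochhammer_ratio_le assms) auto
      also have "\<dots> = exp (Re (d * (Ln (w + of_nat (Suc n)) - of_real (ln (of_nat n)) - Ln w)) + B)"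
        by (simp add: exp_add [symmetric] algebra_simps)
      also have "Ln (w + of_nat (Suc n)) - of_real (ln (of_nat n)) = Ln ((w + of_nat (Suc n)) / of_nat n)"
        using elim assms Ln_divide_of_real[of "real n" "w + of_nat (Suc n)"] by (simp add: complex_eq_iff)
      finally show ?case .
    qed
  qed simp
  also have "Re (d * (Ln 1 - Ln w)) = - Re d * ln (norm w) + Im d * Im (Ln w)"
    using \<open>w \<noteq> 0\<close> by (simp add: Re_Ln)
  also have "exp (\<dots> + B) \<le> exp (- Re d * ln (norm w) + 4 * norm d + B)"
  proof -
    have "\<bar>Im (Ln w)\<bar> < pi / 2" using assms by (intro Re_Ln_pos_lt_imp) simp
    then have "\<bar>Im (Ln w)\<bar> \<le> 4" using pi_less_4 by linarith
    then have "\<bar>Im d * Im (Ln w)\<bar> \<le> norm d * 4"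
      unfolding abs_mult by (intro mult_mono abs_Im_le_cmod) auto
    then show ?thesis by simp
  qed
  also have "\<dots> = norm w powr (- Re d) * exp (8 * norm d + (norm d)\<^sup>2)"
    using \<open>w \<noteq> 0\<close> by (simp add: powr_def B_def exp_add [symmetric])
  finally show ?thesis by (simp add: rGamma_inverse_Gamma field_simps)
qed


section \<open>Bounds for pairs of reciprocal Gamma functions on the whole plane\<close>

lemma powr_le_powr_comparable:
  fixes x y e \<kappa> \<rho> :: real
  assumes "0 < x" "0 < y" "x \<le> \<kappa> * y" "y \<le> \<kappa> * x" "1 \<le> \<kappa>" "\<bar>e\<bar> \<le> \<rho>"
  shows "x powr e \<le> \<kappa> powr \<rho> * y powr e"
proof -
  have "x powr e / y powr e \<le> \<kappa> powr \<bar>e\<bar>"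
  proof (cases "0 \<le> e")
    case True
    have "x powr e / y powr e = (x / y) powr e" using assms by (simp add: powr_divide)
    also have "\<dots> \<le> \<kappa> powr e" using True assms by (intro powr_mono2) (auto simp: field_simps)
    finally show ?thesis using True by simp
  next
    case False
    have "x powr e / y powr e = (y / x) powr (- e)"
      using assms by (simp add: powr_divide powr_minus field_simps)
    also have "\<dots> \<le> \<kappa> powr (- e)" using False assms by (intro powr_mono2) (auto simp: field_simps)
    finally show ?thesis using False by simp
  qed
  also have "\<dots> \<le> \<kappa> powr \<rho>" using assms by (intro powr_mono) auto
  finally show ?thesis using assms by (simp add: field_simps)
qed

lemma norm_sin_le_exp: "norm (sin z :: complex) \<le> exp \<bar>Im z\<bar>"
proof -
  have "norm (sin z) \<le> (norm (exp (\<i> * z)) + norm (exp (- (\<i> * z)))) / 2"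
    unfolding sin_exp_eq using norm_triangle_ineq4[of "exp (\<i> * z)" "exp (- (\<i> * z))"]
    by (simp add: norm_divide norm_mult)
  also have "\<dots> \<le> exp \<bar>Im z\<bar>" by (simp add: abs_if)
  finally show ?thesis .
qed

text \<open>The pair is one factor of the weight, with u = a_i + s and d = b_i - a_i. By reflection
  it equals sin (pi u)/pi times Gamma(u)/Gamma(u+d): the sine causes the exponential growth, the
  quotient the power.\<close>

lemma rGamma_pair_bound_right:
  assumes "0 \<le> \<rho>"
  shows "\<exists>K>0. \<forall>u d. norm d \<le> \<rho> \<longrightarrow> 2 \<le> Re u \<longrightarrow>
    norm (rGamma (1 - u) * rGamma (u + d)) \<le> K * exp (pi * \<bar>Im u\<bar>) * (1 + norm u) powr (- Re d)"
proof (intro exI conjI allI impI)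
  show "0 < exp (8 * \<rho> + \<rho>\<^sup>2) * 2 powr \<rho>" by simp
next
  fix u d :: complex assume d: "norm d \<le> \<rho>" and u: "2 \<le> Re u"
  have "2 \<le> norm u" using u complex_Re_le_cmod[of u] by linarith
  have "u \<notin> \<int>\<^sub>\<le>\<^sub>0" using u by (auto elim!: nonpos_Ints_cases)
  then have "rGamma (1 - u) = sin (of_real pi * u) / of_real pi * Gamma u"
    using rGamma_reflection_complex[of u, symmetric] by (simp add: rGamma_inverse_Gamma Gamma_eq_zero_iff)
  then have "norm (rGamma (1 - u) * rGamma (u + d)) =
      norm (sin (of_real pi * u)) / pi * norm (Gamma u * rGamma (u + d))"
    by (simp add: norm_mult norm_divide)
  also have "\<dots> \<le> exp (pi * \<bar>Im u\<bar>) * (norm u powr (- Re d) * exp (8 * norm d + (norm d)\<^sup>2))"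
  proof (intro mult_mono norm_Gamma_mult_rGamma_le u)
    have "norm (sin (of_real pi * u)) / pi \<le> norm (sin (of_real pi * u)) / 1"
      using pi_gt3 by (intro divide_left_mono) auto
    also have "\<dots> \<le> exp (pi * \<bar>Im u\<bar>)" using norm_sin_le_exp[of "of_real pi * u"] by (simp add: abs_mult)
    finally show "norm (sin (of_real pi * u)) / pi \<le> exp (pi * \<bar>Im u\<bar>)" .
  qed auto
  also have "\<dots> \<le> exp (pi * \<bar>Im u\<bar>) * ((2 powr \<rho> * (1 + norm u) powr (- Re d)) * exp (8 * \<rho> + \<rho>\<^sup>2))"
  proof (intro mult_left_mono mult_mono)
    show "norm u powr (- Re d) \<le> 2 powr \<rho> * (1 + norm u) powr (- Re d)"
      using \<open>2 \<le> norm u\<close> d abs_Re_le_cmod[of d] by (intro powr_le_powr_comparable) auto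
    show "exp (8 * norm d + (norm d)\<^sup>2) \<le> exp (8 * \<rho> + \<rho>\<^sup>2)"
      using d by (auto intro!: add_mono power_mono)
  qed auto
  finally show "norm (rGamma (1 - u) * rGamma (u + d)) \<le>
      (exp (8 * \<rho> + \<rho>\<^sup>2) * 2 powr \<rho>) * exp (pi * \<bar>Im u\<bar>) * (1 + norm u) powr (- Re d)"
    by (simp add: mult_ac)
qed

lemma pochhammer_reflect: "pochhammer (1 - u - of_nat L) L = (- 1) ^ L * pochhammer (u :: 'a :: comm_ring_1) L"
  using pochhammer_minus'[of "- u" L] by (simp add: algebra_simps)

lemma norm_pochhammer_add_le:
  assumes "\<And>j. j < L \<Longrightarrow> 1 \<le> norm (u + of_nat j :: complex)"
  shows "norm (pochhammer (u + d) L) \<le> (1 + norm d) ^ L * norm (pochhammer u L)"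
proof -
  have "norm (pochhammer (u + d) L) = (\<Prod>j<L. norm (u + d + of_nat j))"
    by (simp add: pochhammer_prod prod_norm atLeast0LessThan)
  also have "\<dots> \<le> (\<Prod>j<L. (1 + norm d) * norm (u + of_nat j))"
  proof (intro prod_mono conjI)
    fix j assume "j \<in> {..<L}"
    have "norm (u + d + of_nat j) = norm ((u + of_nat j) + d)" by (simp add: algebra_simps)
    also have "\<dots> \<le> norm (u + of_nat j) + norm d * 1" using norm_triangle_ineq by simp
    also have "\<dots> \<le> norm (u + of_nat j) + norm d * norm (u + of_nat j)"
      using assms \<open>j \<in> {..<L}\<close> by (intro add_left_mono mult_left_mono) auto
    finally show "norm (u + d + of_nat j) \<le> (1 + norm d) * norm (u + of_nat j)" by (simp add: algebra_simps)
  qed auto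
  also have "\<dots> = (1 + norm d) ^ L * norm (pochhammer u L)"
    by (simp add: prod.distrib pochhammer_prod prod_norm atLeast0LessThan)
  finally show ?thesis .
qed

lemma rGamma_pair_shift:
  "pochhammer (u + d) L * (rGamma (1 - (u + of_nat L)) * rGamma (u + of_nat L + d)) =
   (- 1) ^ L * pochhammer u L * (rGamma (1 - u) * rGamma (u + d :: complex))"
proof -
  have "rGamma (1 - (u + of_nat L)) = (- 1) ^ L * pochhammer u L * rGamma (1 - u)"
    using pochhammer_rGamma[of "1 - u - of_nat L" L] unfolding pochhammer_reflect by (simp add: algebra_simps)
  moreover have "rGamma (u + d) = pochhammer (u + d) L * rGamma (u + of_nat L + d)"
    using pochhammer_rGamma[of "u + d" L] by (simp add: algebra_simps)
  ultimately show ?thesis by simp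
qed

text \<open>The substitution u -> 1-u-d swaps the two factors and so carries the bound from the
  right half-plane to the left. In the strip between, a point with |Im u| >= 1 is moved to the right
  by \<open>L\<close> steps, the factors u + j then being at least 1 in modulus; the rest of the
  strip is bounded and compactness applies.\<close>

lemma rGamma_pair_bound:
  assumes \<rho>: "0 \<le> \<rho>"
  shows "\<exists>K>0. \<forall>u d. norm d \<le> \<rho> \<longrightarrow>
    norm (rGamma (1 - u) * rGamma (u + d)) \<le> K * exp (pi * \<bar>Im u\<bar>) * (1 + norm u) powr (- Re d)"
proof -
  obtain K1 where K1: "K1 > 0" and b1: "\<And>u d. norm d \<le> \<rho> \<Longrightarrow> 2 \<le> Re u \<Longrightarrow>
    norm (rGamma (1 - u) * rGamma (u + d)) \<le> K1 * exp (pi * \<bar>Im u\<bar>) * (1 + norm u) powr (- Re d)"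
    using rGamma_pair_bound_right[OF \<rho>] by blast
  \<comment> \<open>The strip has Re u > -1 - \<open>\<rho>\<close>, so a shift by at least
    \<open>\<rho>\<close> + 3 reaches real part 2.\<close>
  define L where "L = nat \<lceil>\<rho>\<rceil> + 3"
  have L: "\<rho> + 3 \<le> real L" unfolding L_def using real_nat_ceiling_ge[of \<rho>] by simp
  have "compact (cball (0::complex) (\<rho> + 4) \<times> cball (0::complex) \<rho>)" by (intro compact_Times) auto
  moreover have "continuous_on (cball (0::complex) (\<rho> + 4) \<times> cball (0::complex) \<rho>)
      (\<lambda>x. rGamma (1 - fst x) * rGamma (fst x + snd x))"
    by (intro continuous_intros continuous_on_compose2[OF continuous_on_rGamma[of UNIV]]) auto
  ultimately have "bounded ((\<lambda>x. rGamma (1 - fst x) * rGamma (fst x + snd x)) ` (cball (0::complex) (\<rho> + 4) \<times> cball 0 \<rho>))"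
    by (intro compact_imp_bounded compact_continuous_image)
  then obtain B where B: "B > 0" and bB: "\<And>u d. norm u \<le> \<rho> + 4 \<Longrightarrow> norm d \<le> \<rho> \<Longrightarrow>
      norm (rGamma (1 - u) * rGamma (u + d :: complex)) \<le> B"
    unfolding bounded_pos by auto
  define K2 where "K2 = K1 * exp (pi * \<rho>) * (2 + \<rho>) powr \<rho>"
  define K3 where "K3 = (1 + \<rho>) ^ L * K1 * (1 + real L) powr \<rho>"
  define K4 where "K4 = B * (5 + \<rho>) powr \<rho>"
  have pos: "K1 > 0" "K2 > 0" "K3 > 0" "K4 > 0"
    using K1 B \<rho> by (auto simp: K2_def K3_def K4_def)
  have main: "norm (rGamma (1 - u) * rGamma (u + d)) \<le> (K1 + K2 + K3 + K4) * exp (pi * \<bar>Im u\<bar>) * (1 + norm u) powr (- Re d)"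
    if d: "norm d \<le> \<rho>" for u d :: complex
  proof -
    have Re_d: "\<bar>Re d\<bar> \<le> \<rho>" "\<bar>- Re d\<bar> \<le> \<rho>" using d abs_Re_le_cmod[of d] by auto
    have *: ?thesis if "norm (rGamma (1 - u) * rGamma (u + d)) \<le> K * exp (pi * \<bar>Im u\<bar>) * (1 + norm u) powr (- Re d)"
      and "K \<in> {K1, K2, K3, K4}" for K
    proof (rule order_trans[OF that(1)])
      show "K * exp (pi * \<bar>Im u\<bar>) * (1 + norm u) powr (- Re d) \<le> (K1 + K2 + K3 + K4) * exp (pi * \<bar>Im u\<bar>) * (1 + norm u) powr (- Re d)"
        using pos that(2) by (intro mult_right_mono) auto
    qed
    consider "2 \<le> Re u" | "Re (u + d) \<le> - 1" | "Re u < 2" "Re (u + d) > - 1" "1 \<le> \<bar>Im u\<bar>"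
      | "Re u < 2" "Re (u + d) > - 1" "\<bar>Im u\<bar> < 1" by linarith
    then show ?thesis
    proof cases
      case 1
      then show ?thesis using b1[OF d] by (intro *[of K1]) auto
    next
      case 2
      define v where "v = 1 - u - d"
      have "norm (rGamma (1 - u) * rGamma (u + d)) = norm (rGamma (1 - v) * rGamma (v + d))"
        by (simp add: v_def mult.commute)
      also have "\<dots> \<le> K1 * exp (pi * \<bar>Im v\<bar>) * (1 + norm v) powr (- Re d)"
        using 2 by (intro b1 d) (auto simp: v_def)
      also have "\<dots> \<le> K1 * exp (pi * (\<bar>Im u\<bar> + \<rho>)) * ((2 + \<rho>) powr \<rho> * (1 + norm u) powr (- Re d))"
      proof (intro mult_mono)
        show "exp (pi * \<bar>Im v\<bar>) \<le> exp (pi * (\<bar>Im u\<bar> + \<rho>))"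
          using d abs_Im_le_cmod[of d] by (auto simp: v_def)
        have "norm v \<le> 1 + norm u + \<rho>" unfolding v_def
          using norm_triangle_ineq4[of "1 - u" d] norm_triangle_ineq4[of 1 u] d by simp
        moreover have "norm u \<le> 1 + norm v + \<rho>"
        proof -
          have "norm u = norm (1 - v - d)" by (simp add: v_def)
          then show ?thesis using norm_triangle_ineq4[of "1 - v" d] norm_triangle_ineq4[of 1 v] d by simp
        qed
        moreover have "0 \<le> \<rho> * norm v" "0 \<le> \<rho> * norm u" using \<rho> by auto
        ultimately have "1 + norm v \<le> (2 + \<rho>) * (1 + norm u)" "1 + norm u \<le> (2 + \<rho>) * (1 + norm v)"
          using norm_ge_zero[of u] norm_ge_zero[of v] unfolding distrib_left distrib_right by linarith+
        then show "(1 + norm v) powr (- Re d) \<le> (2 + \<rho>) powr \<rho> * (1 + norm u) powr (- Re d)"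
          using \<rho> Re_d by (intro powr_le_powr_comparable) (auto simp: add_pos_nonneg)
      qed (use K1 in auto)
      also have "\<dots> = K2 * exp (pi * \<bar>Im u\<bar>) * (1 + norm u) powr (- Re d)"
        by (simp add: K2_def exp_add algebra_simps)
      finally show ?thesis by (intro *[of K2]) auto
    next
      case 3
      define v where "v = u + of_nat L"
      have ge1: "1 \<le> norm (u + of_nat j)" for j using abs_Im_le_cmod[of "u + of_nat j"] 3 by simp
      then have nz: "pochhammer u L \<noteq> 0"
        by (auto simp: pochhammer_eq_0_iff add_eq_0_iff2 dest: spec) (metis ge1 add.left_inverse norm_zero not_one_le_zero)
      have "norm (pochhammer u L) * norm (rGamma (1 - u) * rGamma (u + d)) =
          norm (pochhammer (u + d) L) * norm (rGamma (1 - v) * rGamma (v + d))"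
        using arg_cong[OF rGamma_pair_shift[of u d L], of norm] by (simp add: norm_mult norm_power v_def)
      also have "\<dots> \<le> ((1 + norm d) ^ L * norm (pochhammer u L)) *
          (K1 * exp (pi * \<bar>Im v\<bar>) * (1 + norm v) powr (- Re d))"
      proof (intro mult_mono b1 d norm_pochhammer_add_le ge1)
        show "2 \<le> Re v" using 3 L d abs_Re_le_cmod[of d] by (simp add: v_def)
      qed auto
      finally have "norm (pochhammer u L) * norm (rGamma (1 - u) * rGamma (u + d)) \<le>
         norm (pochhammer u L) * ((1 + norm d) ^ L * (K1 * exp (pi * \<bar>Im v\<bar>) * (1 + norm v) powr (- Re d)))"
        by (simp add: mult_ac)
      then have "norm (rGamma (1 - u) * rGamma (u + d)) \<le> (1 + norm d) ^ L * (K1 * exp (pi * \<bar>Im v\<bar>) * (1 + norm v) powr (- Re d))"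
        using nz by (subst (asm) mult_le_cancel_left) auto
      also have "\<dots> \<le> (1 + \<rho>) ^ L * (K1 * exp (pi * \<bar>Im u\<bar>) * ((1 + real L) powr \<rho> * (1 + norm u) powr (- Re d)))"
      proof (intro mult_mono power_mono)
        have "norm v \<le> norm u + L" unfolding v_def using norm_triangle_ineq[of u "of_nat L"] by simp
        moreover have "norm u \<le> norm v + L"
          unfolding v_def using norm_triangle_ineq4[of "u + of_nat L" "of_nat L"] by simp
        moreover have "0 \<le> real L * norm v" "0 \<le> real L * norm u" by (simp_all del: mult_eq_0_iff)
        ultimately have "1 + norm v \<le> (1 + real L) * (1 + norm u)" "1 + norm u \<le> (1 + real L) * (1 + norm v)"
          unfolding distrib_left distrib_right by linarith+
        then show "(1 + norm v) powr (- Re d) \<le> (1 + real L) powr \<rho> * (1 + norm u) powr (- Re d)"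
          using \<rho> Re_d by (intro powr_le_powr_comparable) (auto simp: add_pos_nonneg)
      qed (use K1 \<rho> d in \<open>auto simp: v_def\<close>)
      also have "\<dots> = K3 * exp (pi * \<bar>Im u\<bar>) * (1 + norm u) powr (- Re d)"
        by (simp add: K3_def algebra_simps)
      finally show ?thesis by (intro *[of K3]) auto
    next
      case 4
      have "\<bar>Re u\<bar> \<le> \<rho> + 2" using 4 Re_d \<rho> by auto
      then have u: "norm u \<le> \<rho> + 4" using cmod_le[of u] 4 by linarith
      have "norm (rGamma (1 - u) * rGamma (u + d)) \<le> B * 1 * 1" using bB[OF u d] by simp
      also have "\<dots> \<le> B * exp (pi * \<bar>Im u\<bar>) * ((5 + \<rho>) powr \<rho> * (1 + norm u) powr (- Re d))"
      proof (intro mult_mono)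
        have "1 powr (- Re d) \<le> (5 + \<rho>) powr \<rho> * (1 + norm u) powr (- Re d)"
        proof (intro powr_le_powr_comparable)
          show "1 \<le> (5 + \<rho>) * (1 + norm u)"
            using \<rho> mult_mono[of 1 "5 + \<rho>" 1 "1 + norm u"] by simp
        qed (use \<rho> Re_d u in \<open>auto simp: add_pos_nonneg\<close>)
        then show "1 \<le> (5 + \<rho>) powr \<rho> * (1 + norm u) powr (- Re d)" by simp
      qed (use B in auto)
      also have "\<dots> = K4 * exp (pi * \<bar>Im u\<bar>) * (1 + norm u) powr (- Re d)"
        by (simp add: K4_def algebra_simps)
      finally show ?thesis by (intro *[of K4]) auto
    qed
  qed
  have "K1 + K2 + K3 + K4 > 0" using pos by simp
  with main show ?thesis by blast
qed

section \<open>Bilateral sums\<close>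

lemma has_sum_sum_finite:
  fixes f :: "'i \<Rightarrow> 'a \<Rightarrow> 'b :: topological_comm_monoid_add"
  assumes "finite I" "\<And>i. i \<in> I \<Longrightarrow> (f i has_sum s i) A"
  shows "((\<lambda>x. \<Sum>i\<in>I. f i x) has_sum (\<Sum>i\<in>I. s i)) A"
  using assms by (induction I rule: finite_induct) (auto intro!: has_sum_add)

text \<open>Dominated convergence along a filter. The limit function is adjoined to the parameter
  set as the extra point \<open>None\<close>, so one application of the Weierstrass test
  approximates all the sums by the same finite partial sum.\<close>

lemma tendsto_infsum_dominated:
  fixes f :: "'a \<Rightarrow> 'b \<Rightarrow> 'c :: banach"
  assumes lim: "\<And>y. y \<in> A \<Longrightarrow> (f y \<longlongrightarrow> g y) F"
    and bound: "eventually (\<lambda>x. \<forall>y\<in>A. norm (f y x) \<le> M y) F"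
    and M: "M summable_on A" and F: "F \<noteq> bot"
  shows "((\<lambda>x. \<Sum>\<^sub>\<infinity>y\<in>A. f y x) \<longlongrightarrow> (\<Sum>\<^sub>\<infinity>y\<in>A. g y)) F"
proof (rule tendstoI)
  fix e :: real assume "e > 0"
  define h where "h = (\<lambda>y u. case u of None \<Rightarrow> g y | Some x \<Rightarrow> f y x)"
  define Y where "Y = insert None (Some ` {x. \<forall>y\<in>A. norm (f y x) \<le> M y})"
  have gM: "norm (g y) \<le> M y" if "y \<in> A" for y
  proof (rule tendsto_upperbound[OF tendsto_norm[OF lim[OF that]] _ F])
    show "eventually (\<lambda>x. norm (f y x) \<le> M y) F" using bound by eventually_elim (use that in auto)
  qed
  have "uniform_limit Y (\<lambda>X u. \<Sum>y\<in>X. h y u) (\<lambda>u. \<Sum>\<^sub>\<infinity>y\<in>A. h y u) (finite_subsets_at_top A)"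
    by (rule Weierstrass_m_test_general[OF _ M]) (auto simp: Y_def h_def gM)
  from uniform_limitD[OF this, of "e / 3"] \<open>e > 0\<close>
  obtain X where X: "finite X" "X \<subseteq> A"
    and dX: "\<forall>u\<in>Y. dist (\<Sum>y\<in>X. h y u) (\<Sum>\<^sub>\<infinity>y\<in>A. h y u) < e / 3"
    by (auto simp: eventually_finite_subsets_at_top)
  have "((\<lambda>x. \<Sum>y\<in>X. f y x) \<longlongrightarrow> (\<Sum>y\<in>X. g y)) F"
    by (intro tendsto_sum lim) (use X in auto)
  then have "eventually (\<lambda>x. dist (\<Sum>y\<in>X. f y x) (\<Sum>y\<in>X. g y) < e / 3) F"
    by (rule tendstoD) (use \<open>e > 0\<close> in simp)
  with bound show "eventually (\<lambda>x. dist (\<Sum>\<^sub>\<infinity>y\<in>A. f y x) (\<Sum>\<^sub>\<infinity>y\<in>A. g y) < e) F"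
  proof eventually_elim
    case (elim x)
    then have "Some x \<in> Y" by (auto simp: Y_def)
    with dX have "dist (\<Sum>y\<in>X. h y (Some x)) (\<Sum>\<^sub>\<infinity>y\<in>A. h y (Some x)) < e / 3" by blast
    then have 1: "dist (\<Sum>y\<in>X. f y x) (\<Sum>\<^sub>\<infinity>y\<in>A. f y x) < e / 3" by (simp add: h_def)
    have "None \<in> Y" by (simp add: Y_def)
    with dX have "dist (\<Sum>y\<in>X. h y None) (\<Sum>\<^sub>\<infinity>y\<in>A. h y None) < e / 3" by blast
    then have "dist (\<Sum>y\<in>X. g y) (\<Sum>\<^sub>\<infinity>y\<in>A. g y) < e / 3" by (simp add: h_def)
    with 1 elim(2) show ?case
      using dist_triangle[of "\<Sum>\<^sub>\<infinity>y\<in>A. f y x" "\<Sum>\<^sub>\<infinity>y\<in>A. g y" "\<Sum>y\<in>X. f y x"]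
        dist_triangle[of "\<Sum>y\<in>X. f y x" "\<Sum>\<^sub>\<infinity>y\<in>A. g y" "\<Sum>y\<in>X. g y"]
      by (simp add: dist_commute)
  qed
qed

lemma summable_on_int_powr:
  assumes "e < - 1"
  shows "(\<lambda>y::int. (1 + \<bar>real_of_int y\<bar>) powr e) summable_on UNIV"
proof -
  have "(\<lambda>n. real n powr e) summable_on UNIV"
    using assms by (simp add: summable_on_UNIV_nonneg_real_iff summable_real_powr_iff)
  then have "(\<lambda>n. real n powr e) summable_on range Suc" by (rule summable_on_subset_banach) auto
  then have nat: "(\<lambda>n. (1 + real n) powr e) summable_on UNIV"
    by (subst (asm) summable_on_reindex) (auto simp: o_def add_ac)
  have "(\<lambda>y::int. (1 + \<bar>real_of_int y\<bar>) powr e) summable_on (range int \<union> range (\<lambda>n. - int n))"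
  proof (rule summable_on_union)
    show "(\<lambda>y::int. (1 + \<bar>real_of_int y\<bar>) powr e) summable_on range int"
      using nat by (subst summable_on_reindex) (auto simp: o_def)
    show "(\<lambda>y::int. (1 + \<bar>real_of_int y\<bar>) powr e) summable_on range (\<lambda>n. - int n)"
      using nat by (subst summable_on_reindex) (auto simp: o_def inj_def)
  qed
  also have "range int \<union> range (\<lambda>n. - int n) = UNIV"
    by (auto intro: rangeI) (metis int_cases2 rangeI)
  finally show ?thesis .
qed

lemma has_sum_telescope_int:
  fixes T :: "int \<Rightarrow> 'a :: {banach}"
  assumes "(\<lambda>y. T (y + 1) - T y) summable_on UNIV"
    and "(\<lambda>N. T (int N)) \<longlonglongrightarrow> 0" "(\<lambda>N. T (- int N)) \<longlonglongrightarrow> 0"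
  shows "((\<lambda>y. T (y + 1) - T y) has_sum 0) UNIV"
proof -
  obtain S where S: "((\<lambda>y. T (y + 1) - T y) has_sum S) UNIV"
    using assms(1) by (auto simp: summable_on_def)
  have "filterlim (\<lambda>N. {- int N..<int N}) (finite_subsets_at_top UNIV) sequentially"
    unfolding filterlim_finite_subsets_at_top
  proof safe
    fix X :: "int set" assume "finite X"
    then have "\<bar>x\<bar> < Max (abs ` X) + 1" if "x \<in> X" for x
      using Max_ge[of "abs ` X" "\<bar>x\<bar>"] that by simp
    then obtain B where B: "\<forall>x\<in>X. \<bar>x\<bar> < B" by blast
    show "\<forall>\<^sub>F N in sequentially. finite {- int N..<int N} \<and> X \<subseteq> {- int N..<int N} \<and> {- int N..<int N} \<subseteq> UNIV"
      using eventually_ge_at_top[of "nat B"] by eventually_elim (use B in \<open>force simp: abs_less_iff\<close>)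
  qed
  with S have "(\<lambda>N. \<Sum>y\<in>{- int N..<int N}. T (y + 1) - T y) \<longlonglongrightarrow> S"
    unfolding has_sum_def by (rule filterlim_compose)
  also have "(\<lambda>N. \<Sum>y\<in>{- int N..<int N}. T (y + 1) - T y) = (\<lambda>N. T (int N) - T (- int N))"
  proof
    fix N
    have "(\<Sum>y\<in>{- int N..<int N}. T (y + 1) - T y) = (\<Sum>k<2 * N. T (int (Suc k) - int N) - T (int k - int N))"
      by (rule sum.reindex_bij_witness[of _ "\<lambda>k. int k - int N" "\<lambda>y. nat (y + int N)"])
         (auto simp: algebra_simps)
    also have "\<dots> = T (int (2 * N) - int N) - T (int 0 - int N)"
      by (rule sum_lessThan_telescope)
    finally show "(\<Sum>y\<in>{- int N..<int N}. T (y + 1) - T y) = T (int N) - T (- int N)" by simp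
  qed
  finally have "(\<lambda>N. T (int N) - T (- int N)) \<longlonglongrightarrow> S" .
  moreover have "(\<lambda>N. T (int N) - T (- int N)) \<longlonglongrightarrow> 0 - 0" by (intro tendsto_diff assms)
  ultimately have "S = 0" using LIMSEQ_unique by fastforce
  with S show ?thesis by simp
qed

section \<open>The weight and its decay\<close>

definition kern :: "nat \<Rightarrow> (nat \<Rightarrow> complex) \<Rightarrow> (nat \<Rightarrow> complex) \<Rightarrow> complex \<Rightarrow> complex" where
  "kern n a b s = (\<Prod>i\<le>n. rGamma (1 - a i - s) * rGamma (b i + s))"

definition excess :: "nat \<Rightarrow> (nat \<Rightarrow> complex) \<Rightarrow> (nat \<Rightarrow> complex) \<Rightarrow> complex" where
  "excess n a b = (\<Sum>i\<le>n. b i) - (\<Sum>i\<le>n. a i)"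

text \<open>\<open>K\<close> depends only on \<open>n\<close> and on the bound for the parameters,
  while the exponent follows the actual \<open>excess\<close>; the perturbation of \<open>a\<close>
  in \<open>moment_det_eq\<close> relies on this uniformity.\<close>

lemma kern_bound:
  assumes \<rho>: "0 \<le> \<rho>"
  shows "\<exists>K>0. \<forall>a b s. (\<forall>i\<le>n. norm (a i) \<le> \<rho> \<and> norm (b i) \<le> \<rho>) \<longrightarrow>
    norm (kern n a b s) \<le> K * exp (real (n + 1) * pi * \<bar>Im s\<bar>) * (1 + norm s) powr (- Re (excess n a b))"
proof -
  obtain K where K: "K > 0" and b: "\<And>u d. norm d \<le> 2 * \<rho> \<Longrightarrow>
    norm (rGamma (1 - u) * rGamma (u + d)) \<le> K * exp (pi * \<bar>Im u\<bar>) * (1 + norm u) powr (- Re d)"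
    using rGamma_pair_bound[of "2 * \<rho>"] \<rho> by auto
  define K' where "K' = K * exp (pi * \<rho>) * (1 + \<rho>) powr (2 * \<rho>)"
  have "K' > 0" using K \<rho> by (simp add: K'_def)
  show ?thesis
  proof (intro exI[of _ "K' ^ (n + 1)"] conjI allI impI)
    show "K' ^ (n + 1) > 0" using \<open>K' > 0\<close> by simp
  next
    fix a b :: "nat \<Rightarrow> complex" and s
    assume ab: "\<forall>i\<le>n. norm (a i) \<le> \<rho> \<and> norm (b i) \<le> \<rho>"
    have *: "norm (rGamma (1 - a i - s) * rGamma (b i + s)) \<le>
        K' * exp (pi * \<bar>Im s\<bar>) * (1 + norm s) powr (- Re (b i - a i))" if "i \<le> n" for i
    proof -
      define u d where "u = a i + s" and "d = b i - a i"
      have ai: "norm (a i) \<le> \<rho>" and bi: "norm (b i) \<le> \<rho>" using ab that by auto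
      have d: "norm d \<le> 2 * \<rho>" using norm_triangle_ineq4[of "b i" "a i"] ai bi by (simp add: d_def)
      have "rGamma (1 - a i - s) * rGamma (b i + s) = rGamma (1 - u) * rGamma (u + d)"
        by (simp add: u_def d_def algebra_simps)
      also have "norm \<dots> \<le> K * exp (pi * \<bar>Im u\<bar>) * (1 + norm u) powr (- Re d)" by (rule b[OF d])
      also have "\<dots> \<le> K * exp (pi * (\<rho> + \<bar>Im s\<bar>)) * ((1 + \<rho>) powr (2 * \<rho>) * (1 + norm s) powr (- Re d))"
      proof (intro mult_mono)
        show "exp (pi * \<bar>Im u\<bar>) \<le> exp (pi * (\<rho> + \<bar>Im s\<bar>))"
          using abs_Im_le_cmod[of "a i"] ai by (auto simp: u_def)
        have "norm u \<le> \<rho> + norm s" using norm_triangle_ineq[of "a i" s] ai by (simp add: u_def)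
        moreover have "norm s \<le> \<rho> + norm u"
          using norm_triangle_ineq4[of u "a i"] ai by (simp add: u_def)
        moreover have "0 \<le> \<rho> * norm u" "0 \<le> \<rho> * norm s" using \<rho> by auto
        ultimately have "1 + norm u \<le> (1 + \<rho>) * (1 + norm s)" "1 + norm s \<le> (1 + \<rho>) * (1 + norm u)"
          unfolding distrib_left distrib_right by linarith+
        then show "(1 + norm u) powr (- Re d) \<le> (1 + \<rho>) powr (2 * \<rho>) * (1 + norm s) powr (- Re d)"
          using \<rho> abs_Re_le_cmod[of d] d by (intro powr_le_powr_comparable) (auto simp: add_pos_nonneg)
      qed (use K in auto)
      also have "\<dots> = K' * exp (pi * \<bar>Im s\<bar>) * (1 + norm s) powr (- Re (b i - a i))"
        by (simp add: K'_def d_def exp_add algebra_simps)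
      finally show ?thesis .
    qed
    have pos: "1 + norm s > 0" by (simp add: add_pos_nonneg)
    have "norm (kern n a b s) = (\<Prod>i\<le>n. norm (rGamma (1 - a i - s) * rGamma (b i + s)))"
      by (simp add: kern_def prod_norm)
    also have "\<dots> \<le> (\<Prod>i\<le>n. K' * exp (pi * \<bar>Im s\<bar>) * (1 + norm s) powr (- Re (b i - a i)))"
      by (intro prod_mono conjI *) auto
    also have "\<dots> = K' ^ (n + 1) * exp (pi * \<bar>Im s\<bar>) ^ (n + 1) * (1 + norm s) powr (\<Sum>i\<le>n. - Re (b i - a i))"
      using pos by (simp add: prod.distrib powr_sum power_mult_distrib)
    also have "exp (pi * \<bar>Im s\<bar>) ^ (n + 1) = exp (real (n + 1) * pi * \<bar>Im s\<bar>)"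
      by (simp only: exp_of_nat_mult [symmetric] mult.assoc)
    also have "(\<Sum>i\<le>n. - Re (b i - a i)) = - Re (excess n a b)"
      by (simp add: excess_def sum_subtractf)
    finally show "norm (kern n a b s) \<le> K' ^ (n + 1) * exp (real (n + 1) * pi * \<bar>Im s\<bar>) * (1 + norm s) powr (- Re (excess n a b))" .
  qed
qed

lemma kern_plus1:
  "kern n a b (s + 1) * (\<Prod>i\<le>n. b i + s) = (- 1) ^ (n + 1) * (\<Prod>i\<le>n. a i + s) * kern n a b s"
proof -
  have "rGamma (1 - a i - (s + 1)) * rGamma (b i + (s + 1)) * (b i + s) =
      (- 1) * (a i + s) * (rGamma (1 - a i - s) * rGamma (b i + s))" for i
  proof -
    have 1: "rGamma (1 - a i - (s + 1)) = - (a i + s) * rGamma (1 - a i - s)"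
    proof -
      have "1 - a i - s = (- a i - s) + 1" "1 - a i - (s + 1) = - a i - s" "- (a i + s) = - a i - s" by simp_all
      then show ?thesis using rGamma_plus1[of "- a i - s"] by metis
    qed
    have 2: "rGamma (b i + s) = (b i + s) * rGamma (b i + (s + 1))"
      using rGamma_plus1[of "b i + s"] by (simp add: add.assoc)
    show ?thesis unfolding 1 2 by (simp add: mult_ac)
  qed
  then have "(\<Prod>i\<le>n. rGamma (1 - a i - (s + 1)) * rGamma (b i + (s + 1)) * (b i + s)) =
      (\<Prod>i\<le>n. (- 1) * (a i + s) * (rGamma (1 - a i - s) * rGamma (b i + s)))"
    by simp
  then show ?thesis unfolding kern_def prod.distrib by (simp add: prod_uminus)
qed

text \<open>The sign cancels the factor (-1)^(n+1) that appears in \<open>kern_plus1\<close>, so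
  that \<open>bweight\<close> obeys the recurrence of the quotients of shifted factorials
  (\<open>bweight_plus1\<close>). Unlike these it is entire in \<open>z\<close> and in the
  parameters.\<close>

definition bweight :: "nat \<Rightarrow> (nat \<Rightarrow> complex) \<Rightarrow> (nat \<Rightarrow> complex) \<Rightarrow> complex \<Rightarrow> int \<Rightarrow> complex" where
  "bweight n a b z y = ((- 1) ^ (n + 1)) powi y * kern n a b (z + of_int y)"

lemma norm_bweight: "norm (bweight n a b z y) = norm (kern n a b (z + of_int y))"
  by (simp add: bweight_def norm_mult norm_power_int norm_power)

lemma bweight_plus1:
  "bweight n a b z (y + 1) * (\<Prod>i\<le>n. b i + (z + of_int y)) = (\<Prod>i\<le>n. a i + (z + of_int y)) * bweight n a b z y"
proof -
  let ?e = "(- 1) ^ (n + 1) :: complex"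
  have "?e * ?e = 1" by (simp add: power_mult_distrib[symmetric])
  have "bweight n a b z (y + 1) * (\<Prod>i\<le>n. b i + (z + of_int y)) =
    ?e powi y * ?e * (kern n a b (z + of_int y + 1) * (\<Prod>i\<le>n. b i + (z + of_int y)))"
  proof -
    have "?e powi (y + 1) = ?e powi y * ?e" by (rule power_int_add_1) auto
    then show ?thesis by (simp only: bweight_def of_int_add of_int_1 add.assoc mult.assoc)
  qed
  also have "\<dots> = (?e * ?e) * ((\<Prod>i\<le>n. a i + (z + of_int y)) * bweight n a b z y)"
    unfolding kern_plus1 by (simp only: bweight_def mult_ac)
  finally show ?thesis using \<open>?e * ?e = 1\<close> by simp
qed

text \<open>The right side serves as majorant both for the Weierstrass test in \<open>z\<close> and
  for the limit in \<open>a\<close>, hence \<open>\<sigma>\<close> as a lower bound for the varying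
  \<open>excess\<close>. With j <= \<open>\<sigma>\<close> the exponent is nonpositive, which is
  what replacing |s| by |y| requires.\<close>

lemma bterm_bound:
  assumes "0 \<le> \<rho>" "0 \<le> R" "real j \<le> \<sigma>"
  shows "\<exists>K>0. \<forall>a b z y. (\<forall>i\<le>n. norm (a i) \<le> \<rho> \<and> norm (b i) \<le> \<rho>) \<longrightarrow> norm z \<le> R \<longrightarrow> \<sigma> \<le> Re (excess n a b) \<longrightarrow>
    norm (bweight n a b z y * (z + of_int y) ^ j) \<le> K * (1 + \<bar>real_of_int y\<bar>) powr (real j - \<sigma>)"
proof -
  obtain K where K: "K > 0" and b: "\<And>a b s. (\<forall>i\<le>n. norm (a i) \<le> \<rho> \<and> norm (b i) \<le> \<rho>) \<Longrightarrow>
    norm (kern n a b s) \<le> K * exp (real (n + 1) * pi * \<bar>Im s\<bar>) * (1 + norm s) powr (- Re (excess n a b))"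
    using kern_bound[OF assms(1), of n] by blast
  define K' where "K' = K * exp (real (n + 1) * pi * R) * (1 + R) powr (\<sigma> - real j)"
  have "K' > 0" using K assms by (simp add: K'_def)
  moreover have "norm (bweight n a b z y * (z + of_int y) ^ j) \<le> K' * (1 + \<bar>real_of_int y\<bar>) powr (real j - \<sigma>)"
    if ab: "\<forall>i\<le>n. norm (a i) \<le> \<rho> \<and> norm (b i) \<le> \<rho>" and z: "norm z \<le> R" and e: "\<sigma> \<le> Re (excess n a b)" for a b z y
  proof -
    define s where "s = z + of_int y"
    have Im: "\<bar>Im s\<bar> \<le> R" using abs_Im_le_cmod[of z] z by (simp add: s_def)
    have pos: "1 + norm s > 0" by (simp add: add_pos_nonneg)
    have "norm (bweight n a b z y * s ^ j) = norm (kern n a b s) * norm s ^ j"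
      by (simp add: norm_mult norm_bweight s_def norm_power)
    also have "\<dots> \<le> (K * exp (real (n + 1) * pi * R) * (1 + norm s) powr (- \<sigma>)) * (1 + norm s) ^ j"
    proof (intro mult_mono power_mono order_trans[OF b[OF ab]])
      have "real (n + 1) * pi * \<bar>Im s\<bar> \<le> real (n + 1) * pi * R" using Im by (intro mult_left_mono) auto
      then show "exp (real (n + 1) * pi * \<bar>Im s\<bar>) \<le> exp (real (n + 1) * pi * R)" by simp
      show "(1 + norm s) powr (- Re (excess n a b)) \<le> (1 + norm s) powr (- \<sigma>)"
        using e by (intro powr_mono) auto
    qed (use K in auto)
    also have "\<dots> = K * exp (real (n + 1) * pi * R) * (1 + norm s) powr (real j - \<sigma>)"
      using pos by (simp add: powr_realpow [symmetric] powr_add [symmetric])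
    also have "\<dots> \<le> K * exp (real (n + 1) * pi * R) * ((1 + R) powr (\<sigma> - real j) * (1 + \<bar>real_of_int y\<bar>) powr (real j - \<sigma>))"
    proof (intro mult_left_mono)
      have "\<bar>real_of_int y\<bar> = norm (s - z)" by (simp add: s_def)
      also have "\<dots> \<le> norm s + R" using norm_triangle_ineq4[of s z] z by linarith
      finally have "1 + \<bar>real_of_int y\<bar> \<le> (1 + R) * (1 + norm s)"
        using assms(2) mult_nonneg_nonneg[OF assms(2) norm_ge_zero[of s]] unfolding distrib_left distrib_right by linarith
      then have "(1 + \<bar>real_of_int y\<bar>) powr (\<sigma> - real j) \<le> ((1 + R) * (1 + norm s)) powr (\<sigma> - real j)"
        using assms by (intro powr_mono2) auto
      then have "(1 + \<bar>real_of_int y\<bar>) powr (\<sigma> - real j) \<le> (1 + R) powr (\<sigma> - real j) * (1 + norm s) powr (\<sigma> - real j)"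
        using assms pos by (simp add: powr_mult)
      moreover have "x powr (real j - \<sigma>) = 1 / x powr (\<sigma> - real j)" for x :: real
        using powr_minus_divide[of x "\<sigma> - real j"] by simp
      ultimately show "(1 + norm s) powr (real j - \<sigma>) \<le> (1 + R) powr (\<sigma> - real j) * (1 + \<bar>real_of_int y\<bar>) powr (real j - \<sigma>)"
        using pos by (simp add: pos_divide_le_eq mult.commute)
    qed (use K in auto)
    finally show ?thesis by (simp add: s_def K'_def mult_ac)
  qed
  ultimately show ?thesis by blast
qed

lemma bounded_parameters:
  fixes n :: nat
  obtains \<rho> :: real where "0 \<le> \<rho>" "\<forall>i\<le>n. norm (a i :: complex) \<le> \<rho> \<and> norm (b i :: complex) \<le> \<rho>"
proof
  show "0 \<le> (\<Sum>i\<le>n. norm (a i) + norm (b i))" by (intro sum_nonneg) auto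
  show "\<forall>i\<le>n. norm (a i) \<le> (\<Sum>i\<le>n. norm (a i) + norm (b i)) \<and> norm (b i) \<le> (\<Sum>i\<le>n. norm (a i) + norm (b i))"
  proof (intro allI impI)
    fix i assume "i \<le> n"
    then have "norm (a i) + norm (b i) \<le> (\<Sum>i\<le>n. norm (a i) + norm (b i))"
      by (intro member_le_sum) auto
    moreover have "0 \<le> norm (a i)" "0 \<le> norm (b i)" by auto
    ultimately show "norm (a i) \<le> (\<Sum>i\<le>n. norm (a i) + norm (b i)) \<and> norm (b i) \<le> (\<Sum>i\<le>n. norm (a i) + norm (b i))"
      by linarith
  qed
qed

lemma bterm_bound1:
  assumes "real j \<le> Re (excess n a b)"
  shows "\<exists>K>0. \<forall>y. norm (bweight n a b z y * (z + of_int y) ^ j) \<le> K * (1 + \<bar>real_of_int y\<bar>) powr (real j - Re (excess n a b))"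
proof -
  obtain \<rho> :: real where \<rho>: "0 \<le> \<rho>" "\<forall>i\<le>n. norm (a i) \<le> \<rho> \<and> norm (b i) \<le> \<rho>"
    using bounded_parameters by metis
  show ?thesis using bterm_bound[OF \<rho>(1) norm_ge_zero[of z] assms, of n] \<rho>(2) by blast
qed

lemma abs_summable_bterm:
  assumes "real j + 1 < Re (excess n a b)"
  shows "(\<lambda>y. norm (bweight n a b z y * (z + of_int y) ^ j)) summable_on UNIV"
proof -
  obtain K where K: "\<forall>y. norm (bweight n a b z y * (z + of_int y) ^ j) \<le> K * (1 + \<bar>real_of_int y\<bar>) powr (real j - Re (excess n a b))"
    using bterm_bound1[of j n a b z] assms by auto
  show ?thesis
    by (rule Infinite_Sum.abs_summable_on_comparison_test'[where g = "\<lambda>y. K * (1 + \<bar>real_of_int y\<bar>) powr (real j - Re (excess n a b))"])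
       (use K assms in \<open>auto intro!: summable_on_cmult_right summable_on_int_powr\<close>)
qed


section \<open>Moments and the polynomials they annihilate\<close>

definition moment :: "nat \<Rightarrow> (nat \<Rightarrow> complex) \<Rightarrow> (nat \<Rightarrow> complex) \<Rightarrow> complex \<Rightarrow> nat \<Rightarrow> complex" where
  "moment n a b z j = (\<Sum>\<^sub>\<infinity>y. bweight n a b z y * (z + of_int y) ^ j)"

lemma has_sum_moment:
  assumes "real j + 1 < Re (excess n a b)"
  shows "((\<lambda>y. bweight n a b z y * (z + of_int y) ^ j) has_sum moment n a b z j) UNIV"
  unfolding moment_def using abs_summable_summable[OF abs_summable_bterm[OF assms]] by (rule has_sum_infsum)

lemma poly_eq_sum_coeff:
  fixes f :: "complex poly"
  assumes "\<And>j. N \<le> j \<Longrightarrow> coeff f j = 0"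
  shows "poly f x = (\<Sum>j<N. coeff f j * x ^ j)"
proof -
  have "poly f x = (\<Sum>j\<le>degree f. coeff f j * x ^ j)" by (rule poly_altdef)
  also have "\<dots> = (\<Sum>j<N. coeff f j * x ^ j)"
  proof (rule sum.mono_neutral_cong)
    fix i assume "i \<in> {..degree f} - {..<N}"
    then show "coeff f i * x ^ i = 0" using assms by simp
  next
    fix i assume "i \<in> {..<N} - {..degree f}"
    then show "coeff f i * x ^ i = 0" by (simp add: coeff_eq_0)
  qed auto
  finally show ?thesis .
qed

lemma has_sum_poly_moment:
  assumes "real N < Re (excess n a b)" "\<And>j. N \<le> j \<Longrightarrow> coeff f j = 0"
  shows "((\<lambda>y. bweight n a b z y * poly f (z + of_int y)) has_sum (\<Sum>j<N. moment n a b z j * coeff f j)) UNIV"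
proof -
  note f = poly_eq_sum_coeff[OF assms(2)]
  have "((\<lambda>y. \<Sum>j<N. bweight n a b z y * (z + of_int y) ^ j * coeff f j) has_sum (\<Sum>j<N. moment n a b z j * coeff f j)) UNIV"
    by (intro has_sum_sum_finite has_sum_cmult_left has_sum_moment) (use assms(1) in auto)
  then show ?thesis by (simp add: f sum_distrib_left mult_ac)
qed

text \<open>\<open>P\<close> is monic of degree d+1 with second coefficient \<open>c\<close>. Two
  coefficients are tracked because the leading terms of the two products in \<open>Dpoly\<close>
  cancel.\<close>

definition monic2 :: "complex poly \<Rightarrow> nat \<Rightarrow> complex \<Rightarrow> bool" where
  "monic2 P d c \<longleftrightarrow> coeff P (Suc d) = 1 \<and> coeff P d = c \<and> (\<forall>k>Suc d. coeff P k = 0)"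

lemma monic2_mult: "monic2 P d c \<Longrightarrow> monic2 ([:u, 1:] * P) (Suc d) (c + u)"
  by (auto simp: monic2_def coeff_pCons split: nat.splits)

lemma monic2_prod: "monic2 (\<Prod>i\<le>n. [:u i, 1:]) n (\<Sum>i\<le>n. u i)"
proof (induction n)
  case 0
  show ?case by (auto simp: monic2_def coeff_pCons split: nat.splits)
next
  case (Suc n)
  then show ?case using monic2_mult[OF Suc, of "u (Suc n)"] by (simp add: mult.commute)
qed

lemma monic2_power: "monic2 P d c \<Longrightarrow> monic2 ([:u, 1:] ^ k * P) (d + k) (c + of_nat k * u)"
proof (induction k)
  case (Suc k)
  then show ?case using monic2_mult[of "[:u, 1:] ^ k * P" "d + k" "c + of_nat k * u" u]
    by (simp add: algebra_simps)
qed simp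

text \<open>The bilateral sums annihilate the image of this operator: it is the numerator of a telescoping difference.\<close>
definition Dpoly :: "nat \<Rightarrow> (nat \<Rightarrow> complex) \<Rightarrow> (nat \<Rightarrow> complex) \<Rightarrow> nat \<Rightarrow> complex poly" where
  "Dpoly n a b k = [:1, 1:] ^ k * (\<Prod>i\<le>n. [:a i, 1:]) - [:0, 1:] ^ k * (\<Prod>i\<le>n. [:b i - 1, 1:])"

lemma poly_Dpoly:
  "poly (Dpoly n a b k) s = (\<Prod>i\<le>n. a i + s) * (s + 1) ^ k - (\<Prod>i\<le>n. b i - 1 + s) * s ^ k"
  by (simp add: Dpoly_def poly_prod poly_power mult_ac add_ac)

text \<open>The second coefficients of the two products are |a| + k and |b| - (n+1). Their
  differences for k = 0, 1, ... later build, up to sign, the Pochhammer symbol between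
  Gamma(|b|-|a|-|m|-n) and Gamma(|b|-|a|-n).\<close>

lemma coeff_Dpoly:
  shows "coeff (Dpoly n a b k) (n + k) = of_nat (n + 1 + k) - excess n a b"
    and "n + k < j \<Longrightarrow> coeff (Dpoly n a b k) j = 0"
proof -
  have 1: "monic2 ([:1, 1:] ^ k * (\<Prod>i\<le>n. [:a i, 1:])) (n + k) ((\<Sum>i\<le>n. a i) + of_nat k * 1)"
    by (intro monic2_power monic2_prod)
  have 2: "monic2 ([:0, 1:] ^ k * (\<Prod>i\<le>n. [:b i - 1, 1:])) (n + k) ((\<Sum>i\<le>n. b i - 1) + of_nat k * 0)"
    by (intro monic2_power monic2_prod)
  show "coeff (Dpoly n a b k) (n + k) = of_nat (n + 1 + k) - excess n a b"
    using 1 2 by (simp add: Dpoly_def monic2_def excess_def sum_subtractf)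
  assume "n + k < j"
  then show "coeff (Dpoly n a b k) j = 0"
    using 1 2 by (cases "j = Suc (n + k)") (auto simp: Dpoly_def monic2_def)
qed

text \<open>By the recurrence of the weight, its product with \<open>Dpoly\<close> is T(y+1) - T(y),
  where T(y) is the weight times s^k times the product of the b_i - 1 + s.\<close>

lemma moment_Dpoly:
  assumes "n + k < N" "real N < Re (excess n a b)"
  shows "(\<Sum>j<N. moment n a b z j * coeff (Dpoly n a b k) j) = 0"
proof -
  define B where "B = (\<Prod>i\<le>n. [:b i - 1, 1:])"
  define T where "T = (\<lambda>y::int. bweight n a b z y * poly ([:0, 1:] ^ k * B) (z + of_int y))"
  have Tdiff: "T (y + 1) - T y = bweight n a b z y * poly (Dpoly n a b k) (z + of_int y)" for y
  proof -
    have "T (y + 1) = (bweight n a b z (y + 1) * (\<Prod>i\<le>n. b i + (z + of_int y))) * (z + of_int y + 1) ^ k"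
      by (simp add: T_def B_def poly_prod poly_power algebra_simps)
    then show ?thesis unfolding bweight_plus1
      by (simp add: T_def B_def poly_Dpoly poly_prod poly_power algebra_simps)
  qed
  have "\<And>j. N \<le> j \<Longrightarrow> coeff (Dpoly n a b k) j = 0" using coeff_Dpoly(2) assms(1) by auto
  from has_sum_poly_moment[OF assms(2) this]
  have hs: "((\<lambda>y. T (y + 1) - T y) has_sum (\<Sum>j<N. moment n a b z j * coeff (Dpoly n a b k) j)) UNIV"
    unfolding Tdiff .
  \<comment> \<open>\<open>T\<close> has degree n+k+1 in s, one more than \<open>Dpoly\<close>. This
    is at most \<open>N\<close>, which lies below the real part of the \<open>excess\<close>, so
    \<open>T\<close> vanishes at both ends.\<close>
  have deg: "coeff ([:0, 1:] ^ k * B) j = 0" if "N < j" for j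
    using monic2_power[OF monic2_prod[of "\<lambda>i. b i - 1" n], of 0 k] assms(1) that
    unfolding monic2_def B_def by (auto dest: spec[of _ j])
  have Tterm: "T y = (\<Sum>j\<le>N. coeff ([:0, 1:] ^ k * B) j * (bweight n a b z y * (z + of_int y) ^ j))" for y
    unfolding T_def by (subst poly_eq_sum_coeff[of "Suc N"])
      (use deg in \<open>auto simp: lessThan_Suc_atMost sum_distrib_left mult_ac\<close>)
  have lim: "(\<lambda>m. T (g m)) \<longlonglongrightarrow> 0" if g: "\<And>m. \<bar>real_of_int (g m)\<bar> = real m" for g
  proof -
    have *: "(\<lambda>m. bweight n a b z (g m) * (z + of_int (g m)) ^ j) \<longlonglongrightarrow> 0" if j: "j \<le> N" for j
    proof -
      obtain K where K: "\<And>y. norm (bweight n a b z y * (z + of_int y) ^ j) \<le> K * (1 + \<bar>real_of_int y\<bar>) powr (real j - Re (excess n a b))"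
        using bterm_bound1[of j n a b z] assms j by force
      have "(\<lambda>m. (1 + real m) powr (real j - Re (excess n a b))) \<longlonglongrightarrow> 0"
      proof (rule tendsto_neg_powr)
        show "filterlim (\<lambda>m. 1 + real m) at_top sequentially"
          by (intro filterlim_tendsto_add_at_top[OF tendsto_const] filterlim_real_sequentially)
      qed (use assms j in auto)
      then have "(\<lambda>m. K * (1 + real m) powr (real j - Re (excess n a b))) \<longlonglongrightarrow> 0"
        using tendsto_mult_right_zero by blast
      then show ?thesis
        by (rule Lim_null_comparison[rotated]) (use K[of "g _"] in \<open>auto simp: g\<close>)
    qed
    have "(\<lambda>m. \<Sum>j\<le>N. coeff ([:0, 1:] ^ k * B) j * (bweight n a b z (g m) * (z + of_int (g m)) ^ j)) \<longlonglongrightarrow> (\<Sum>j\<le>N. coeff ([:0, 1:] ^ k * B) j * 0)"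
      by (intro tendsto_intros *) auto
    then show ?thesis unfolding Tterm by simp
  qed
  have "((\<lambda>y. T (y + 1) - T y) has_sum 0) UNIV"
    by (rule has_sum_telescope_int[OF has_sum_imp_summable[OF hs] lim lim]) auto
  with hs show ?thesis by (rule has_sum_unique)
qed

section \<open>Determinants of bilateral sums\<close>

text \<open>Entries are functions on nat instead of matrices with a carrier, so rows and blocks can
  be re-indexed freely.\<close>

definition detf :: "nat \<Rightarrow> (nat \<Rightarrow> nat \<Rightarrow> 'a :: comm_ring_1) \<Rightarrow> 'a" where
  "detf N A = det (mat N N (\<lambda>(i, j). A i j))"

lemma detf_leibniz:
  "detf N A = (\<Sum>p | p permutes {..<N}. signof p * (\<Prod>i<N. A i (p i)))"
proof -
  have "detf N A = (\<Sum>p | p permutes {0..<N}. signof p * (\<Prod>i = 0..<N. A i (p i)))"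
    unfolding detf_def by (subst det_def'[of _ N]) (auto intro!: sum.cong prod.cong simp: permutes_in_image)
  then show ?thesis by (simp add: atLeast0LessThan)
qed

lemma detf_cong:
  "(\<And>i j. i < N \<Longrightarrow> j < N \<Longrightarrow> A i j = B i j) \<Longrightarrow> detf N A = detf N B"
  unfolding detf_def by (intro arg_cong[of _ _ det] eq_matI) auto

lemma detf_mult:
  fixes A B :: "nat \<Rightarrow> nat \<Rightarrow> 'a :: comm_ring_1"
  shows "detf N (\<lambda>i k. \<Sum>j<N. A i j * B j k) = detf N A * detf N B"
proof -
  have "mat N N (\<lambda>(i, k). \<Sum>j<N. A i j * B j k) = mat N N (\<lambda>(i, j). A i j) * mat N N (\<lambda>(i, j). B i j)"
    by (intro eq_matI) (auto simp: scalar_prod_def atLeast0LessThan)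
  then show ?thesis unfolding detf_def by (simp add: det_mult[of _ N])
qed

lemma detf_upper_triangular:
  assumes "\<And>i j. j < i \<Longrightarrow> i < N \<Longrightarrow> A i j = 0"
  shows "detf N A = (\<Prod>i<N. A i i)"
proof -
  have "detf N A = prod_list (diag_mat (mat N N (\<lambda>(i, j). A i j)))"
    unfolding detf_def by (rule det_upper_triangular) (use assms in auto)
  then show ?thesis by (simp add: diag_mat_def prod.list_conv_set_nth atLeast0LessThan)
qed

lemma detf_lower_triangular:
  assumes "\<And>i j. i < j \<Longrightarrow> j < N \<Longrightarrow> A i j = 0"
  shows "detf N A = (\<Prod>i<N. A i i)"
proof -
  have "detf N A = prod_list (diag_mat (mat N N (\<lambda>(i, j). A i j)))"
    unfolding detf_def by (rule det_lower_triangular[of N]) (use assms in auto)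
  then show ?thesis by (simp add: diag_mat_def prod.list_conv_set_nth atLeast0LessThan)
qed

lemma detf_block:
  fixes A :: "nat \<Rightarrow> nat \<Rightarrow> 'a :: idom"
  assumes "\<And>i j. i < n \<Longrightarrow> j < q \<Longrightarrow> A i (n + j) = 0"
  shows "detf (n + q) A = detf n A * detf q (\<lambda>i j. A (n + i) (n + j))"
proof -
  have "mat (n + q) (n + q) (\<lambda>(i, j). A i j) =
    four_block_mat (mat n n (\<lambda>(i, j). A i j)) (0\<^sub>m n q) (mat q n (\<lambda>(i, j). A (n + i) j)) (mat q q (\<lambda>(i, j). A (n + i) (n + j)))"
  proof (intro eq_matI, goal_cases)
    case (1 i j)
    then show ?case using assms[of i "j - n"] by auto
  qed auto
  then show ?thesis unfolding detf_def by (simp add: det_four_block_mat_upper_right_zero[of _ n _ q])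
qed

lemma detf_row_scale:
  "detf N (\<lambda>i j. c i * A i j) = (\<Prod>i<N. c i) * detf N A"
  unfolding detf_leibniz by (simp add: prod.distrib sum_distrib_left mult_ac)

text \<open>A change of polynomial basis is multiplication from the right by the triangular matrix
  of coefficients.\<close>

lemma detf_poly_basis:
  fixes X :: "nat \<Rightarrow> nat \<Rightarrow> 'a :: comm_ring_1"
  assumes "\<And>c j. c < j \<Longrightarrow> j < N \<Longrightarrow> coeff (f c) j = 0"
  shows "detf N (\<lambda>i c. \<Sum>j<N. X i j * coeff (f c) j) = detf N X * (\<Prod>c<N. coeff (f c) c)"
  unfolding detf_mult[of N X "\<lambda>j c. coeff (f c) j"]
  by (subst detf_upper_triangular[of N "\<lambda>j c. coeff (f c) j"]) (use assms in auto)

definition vand :: "nat \<Rightarrow> (nat \<Rightarrow> 'a :: comm_ring_1) \<Rightarrow> 'a" where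
  "vand N x = (\<Prod>j<N. \<Prod>i<j. x j - x i)"

text \<open>In the Newton basis, the products of x - x_i over i < c, the matrix of values is lower
  triangular, and the change from the powers has determinant 1.\<close>

lemma detf_vandermonde:
  fixes x :: "nat \<Rightarrow> complex"
  shows "detf N (\<lambda>i j. x i ^ j) = vand N x"
proof -
  define f where "f = (\<lambda>c. \<Prod>i<c. [:- x i, 1:])"
  have deg: "degree (f c) = c" for c
    unfolding f_def by (subst degree_prod_eq_sum_degree) auto
  have lead: "coeff (f c) c = 1" for c
    using lead_coeff_prod[of "\<lambda>i. [:- x i, 1:]" "{..<c}"] deg[of c] by (simp add: f_def)
  have "detf N (\<lambda>i c. \<Sum>j<N. x i ^ j * coeff (f c) j) = detf N (\<lambda>i j. x i ^ j)"
    by (subst detf_poly_basis) (auto simp: lead coeff_eq_0 deg)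
  also have "detf N (\<lambda>i c. \<Sum>j<N. x i ^ j * coeff (f c) j) = detf N (\<lambda>i c. poly (f c) (x i))"
    by (intro detf_cong) (auto simp: poly_eq_sum_coeff[of N] coeff_eq_0 deg mult.commute)
  also have "\<dots> = (\<Prod>c<N. poly (f c) (x c))"
    by (rule detf_lower_triangular) (auto simp: f_def poly_prod)
  also have "\<dots> = vand N x" by (simp add: f_def vand_def poly_prod)
  finally show ?thesis by simp
qed

lemma prod_lessThan_add: "(\<Prod>i<n + q. f i) = (\<Prod>i<n. f i) * (\<Prod>i<q. f (n + i :: nat) :: 'a :: comm_monoid_mult)"
  by (induction q) (simp_all add: mult_ac)

lemma vand_append:
  fixes x :: "nat \<Rightarrow> 'a :: comm_ring_1"
  shows "vand (n + q) x = vand n x * vand q (\<lambda>i. x (n + i)) * (\<Prod>l<q. \<Prod>k<n. x (n + l) - x k)"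
proof (induction q)
  case (Suc q)
  have "(\<Prod>i<n + q. x (n + q) - x i) = (\<Prod>k<n. x (n + q) - x k) * (\<Prod>i<q. x (n + q) - x (n + i))"
    by (rule prod_lessThan_add)
  with Suc show ?case by (simp add: vand_def mult_ac)
qed (simp add: vand_def)

text \<open>Tuples are functions that vanish from \<open>n\<close> on, so setting coordinate
  \<open>n\<close> is a bijection that raises \<open>n\<close> by one; the induction step is Fubini
  for an absolutely summable product.\<close>

lemma has_sum_prod_funs:
  fixes g :: "nat \<Rightarrow> int \<Rightarrow> complex"
  assumes "\<And>k. k < n \<Longrightarrow> (\<lambda>y. norm (g k y)) summable_on UNIV"
  shows "(\<lambda>y. norm (\<Prod>k<n. g k (y k))) summable_on {y. \<forall>k\<ge>n. y k = 0}"
    and "((\<lambda>y. \<Prod>k<n. g k (y k)) has_sum (\<Prod>k<n. \<Sum>\<^sub>\<infinity>y. g k y)) {y. \<forall>k\<ge>n. y k = 0}"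
proof -
  have "(\<lambda>y. norm (\<Prod>k<n. g k (y k))) summable_on {y. \<forall>k\<ge>n. y k = 0} \<and>
    ((\<lambda>y. \<Prod>k<n. g k (y k)) has_sum (\<Prod>k<n. \<Sum>\<^sub>\<infinity>y. g k y)) {y. \<forall>k\<ge>n. y k = 0}"
    using assms
  proof (induction n)
    case 0
    have "{y :: nat \<Rightarrow> int. \<forall>k\<ge>0. y k = 0} = {\<lambda>_. 0}" by auto
    then show ?case by (simp add: has_sum_finite_iff)
  next
    case (Suc n)
    define A where "A = (\<lambda>n. {y :: nat \<Rightarrow> int. \<forall>k\<ge>n. y k = 0})"
    define P where "P = (\<lambda>y :: nat \<Rightarrow> int. \<Prod>k<n. g k (y k))"
    have IH: "(\<lambda>y. norm (P y)) summable_on A n" "(P has_sum (\<Prod>k<n. \<Sum>\<^sub>\<infinity>y. g k y)) (A n)"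
      using Suc by (auto simp: A_def P_def)
    have gn: "(\<lambda>y. norm (g n y)) summable_on UNIV" using Suc.prems by auto
    have bij: "bij_betw (\<lambda>(y, v). y(n := v)) (A n \<times> UNIV) (A (Suc n))"
      by (rule bij_betw_byWitness[where f' = "\<lambda>y. (y(n := 0), y n)"])
         (auto simp: A_def fun_eq_iff le_Suc_eq Suc_le_eq)
    have eq: "(\<Prod>k<Suc n. g k (((\<lambda>(y, v). y(n := v)) u) k)) = (case u of (y, v) \<Rightarrow> P y * g n v)" for u
      by (auto simp: P_def split: prod.split)
    have ns: "(\<lambda>u. norm (case u of (y, v) \<Rightarrow> P y * g n v)) summable_on (A n \<times> UNIV)"
    proof (subst Infinite_Sum.abs_summable_on_Sigma_iff, intro conjI ballI)
      show "(\<lambda>v. norm (case (y, v) of (y, v) \<Rightarrow> P y * g n v)) summable_on UNIV" for y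
        using summable_on_cmult_right[OF gn] by (simp add: norm_mult)
      show "(\<lambda>y. norm (\<Sum>\<^sub>\<infinity>v. norm (case (y, v) of (y, v) \<Rightarrow> P y * g n v))) summable_on A n"
        using summable_on_cmult_left[OF IH(1), of "\<Sum>\<^sub>\<infinity>v. norm (g n v)"]
        by (simp add: norm_mult infsum_cmult_right' infsum_nonneg)
    qed
    have "(\<lambda>y. norm (\<Prod>k<Suc n. g k (y k))) summable_on A (Suc n)"
      using ns unfolding summable_on_reindex_bij_betw[OF bij, symmetric] eq by simp
    moreover have "((\<lambda>u. case u of (y, v) \<Rightarrow> P y * g n v) has_sum (\<Prod>k<n. \<Sum>\<^sub>\<infinity>y. g k y) * (\<Sum>\<^sub>\<infinity>y. g n y)) (A n \<times> UNIV)"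
    proof (rule has_sum_SigmaI)
      show "((\<lambda>v. case (y, v) of (y, v) \<Rightarrow> P y * g n v) has_sum P y * (\<Sum>\<^sub>\<infinity>y. g n y)) UNIV" for y
        using abs_summable_summable[OF gn] by (simp add: has_sum_cmult_right)
      show "((\<lambda>y. P y * (\<Sum>\<^sub>\<infinity>y. g n y)) has_sum (\<Prod>k<n. \<Sum>\<^sub>\<infinity>y. g k y) * (\<Sum>\<^sub>\<infinity>y. g n y)) (A n)"
        by (intro has_sum_cmult_left IH)
      show "(\<lambda>u. case u of (y, v) \<Rightarrow> P y * g n v) summable_on (A n \<times> UNIV)"
        using ns by (rule abs_summable_summable)
    qed
    then have "((\<lambda>y. \<Prod>k<Suc n. g k (y k)) has_sum (\<Prod>k<Suc n. \<Sum>\<^sub>\<infinity>y. g k y)) (A (Suc n))"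
      unfolding has_sum_reindex_bij_betw[OF bij, symmetric] eq by simp
    ultimately show ?case unfolding A_def by blast
  qed
  then show "(\<lambda>y. norm (\<Prod>k<n. g k (y k))) summable_on {y. \<forall>k\<ge>n. y k = 0}"
    and "((\<lambda>y. \<Prod>k<n. g k (y k)) has_sum (\<Prod>k<n. \<Sum>\<^sub>\<infinity>y. g k y)) {y. \<forall>k\<ge>n. y k = 0}"
    by auto
qed

text \<open>Row i < n depends on y_i alone and the border rows are constant, so each term of the
  Leibniz expansion is a product of functions of one variable each.\<close>

lemma has_sum_detf:
  fixes g :: "nat \<Rightarrow> nat \<Rightarrow> int \<Rightarrow> complex"
  assumes "\<And>i j. i < n \<Longrightarrow> j < n + q \<Longrightarrow> (\<lambda>y. norm (g i j y)) summable_on UNIV"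
  shows "((\<lambda>y. detf (n + q) (\<lambda>i j. if i < n then g i j (y i) else R i j)) has_sum
    detf (n + q) (\<lambda>i j. if i < n then \<Sum>\<^sub>\<infinity>y. g i j y else R i j)) {y. \<forall>k\<ge>n. y k = 0}"
  unfolding detf_leibniz
proof (intro has_sum_sum_finite has_sum_cmult_right)
  show "finite {p. p permutes {..<n + q}}" by (rule finite_permutations) auto
next
  fix p assume "p \<in> {p. p permutes {..<n + q}}"
  then have p: "p i < n + q" if "i < n + q" for i using that permutes_in_image by fastforce
  have "((\<lambda>y. (\<Prod>i<n. g i (p i) (y i)) * (\<Prod>i<q. R (n + i) (p (n + i)))) has_sum
    (\<Prod>i<n. \<Sum>\<^sub>\<infinity>y. g i (p i) y) * (\<Prod>i<q. R (n + i) (p (n + i)))) {y. \<forall>k\<ge>n. y k = 0}"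
    by (intro has_sum_cmult_left has_sum_prod_funs assms) (use p in auto)
  then show "((\<lambda>y. \<Prod>i<n + q. if i < n then g i (p i) (y i) else R i (p i)) has_sum
    (\<Prod>i<n + q. if i < n then \<Sum>\<^sub>\<infinity>y. g i (p i) y else R i (p i))) {y. \<forall>k\<ge>n. y k = 0}"
    by (simp add: prod_lessThan_add)
qed

text \<open>Both sides are evaluations of the determinant with rows given by the moments at the \<open>z k\<close> and by the
  powers of the \<open>r l\<close>: as a sum of Vandermonde determinants, and after a triangular change of the
  polynomial basis to the powers below \<open>n\<close> followed by polynomials annihilated by the bilateral sums.\<close>
lemma has_sum_vand_roots:
  fixes r :: "nat \<Rightarrow> complex"
  assumes ex: "real (n + q) < Re (excess n a b)"
  shows "((\<lambda>y. (\<Prod>k<n. bweight n a b (z k) (y k)) * vand n (\<lambda>k. z k + of_int (y k)) *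
      (\<Prod>l<q. \<Prod>k<n. r l - (z k + of_int (y k))) * (vand q r * (\<Prod>k<q. of_nat (n + 1 + k) - excess n a b)))
    has_sum (detf n (\<lambda>k j. moment n a b (z k) j) * detf q (\<lambda>l k. poly (Dpoly n a b k) (r l)))) {y. \<forall>k\<ge>n. y k = 0}"
proof -
  let ?N = "n + q"
  let ?\<Lambda> = "\<Prod>k<q. of_nat (n + 1 + k) - excess n a b"
  define X where "X = (\<lambda>i j. if i < n then moment n a b (z i) j else r (i - n) ^ j)"
  define f :: "nat \<Rightarrow> complex poly" where "f = (\<lambda>c. if c < n then monom 1 c else Dpoly n a b (c - n))"
  have f0: "coeff (f c) j = 0" if "c < j" for c j
    using that coeff_Dpoly(2)[of n "c - n" j a b] by (auto simp: f_def)
  have fl: "(\<Prod>c<?N. coeff (f c) c) = ?\<Lambda>"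
    by (simp add: prod_lessThan_add f_def coeff_Dpoly)
  have "((\<lambda>y. detf ?N (\<lambda>i j. if i < n then bweight n a b (z i) (y i) * (z i + of_int (y i)) ^ j else r (i - n) ^ j)) has_sum
    detf ?N X) {y. \<forall>k\<ge>n. y k = 0}"
    unfolding X_def moment_def
    by (rule has_sum_detf) (intro abs_summable_bterm, use ex in auto)
  also have "(\<lambda>y. detf ?N (\<lambda>i j. if i < n then bweight n a b (z i) (y i) * (z i + of_int (y i)) ^ j else r (i - n) ^ j)) =
    (\<lambda>y. (\<Prod>k<n. bweight n a b (z k) (y k)) * vand n (\<lambda>k. z k + of_int (y k)) *
      (\<Prod>l<q. \<Prod>k<n. r l - (z k + of_int (y k))) * vand q r)"
  proof
    fix y
    define s where "s = (\<lambda>i. if i < n then z i + of_int (y i) else r (i - n))"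
    have "detf ?N (\<lambda>i j. if i < n then bweight n a b (z i) (y i) * (z i + of_int (y i)) ^ j else r (i - n) ^ j) =
      detf ?N (\<lambda>i j. (if i < n then bweight n a b (z i) (y i) else 1) * s i ^ j)"
      by (intro detf_cong) (auto simp: s_def)
    also have "\<dots> = (\<Prod>k<n. bweight n a b (z k) (y k)) * vand ?N s"
      unfolding detf_row_scale detf_vandermonde by (simp add: prod_lessThan_add)
    also have "vand ?N s = vand n (\<lambda>k. z k + of_int (y k)) * vand q r * (\<Prod>l<q. \<Prod>k<n. r l - (z k + of_int (y k)))"
      unfolding vand_append by (simp add: s_def vand_def)
    finally show "detf ?N (\<lambda>i j. if i < n then bweight n a b (z i) (y i) * (z i + of_int (y i)) ^ j else r (i - n) ^ j) =
      (\<Prod>k<n. bweight n a b (z k) (y k)) * vand n (\<lambda>k. z k + of_int (y k)) *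
      (\<Prod>l<q. \<Prod>k<n. r l - (z k + of_int (y k))) * vand q r" by (simp add: mult_ac)
  qed
  finally have "((\<lambda>y. (\<Prod>k<n. bweight n a b (z k) (y k)) * vand n (\<lambda>k. z k + of_int (y k)) *
      (\<Prod>l<q. \<Prod>k<n. r l - (z k + of_int (y k))) * vand q r * ?\<Lambda>)
    has_sum (detf ?N X * ?\<Lambda>)) {y. \<forall>k\<ge>n. y k = 0}"
    by (rule has_sum_cmult_left)
  moreover have "detf ?N X * ?\<Lambda> = detf n (\<lambda>k j. moment n a b (z k) j) * detf q (\<lambda>l k. poly (Dpoly n a b k) (r l))"
  proof -
    have "detf ?N X * ?\<Lambda> = detf ?N (\<lambda>i c. \<Sum>j<?N. X i j * coeff (f c) j)"
      by (subst detf_poly_basis) (use f0 in \<open>auto simp: fl\<close>)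
    also have "\<dots> = detf n (\<lambda>i c. \<Sum>j<?N. X i j * coeff (f c) j) *
        detf q (\<lambda>i c. \<Sum>j<?N. X (n + i) j * coeff (f (n + c)) j)"
    proof (rule detf_block)
      fix i j assume "i < n" "j < q"
      then show "(\<Sum>ja<?N. X i ja * coeff (f (n + j)) ja) = 0"
        using moment_Dpoly[of n j ?N a b "z i"] ex by (simp add: X_def f_def)
    qed
    also have "detf n (\<lambda>i c. \<Sum>j<?N. X i j * coeff (f c) j) = detf n (\<lambda>k j. moment n a b (z k) j)"
      by (intro detf_cong) (simp add: X_def f_def coeff_monom if_distrib cong: if_cong)
    also have "detf q (\<lambda>i c. \<Sum>j<?N. X (n + i) j * coeff (f (n + c)) j) = detf q (\<lambda>l k. poly (Dpoly n a b k) (r l))"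
      by (intro detf_cong, subst poly_eq_sum_coeff[of ?N])
         (auto simp: X_def f_def coeff_Dpoly mult.commute)
    finally show ?thesis .
  qed
  ultimately show ?thesis by (simp add: mult_ac)
qed

section \<open>Dependence on the base points\<close>

lemma moment_plus1: "moment n a b (z + 1) j = (- 1) ^ (n + 1) * moment n a b z j"
proof -
  let ?e = "(- 1) ^ (n + 1) :: complex"
  have "?e * ?e = 1" by (simp add: power_mult_distrib[symmetric])
  have shift: "bweight n a b z (y + 1) = ?e * bweight n a b (z + 1) y" for y
    using power_int_add_1[of ?e y] by (simp add: bweight_def add_ac mult_ac)
  have "moment n a b z j = (\<Sum>\<^sub>\<infinity>y. bweight n a b z (y + 1) * (z + of_int (y + 1)) ^ j)"
    unfolding moment_def
    by (rule infsum_reindex_bij_witness[of _ "\<lambda>y. y + 1" "\<lambda>y. y - 1"]) auto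
  also have "\<dots> = (\<Sum>\<^sub>\<infinity>y. ?e * (bweight n a b (z + 1) y * (z + 1 + of_int y) ^ j))"
    unfolding shift by (simp add: mult.assoc add_ac)
  also have "\<dots> = ?e * moment n a b (z + 1) j"
    unfolding moment_def by (rule infsum_cmult_right')
  finally have "?e * moment n a b z j = (?e * ?e) * moment n a b (z + 1) j" by (simp only: mult.assoc)
  with \<open>?e * ?e = 1\<close> show ?thesis by simp
qed

lemma moment_holomorphic:
  assumes ex: "real j + 1 < Re (excess n a b)"
  shows "(\<lambda>z. moment n a b z j) holomorphic_on UNIV"
proof -
  have "(\<lambda>z. moment n a b z j) holomorphic_on ball 0 R" for R :: real
  proof (cases "0 < R")
    case True
    obtain \<rho> :: real where \<rho>: "0 \<le> \<rho>" "\<forall>i\<le>n. norm (a i) \<le> \<rho> \<and> norm (b i) \<le> \<rho>"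
      using bounded_parameters by metis
    obtain K where K: "\<And>z y. norm z \<le> R \<Longrightarrow> norm (bweight n a b z y * (z + of_int y) ^ j) \<le>
        K * (1 + \<bar>real_of_int y\<bar>) powr (real j - Re (excess n a b))"
      using bterm_bound[OF \<rho>(1), of R j "Re (excess n a b)" n] \<rho>(2) ex True by fastforce
    have "uniform_limit (cball 0 R) (\<lambda>X z. \<Sum>y\<in>X. bweight n a b z y * (z + of_int y) ^ j)
        (\<lambda>z. \<Sum>\<^sub>\<infinity>y. bweight n a b z y * (z + of_int y) ^ j) (finite_subsets_at_top UNIV)"
      by (rule Weierstrass_m_test_general[where M = "\<lambda>y. K * (1 + \<bar>real_of_int y\<bar>) powr (real j - Re (excess n a b))"])
        (use K ex in \<open>auto intro!: summable_on_cmult_right summable_on_int_powr\<close>)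
    moreover have hol: "(\<lambda>z. \<Sum>y\<in>X. bweight n a b z y * (z + of_int y) ^ j) holomorphic_on A" for X A
      unfolding bweight_def kern_def by (intro holomorphic_intros holomorphic_rGamma') auto
    ultimately show ?thesis
      by (elim holomorphic_uniform_limit[rotated])
         (auto simp: moment_def intro!: always_eventually holomorphic_on_imp_continuous_on hol)
  qed (simp add: ball_empty holomorphic_on_def)
  then have "(\<lambda>z. moment n a b z j) field_differentiable at u" for u
    by (rule holomorphic_on_imp_differentiable_at[of _ "ball 0 (norm u + 1)"]) auto
  then show ?thesis by (auto simp: holomorphic_on_def field_differentiable_at_within)
qed

lemma half_le: "x \<le> t + 1 \<Longrightarrow> 0 \<le> t \<Longrightarrow> (1 + x) / 2 \<le> 1 + (t :: real)"
  by (simp add: field_simps)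

text \<open>The exponent j - Re(\<open>excess\<close>) is split into -\<open>\<eta>\<close> and
  -1-\<open>\<eta>\<close>, where \<open>\<eta>\<close> is half the slack in the convergence
  condition. The second part pays for the summation over \<open>y\<close>; the first is kept as
  decay in Im z.\<close>

lemma moment_growth:
  assumes ex: "real j + 1 < Re (excess n a b)"
  defines "\<eta> \<equiv> (Re (excess n a b) - real j - 1) / 2"
  obtains K where "K > 0" "\<And>z. \<bar>Re z\<bar> \<le> 1 \<Longrightarrow>
    norm (moment n a b z j) \<le> K * exp (real (n + 1) * pi * \<bar>Im z\<bar>) * (1 + \<bar>Im z\<bar>) powr (- \<eta>)"
proof -
  define \<sigma> where "\<sigma> = Re (excess n a b)"
  have \<eta>: "\<eta> > 0" "real j - \<sigma> = - \<eta> + (- 1 - \<eta>)" using ex by (auto simp: \<eta>_def \<sigma>_def field_simps)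
  obtain \<rho> :: real where \<rho>: "0 \<le> \<rho>" "\<forall>i\<le>n. norm (a i) \<le> \<rho> \<and> norm (b i) \<le> \<rho>"
    using bounded_parameters by metis
  obtain K where K: "K > 0" and bd: "\<And>s. norm (kern n a b s) \<le> K * exp (real (n + 1) * pi * \<bar>Im s\<bar>) * (1 + norm s) powr (- \<sigma>)"
    using kern_bound[OF \<rho>(1), of n] \<rho>(2) unfolding \<sigma>_def by metis
  define M where "M = (\<lambda>y::int. 2 powr (1 + \<eta>) * (1 + \<bar>real_of_int y\<bar>) powr (- 1 - \<eta>))"
  have M: "M summable_on UNIV" unfolding M_def using \<eta> by (intro summable_on_cmult_right summable_on_int_powr) auto
  have M0: "M y \<ge> 0" for y by (simp add: M_def)
  define S where "S = infsum M UNIV"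
  have "S \<ge> 0" unfolding S_def using M0 by (intro infsum_nonneg) auto
  have "norm (moment n a b z j) \<le> (K * (S + 1)) * exp (real (n + 1) * pi * \<bar>Im z\<bar>) * (1 + \<bar>Im z\<bar>) powr (- \<eta>)"
    if z: "\<bar>Re z\<bar> \<le> 1" for z
  proof -
    define C where "C = K * exp (real (n + 1) * pi * \<bar>Im z\<bar>) * (1 + \<bar>Im z\<bar>) powr (- \<eta>)"
    have C: "C \<ge> 0" using K by (simp add: C_def)
    have tb: "norm (bweight n a b z y * (z + of_int y) ^ j) \<le> C * M y" for y
    proof -
      define s where "s = z + of_int y"
      have pos: "1 + norm s > 0" by (simp add: add_pos_nonneg)
      have "norm (bweight n a b z y * s ^ j) = norm (kern n a b s) * norm s ^ j"
        by (simp add: norm_mult norm_bweight s_def norm_power)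
      also have "\<dots> \<le> (K * exp (real (n + 1) * pi * \<bar>Im s\<bar>) * (1 + norm s) powr (- \<sigma>)) * (1 + norm s) ^ j"
        using K by (intro mult_mono power_mono bd) auto
      also have "\<dots> = K * exp (real (n + 1) * pi * \<bar>Im z\<bar>) * ((1 + norm s) powr (- \<eta>) * (1 + norm s) powr (- 1 - \<eta>))"
        using pos \<eta>(2) by (simp add: powr_realpow [symmetric] powr_add [symmetric] s_def)
      also have "\<dots> \<le> K * exp (real (n + 1) * pi * \<bar>Im z\<bar>) * ((1 + \<bar>Im z\<bar>) powr (- \<eta>) * ((1 + \<bar>real_of_int y\<bar>) / 2) powr (- 1 - \<eta>))"
      proof (intro mult_left_mono mult_mono powr_mono2')
        show "1 + \<bar>Im z\<bar> \<le> 1 + norm s" using abs_Im_le_cmod[of s] by (simp add: s_def)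
        have "\<bar>real_of_int y\<bar> \<le> norm s + 1"
          using abs_Re_le_cmod[of s] z by (simp add: s_def)
        then show "(1 + \<bar>real_of_int y\<bar>) / 2 \<le> 1 + norm s"
          by (intro half_le) auto
      qed (use K \<eta> in auto)
      also have "((1 + \<bar>real_of_int y\<bar>) / 2) powr (- 1 - \<eta>) = M y"
      proof -
        have "- (1 + \<eta>) = - 1 - \<eta>" by simp
        then have "2 powr (- 1 - \<eta>) = 1 / 2 powr (1 + \<eta>)" using powr_minus_divide[of 2 "1 + \<eta>"] by metis
        then show ?thesis unfolding M_def by (subst powr_divide) (simp_all add: mult.commute)
      qed
      finally show ?thesis by (simp add: s_def C_def mult_ac)
    qed
    have "norm (moment n a b z j) \<le> C * S"
      unfolding S_def
    proof (rule norm_infsum_le[OF has_sum_moment[OF ex]])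
      show "((\<lambda>y. C * M y) has_sum (C * infsum M UNIV)) UNIV"
        using M by (intro has_sum_cmult_right has_sum_infsum)
    qed (use tb in auto)
    also have "\<dots> \<le> C * (S + 1)" using C by (intro mult_left_mono) auto
    finally show ?thesis by (simp add: C_def mult_ac)
  qed
  moreover have "K * (S + 1) > 0" using K \<open>S \<ge> 0\<close> by simp
  ultimately show ?thesis using that by blast
qed

lemma int_period:
  fixes H :: "complex \<Rightarrow> 'b"
  assumes "\<And>z. H (z + 1) = H z"
  shows "H (z + of_int k) = H z"
proof (induction k rule: int_induct[where k = 0])
  case (step1 i)
  then show ?case using assms[of "z + of_int i"] by (simp add: add.assoc)
next
  case (step2 i)
  then show ?case using assms[of "z + of_int (i - 1)"] by (simp add: add.assoc)
qed simp

text \<open>In the variable \<open>w = exp (2 * pi * \<i> * z)\<close>, the function \<open>k\<close> below is entire and of growth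
  \<open>o(|w| ^ (n + 1))\<close>, hence a polynomial.\<close>
lemma trigonometric_polynomial:
  fixes F :: "complex \<Rightarrow> complex"
  assumes hol: "F holomorphic_on UNIV"
    and per: "\<And>z. F (z + 1) = (- 1) ^ (n + 1) * F z"
    and K: "K > 0" and \<eta>: "\<eta> > 0"
    and growth: "\<And>z. \<bar>Re z\<bar> \<le> 1 \<Longrightarrow>
      norm (F z) \<le> K * exp (real (n + 1) * pi * \<bar>Im z\<bar>) * (1 + \<bar>Im z\<bar>) powr (- \<eta>)"
  shows "\<exists>c. \<forall>z. F z = exp (- \<i> * pi * (of_nat n - 1) * z) * (\<Sum>r<n. c r * exp (2 * pi * \<i> * z) ^ r)"
proof -
  \<comment> \<open>The exponential absorbs the sign in \<open>per\<close>, since exp (i pi (n-1))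
    is again (-1)^(n+1). Thus \<open>H\<close> has period 1 and is a function of w = exp (2 pi i
    z).\<close>
  define H where "H = (\<lambda>z. F z * exp (\<i> * pi * (of_nat n - 1) * z))"
  have Hhol: "H holomorphic_on UNIV" unfolding H_def by (intro holomorphic_intros hol)
  have Hper: "H (z + 1) = H z" for z
  proof -
    have "exp (\<i> * pi * (of_nat n - 1)) = exp (of_nat n * (\<i> * pi) - \<i> * pi)"
      by (simp add: algebra_simps)
    also have "\<dots> = exp (of_nat n * (\<i> * pi)) / exp (\<i> * pi)" by (rule exp_diff)
    also have "\<dots> = (- 1) ^ n * (- 1)" unfolding exp_of_nat_mult by (simp add: mult.commute[of \<i>])
    finally have e: "exp (\<i> * pi * (of_nat n - 1)) = (- 1) ^ (n + 1)" by simp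
    have "H (z + 1) = (- 1) ^ (n + 1) * F z * (exp (\<i> * pi * (of_nat n - 1)) * exp (\<i> * pi * (of_nat n - 1) * z))"
      unfolding H_def per by (simp add: exp_add [symmetric] algebra_simps)
    also have "\<dots> = ((- 1) ^ (n + 1) * (- 1) ^ (n + 1)) * H z" unfolding e H_def by (simp only: mult_ac)
    also have "((- 1) ^ (n + 1) * (- 1) ^ (n + 1) :: complex) = 1" by (simp add: power_mult_distrib[symmetric])
    finally show ?thesis by simp
  qed
  have Hexp: "H u = H v" if "exp (2 * pi * \<i> * u) = exp (2 * pi * \<i> * v)" for u v
  proof -
    from that obtain k :: int where "2 * pi * \<i> * u = 2 * pi * \<i> * v + (of_int (2 * k) * pi) * \<i>"
      by (auto simp: exp_eq)
    then have "2 * pi * \<i> * u = 2 * pi * \<i> * (v + of_int k)" by (simp add: algebra_simps)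
    then have "u = v + of_int k" by simp
    then show ?thesis using int_period[of H v k] Hper by simp
  qed
  \<comment> \<open>Near w = 0 the growth hypothesis only makes \<open>H\<close> of order o(1/|w|);
    the factor \<open>w\<close> turns this into a removable singularity with value 0.\<close>
  define k where "k = (\<lambda>w. if w = 0 then 0 else w * H (Ln w / (2 * pi * \<i>)))"
  define \<tau> where "\<tau> = (\<lambda>x::real. K * (1 + \<bar>ln x\<bar> / (2 * pi)) powr (- \<eta>))"
  have kb: "norm (k w) \<le> \<tau> (norm w) * max 1 (norm w ^ (n + 1))" if "w \<noteq> 0" for w
  proof -
    define L where "L = ln (norm w)"
    define z where "z = Ln w / (2 * pi * \<i>)"
    have z: "Re z = Im (Ln w) / (2 * pi)" "Im z = - L / (2 * pi)"
      using that by (simp_all add: z_def L_def Re_divide Im_divide power2_eq_square)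
    have Rez: "\<bar>Re z\<bar> \<le> 1" using mpi_less_Im_Ln[OF that] Im_Ln_le_pi[OF that]
      unfolding z by (simp add: abs_le_iff field_simps)
    have Imz: "pi * \<bar>Im z\<bar> = \<bar>L\<bar> / 2" "\<bar>Im z\<bar> = \<bar>L\<bar> / (2 * pi)" unfolding z by (simp_all add: abs_divide)
    have ew: "norm w = exp L" using that by (simp add: L_def)
    \<comment> \<open>The exponents balance exactly: the total is |w|^(n+1) outside the unit circle
      and 1 inside.\<close>
    have exp_le: "exp (L + real (n + 1) * (\<bar>L\<bar> / 2) + L / 2 * (real n - 1)) \<le> max 1 (norm w ^ (n + 1))"
    proof (cases "L \<ge> 0")
      case True
      then have "L + real (n + 1) * (\<bar>L\<bar> / 2) + L / 2 * (real n - 1) = real (n + 1) * L"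
        by (simp add: field_simps)
      then show ?thesis unfolding ew by (simp only: exp_of_nat_mult max.cobounded2)
    next
      case False
      then have "L + real (n + 1) * (\<bar>L\<bar> / 2) + L / 2 * (real n - 1) = 0"
        by (simp add: field_simps)
      then show ?thesis by simp
    qed
    have "norm (k w) = exp L * (norm (F z) * exp (- (pi * Im z) * (real n - 1)))"
    proof -
      have "k w = w * (F z * exp (\<i> * pi * (of_nat n - 1) * z))" using that by (simp add: k_def H_def z_def)
      moreover have "Re (\<i> * pi * (of_nat n - 1) * z) = - (pi * Im z) * (real n - 1)" by (simp add: algebra_simps)
      ultimately show ?thesis by (simp only: norm_mult norm_exp_eq_Re ew)
    qed
    also have "\<dots> \<le> exp L * ((K * exp (real (n + 1) * pi * \<bar>Im z\<bar>) * (1 + \<bar>Im z\<bar>) powr (- \<eta>)) * exp (- (pi * Im z) * (real n - 1)))"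
      by (intro mult_left_mono mult_right_mono growth Rez) auto
    also have "\<dots> = \<tau> (norm w) * exp (L + real (n + 1) * (\<bar>L\<bar> / 2) + L / 2 * (real n - 1))"
      unfolding exp_add mult.assoc[of "real (n + 1)"] Imz(1)
      by (simp add: Imz(2) \<tau>_def L_def[symmetric] z(2))
    also have "\<dots> \<le> \<tau> (norm w) * max 1 (norm w ^ (n + 1))"
      by (intro mult_left_mono exp_le) (use K in \<open>simp add: \<tau>_def\<close>)
    finally show ?thesis .
  qed
  have \<tau>0: "(\<tau> \<longlongrightarrow> 0) (at_right 0)" unfolding \<tau>_def using \<eta> by real_asymp
  have \<tau>inf: "(\<tau> \<longlongrightarrow> 0) at_top" unfolding \<tau>_def using \<eta> by real_asymp
  have \<tau>K: "\<tau> x \<le> K" for x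
  proof -
    have "(1 + \<bar>ln x\<bar> / (2 * pi)) powr (- \<eta>) \<le> 1 powr (- \<eta>)" using \<eta> by (intro powr_mono2') auto
    then show ?thesis unfolding \<tau>_def using K by simp
  qed
  have khol: "k holomorphic_on (UNIV - {0})"
  proof -
    have "k holomorphic_on (- \<real>\<^sub>\<le>\<^sub>0)"
    proof (rule holomorphic_transform)
      show "(\<lambda>w. w * H (Ln w / (2 * pi * \<i>))) holomorphic_on (- \<real>\<^sub>\<le>\<^sub>0)"
        by (intro holomorphic_intros holomorphic_on_compose_gen[OF _ Hhol, unfolded o_def]) auto
    qed (auto simp: k_def)
    \<comment> \<open>\<open>Ln\<close> is cut along the negative axis. Off the nonnegative axis, Ln
      (-w) + i pi is another logarithm of \<open>w\<close>, and by \<open>Hexp\<close> the branch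
      does not affect \<open>H\<close>. The two domains cover every nonzero
      \<open>w\<close>.\<close>
    moreover have "k holomorphic_on uminus ` (- \<real>\<^sub>\<le>\<^sub>0)"
    proof (rule holomorphic_transform)
      show "(\<lambda>w. w * H ((Ln (- w) + \<i> * pi) / (2 * pi * \<i>))) holomorphic_on uminus ` (- \<real>\<^sub>\<le>\<^sub>0)"
        by (intro holomorphic_intros holomorphic_on_compose_gen[OF _ Hhol, unfolded o_def]) auto
    next
      fix w :: complex assume "w \<in> uminus ` (- \<real>\<^sub>\<le>\<^sub>0)"
      then have "w \<noteq> 0" by auto
      then have "H ((Ln (- w) + \<i> * pi) / (2 * pi * \<i>)) = H (Ln w / (2 * pi * \<i>))"
        by (intro Hexp) (simp add: exp_add mult.commute[of \<i>])
      with \<open>w \<noteq> 0\<close> show "w * H ((Ln (- w) + \<i> * pi) / (2 * pi * \<i>)) = k w" by (simp add: k_def)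
    qed
    moreover have "open (uminus ` (- \<real>\<^sub>\<le>\<^sub>0 :: complex set))"
      by (intro open_negations) (simp add: closed_nonpos_Reals_complex open_Compl)
    ultimately have "k holomorphic_on (- \<real>\<^sub>\<le>\<^sub>0 \<union> uminus ` (- \<real>\<^sub>\<le>\<^sub>0))"
      by (intro holomorphic_on_Un) (auto simp: closed_nonpos_Reals_complex open_Compl)
    moreover have "UNIV - {0} \<subseteq> - \<real>\<^sub>\<le>\<^sub>0 \<union> uminus ` (- \<real>\<^sub>\<le>\<^sub>0 :: complex set)"
    proof
      fix w :: complex assume "w \<in> UNIV - {0}"
      then have "w \<notin> \<real>\<^sub>\<le>\<^sub>0 \<or> - w \<notin> \<real>\<^sub>\<le>\<^sub>0" by (auto simp: complex_nonpos_Reals_iff complex_eq_iff)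
      then show "w \<in> - \<real>\<^sub>\<le>\<^sub>0 \<union> uminus ` (- \<real>\<^sub>\<le>\<^sub>0)"
        by (metis ComplI Un_iff image_eqI minus_minus)
    qed
    ultimately show ?thesis by (rule holomorphic_on_subset)
  qed
  have kUNIV: "k holomorphic_on UNIV"
  proof (rule no_isolated_singularity'[of "{0}"])
    fix u :: complex assume "u \<in> {0}"
    have "(k \<longlongrightarrow> 0) (at 0)"
    proof (rule Lim_null_comparison)
      have "((\<lambda>w::complex. \<tau> (norm w)) \<longlongrightarrow> 0) (at 0)"
        by (rule filterlim_compose[OF \<tau>0])
          (auto simp: filterlim_at intro!: tendsto_norm_zero eventually_at_ball' simp: eventually_at_filter)
      then show "((\<lambda>w::complex. \<tau> (norm w)) \<longlongrightarrow> 0) (at 0)" .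
      have "eventually (\<lambda>w::complex. norm w < 1 \<and> w \<noteq> 0) (at 0)"
        unfolding eventually_at by (intro exI[of _ 1]) (auto simp: dist_norm)
      then show "eventually (\<lambda>w. norm (k w) \<le> \<tau> (norm w)) (at 0)"
      proof eventually_elim
        case (elim w)
        then have "max 1 (norm w ^ (n + 1)) = 1" by (intro max_absorb1 power_le_one) auto
        then show ?case using kb[of w] elim by simp
      qed
    qed
    then show "(k \<longlongrightarrow> k u) (at u within UNIV)" using \<open>u \<in> {0}\<close> by (simp add: k_def)
  qed (use khol in auto)
  define d where "d = (\<lambda>i. (deriv ^^ i) k 0 / fact i)"
  have kb1: "norm (k w) \<le> \<tau> (norm w) * norm w ^ (n + 1)" if "1 \<le> norm w" for w
  proof -
    have "max 1 (norm w ^ (n + 1)) = norm w ^ (n + 1)" using that by (intro max_absorb2 one_le_power)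
    moreover have "w \<noteq> 0" using that by auto
    ultimately show ?thesis using kb[of w] by metis
  qed
  have kpoly: "k w = (\<Sum>i\<le>n + 1. d i * w ^ i)" for w
    unfolding d_def
  proof (rule Liouville_polynomial[OF kUNIV, of 1 K])
    fix w :: complex assume "1 \<le> norm w"
    then show "norm (k w) \<le> K * norm w ^ (n + 1)"
      using kb1 \<tau>K by (meson mult_right_mono norm_ge_zero order_trans zero_le_power)
  qed
  have d0: "d 0 = 0" by (simp add: d_def k_def)
  \<comment> \<open>The Cauchy estimate bounds this coefficient by \<open>\<tau>\<close> r for every
    r >= 1, and \<open>\<tau>\<close> tends to 0. With \<open>d0\<close> only the orders 1 to n
    remain.\<close>
  have dn: "d (n + 1) = 0"
  proof -
    have "norm (d (n + 1)) \<le> 0"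
    proof (rule tendsto_lowerbound[OF \<tau>inf])
      show "eventually (\<lambda>r. norm (d (n + 1)) \<le> \<tau> r) at_top"
        using eventually_ge_at_top[of 1]
      proof eventually_elim
        case (elim r)
        have "norm ((deriv ^^ (n + 1)) k 0) \<le> fact (n + 1) * (\<tau> r * r ^ (n + 1)) / r ^ (n + 1)"
          by (rule Cauchy_inequality)
             (use elim kb1 in \<open>auto intro!: holomorphic_on_imp_continuous_on holomorphic_on_subset[OF kUNIV]\<close>)
        also have "\<dots> = fact (n + 1) * \<tau> r" using elim by simp
        finally show ?case unfolding d_def norm_divide by (simp add: divide_le_eq mult.commute del: fact_Suc)
      qed
    qed auto
    then show ?thesis by simp
  qed
  have "F z = exp (- \<i> * pi * (of_nat n - 1) * z) * (\<Sum>r<n. d (Suc r) * exp (2 * pi * \<i> * z) ^ r)" for z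
  proof -
    define w where "w = exp (2 * pi * \<i> * z)"
    have "w \<noteq> 0" by (simp add: w_def)
    have "H (Ln w / (2 * pi * \<i>)) = H z" by (rule Hexp) (use \<open>w \<noteq> 0\<close> in \<open>simp add: w_def\<close>)
    then have "w * H z = k w" using \<open>w \<noteq> 0\<close> by (simp add: k_def)
    also have "\<dots> = (\<Sum>i<n. d (Suc i) * w ^ Suc i)"
      unfolding kpoly using d0 dn sum.lessThan_Suc_shift[of "\<lambda>i. d i * w ^ i" n]
      by (simp add: lessThan_Suc_atMost[symmetric])
    also have "\<dots> = w * (\<Sum>r<n. d (Suc r) * w ^ r)" by (simp add: sum_distrib_left mult_ac)
    finally have "H z = (\<Sum>r<n. d (Suc r) * w ^ r)" using \<open>w \<noteq> 0\<close> by simp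
    moreover have "F z = exp (- \<i> * pi * (of_nat n - 1) * z) * H z"
      by (simp add: H_def mult.left_commute exp_add [symmetric])
    ultimately show ?thesis by (simp add: w_def)
  qed
  then show ?thesis by (intro exI[of _ "\<lambda>r. d (Suc r)"]) simp
qed


lemma moment_trigonometric:
  assumes "real j + 1 < Re (excess n a b)"
  shows "\<exists>c. \<forall>z. moment n a b z j = exp (- \<i> * pi * (of_nat n - 1) * z) * (\<Sum>r<n. c r * exp (2 * pi * \<i> * z) ^ r)"
proof -
  define \<eta> where "\<eta> = (Re (excess n a b) - real j - 1) / 2"
  obtain K where K: "K > 0" "\<And>z. \<bar>Re z\<bar> \<le> 1 \<Longrightarrow> norm (moment n a b z j) \<le>
      K * exp (real (n + 1) * pi * \<bar>Im z\<bar>) * (1 + \<bar>Im z\<bar>) powr (- \<eta>)"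
    using moment_growth[OF assms, folded \<eta>_def] by blast
  have "\<eta> > 0" using assms by (simp add: \<eta>_def)
  then show ?thesis
    by (rule trigonometric_polynomial[OF moment_holomorphic[OF assms] moment_plus1 K(1) _ K(2)])
qed

section \<open>The moment determinant as a product of sines\<close>

definition moment_det :: "nat \<Rightarrow> (nat \<Rightarrow> complex) \<Rightarrow> (nat \<Rightarrow> complex) \<Rightarrow> (nat \<Rightarrow> complex) \<Rightarrow> complex" where
  "moment_det n a b z = detf n (\<lambda>k j. moment n a b (z k) j)"

text \<open>Up to powers of pi a product of sines (\<open>sine_vand_altdef\<close>). In this form it
  shows the Gamma functions of the theorem, and its factor \<open>vand\<close> cancels against
  Delta(z).\<close>

definition sine_vand :: "nat \<Rightarrow> (nat \<Rightarrow> complex) \<Rightarrow> complex" where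
  "sine_vand n z = vand n z * (\<Prod>i<n. \<Prod>k<n. rGamma (1 + z k - z i))"

lemma prod_pairs_mult:
  fixes u :: "nat \<Rightarrow> 'a :: comm_monoid_mult"
  shows "(\<Prod>j<n. \<Prod>i<j. u i * u j) = (\<Prod>k<n. u k) ^ (n - 1)"
proof (induction n)
  case (Suc n)
  show ?case
  proof (cases n)
    case (Suc m)
    define P where "P = (\<Prod>k<n. u k)"
    have "(\<Prod>i<n. u i * u n) = P * u n ^ n" by (simp add: prod.distrib P_def)
    moreover have "(\<Prod>j<n. \<Prod>i<j. u i * u j) = P ^ m" using Suc.IH Suc by (simp add: P_def)
    ultimately have "(\<Prod>j<Suc n. \<Prod>i<j. u i * u j) = P ^ m * (P * u n ^ n)" by simp
    also have "\<dots> = (P * u n) ^ n" unfolding Suc by (simp add: power_mult_distrib mult_ac)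
    finally show ?thesis by (simp add: P_def)
  qed simp
qed simp

lemma prod_square_pairs:
  fixes g :: "nat \<Rightarrow> nat \<Rightarrow> 'a :: comm_monoid_mult"
  shows "(\<Prod>i<n. \<Prod>k<n. g i k) = (\<Prod>i<n. g i i) * (\<Prod>j<n. \<Prod>i<j. g i j * g j i)"
  by (induction n) (simp_all add: prod.distrib mult_ac)

text \<open>Reflection for each pair i < j: d / (Gamma(1+d) Gamma(1-d)) = sin (pi d)/pi. The
  diagonal factors are 1/Gamma(1).\<close>

lemma sine_vand_altdef:
  "sine_vand n z = (\<Prod>j<n. \<Prod>i<j. sin (of_real pi * (z j - z i)) / of_real pi)"
proof -
  have "(z j - z i) * (rGamma (1 + z j - z i) * rGamma (1 + z i - z j)) = sin (of_real pi * (z j - z i)) / of_real pi"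
    for i j
  proof -
    define d where "d = z j - z i"
    have e: "1 + z j - z i = d + 1" "1 + z i - z j = 1 - d" by (simp_all add: d_def)
    have "d * (rGamma (d + 1) * rGamma (1 - d)) = rGamma d * rGamma (1 - d)"
      using rGamma_plus1[of d] by (simp add: mult.assoc[symmetric])
    then show ?thesis unfolding e d_def[symmetric] rGamma_reflection_complex .
  qed
  then show ?thesis
    unfolding sine_vand_def prod_square_pairs vand_def by (simp add: prod.distrib[symmetric])
qed

text \<open>Each difference of exponentials is exp (i pi (u+v)) times 2i sin (pi (u-v)). Every point
  occurs in n-1 pairs, so the exponentials collect to the inverse of the first product.\<close>

lemma vand_exp:
  assumes "n \<ge> 1"
  shows "(\<Prod>k<n. exp (- \<i> * pi * (of_nat n - 1) * z k)) * vand n (\<lambda>k. exp (2 * pi * \<i> * z k)) =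
    (\<Prod>j<n. \<Prod>i<j. 2 * pi * \<i>) * sine_vand n z"
proof -
  have 1: "exp (2 * pi * \<i> * u) - exp (2 * pi * \<i> * v) =
      exp (\<i> * pi * v) * exp (\<i> * pi * u) * ((2 * pi * \<i>) * (sin (of_real pi * (u - v)) / of_real pi))" for u v
  proof -
    define P Q where "P = exp (\<i> * pi * u)" and "Q = exp (\<i> * pi * v)"
    have nz: "P \<noteq> 0" "Q \<noteq> 0" by (simp_all add: P_def Q_def)
    have "(2 * pi * \<i>) * (sin (of_real pi * (u - v)) / of_real pi) = exp (\<i> * (pi * (u - v))) - exp (- (\<i> * (pi * (u - v))))"
      by (simp add: sin_exp_eq field_simps)
    also have "exp (\<i> * (pi * (u - v))) = P / Q"
      unfolding P_def Q_def exp_diff[symmetric] by (simp add: algebra_simps)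
    also have "exp (- (\<i> * (pi * (u - v)))) = Q / P"
      unfolding P_def Q_def exp_diff[symmetric] by (simp add: algebra_simps)
    finally have 0: "(2 * pi * \<i>) * (sin (of_real pi * (u - v)) / of_real pi) = P / Q - Q / P" .
    have "exp (2 * pi * \<i> * u) = P * P" "exp (2 * pi * \<i> * v) = Q * Q"
      unfolding P_def Q_def exp_add[symmetric] by (simp_all add: algebra_simps)
    then show ?thesis unfolding 0 P_def[symmetric] Q_def[symmetric] using nz by (simp add: field_simps)
  qed
  have 2: "(\<Prod>k<n. exp (\<i> * pi * z k)) ^ (n - 1) = (\<Prod>k<n. exp (\<i> * pi * (of_nat n - 1) * z k))"
  proof -
    have "exp (\<i> * pi * u) ^ (n - 1) = exp (\<i> * pi * (of_nat n - 1) * u)" for u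
      using assms by (simp add: exp_of_nat_mult [symmetric] of_nat_diff algebra_simps)
    then show ?thesis by (simp only: prod_power_distrib)
  qed
  have 3: "(\<Prod>k<n. exp (- \<i> * pi * (of_nat n - 1) * z k)) * (\<Prod>k<n. exp (\<i> * pi * (of_nat n - 1) * z k)) = 1"
    unfolding prod.distrib[symmetric] exp_add[symmetric] by simp
  have "vand n (\<lambda>k. exp (2 * pi * \<i> * z k)) =
    (\<Prod>k<n. exp (\<i> * pi * z k)) ^ (n - 1) * ((\<Prod>j<n. \<Prod>i<j. 2 * pi * \<i>) * sine_vand n z)"
    unfolding vand_def 1 prod.distrib sine_vand_altdef prod_pairs_mult[symmetric] by (simp only: mult_ac)
  then show ?thesis unfolding 2 using 3 by (simp add: mult.assoc[symmetric])
qed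

lemma moment_det_sine_vand:
  assumes "n \<ge> 1" "real n < Re (excess n a b)"
  obtains C where "\<And>z. moment_det n a b z = C * sine_vand n z"
proof -
  have "\<exists>c. \<forall>z. moment n a b z j = exp (- \<i> * pi * (of_nat n - 1) * z) * (\<Sum>r<n. c r * exp (2 * pi * \<i> * z) ^ r)"
    if "j < n" for j
    using assms that by (intro moment_trigonometric) auto
  then obtain c where c: "\<And>j z. j < n \<Longrightarrow> moment n a b z j =
      exp (- \<i> * pi * (of_nat n - 1) * z) * (\<Sum>r<n. c j r * exp (2 * pi * \<i> * z) ^ r)"
    by metis
  have "moment_det n a b z = ((\<Prod>j<n. \<Prod>i<j. 2 * pi * \<i>) * detf n (\<lambda>r j. c j r)) * sine_vand n z" for z
  proof -
    have "moment_det n a b z = detf n (\<lambda>k j. exp (- \<i> * pi * (of_nat n - 1) * z k) *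
        (\<Sum>r<n. exp (2 * pi * \<i> * z k) ^ r * c j r))"
      unfolding moment_det_def by (intro detf_cong) (simp add: c mult.commute)
    also have "\<dots> = ((\<Prod>k<n. exp (- \<i> * pi * (of_nat n - 1) * z k)) * vand n (\<lambda>k. exp (2 * pi * \<i> * z k))) * detf n (\<lambda>r j. c j r)"
      unfolding detf_row_scale detf_mult[of n "\<lambda>k r. exp (2 * pi * \<i> * z k) ^ r" "\<lambda>r j. c j r"] detf_vandermonde
      by (simp only: mult_ac)
    finally show ?thesis unfolding vand_exp[OF assms(1)] by (simp only: mult_ac)
  qed
  then show ?thesis using that by blast
qed

section \<open>Evaluation of the determinant\<close>

lemma has_sum_moment_det:
  assumes "real n < Re (excess n a b)"
  shows "((\<lambda>y. (\<Prod>k<n. bweight n a b (z k) (y k)) * vand n (\<lambda>k. z k + of_int (y k)))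
    has_sum moment_det n a b z) {y. \<forall>k\<ge>n. y k = 0}"
proof -
  have d0: "detf 0 A = 1" for A :: "nat \<Rightarrow> nat \<Rightarrow> complex" by (simp add: detf_def)
  show ?thesis using has_sum_vand_roots[of n 0 a b z "\<lambda>_. 0"] assms
    by (simp add: d0 vand_def moment_det_def)
qed

lemma bweight_shift:
  "bweight n a b z y = (1 - a n - (z + of_int y)) * bweight n (a(n := a n - 1)) b z y"
proof -
  define s where "s = z + of_int y"
  have *: "rGamma (1 - a n - s) = (1 - a n - s) * rGamma (1 - (a n - 1) - s)"
    using rGamma_plus1[of "1 - a n - s"] by (simp add: algebra_simps)
  have "kern n a b s = (1 - a n - s) * kern n (a(n := a n - 1)) b s"
  proof -
    have k: "kern n a' b s = (rGamma (1 - a' n - s) * rGamma (b n + s)) * (\<Prod>i<n. rGamma (1 - a' i - s) * rGamma (b i + s))" for a'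
      by (simp add: kern_def lessThan_Suc_atMost[symmetric])
    show ?thesis unfolding k using * by (simp add: mult.assoc)
  qed
  then show ?thesis by (simp add: bweight_def s_def)
qed

lemma excess_shift: "excess n (a(n := a n - c)) b = excess n a b + c"
  by (simp add: excess_def lessThan_Suc_atMost[symmetric])

text \<open>The weight for \<open>a\<close> is the weight for the shifted parameters times a linear
  factor with root 1 - a_n, so this is \<open>has_sum_vand_roots\<close> for the shifted parameters
  with that single root.\<close>

lemma moment_det_shift:
  assumes "real n < Re (excess n a b)"
  shows "moment_det n a b z * (excess n a b - of_nat n) = moment_det n (a(n := a n - 1)) b z * (\<Prod>i\<le>n. b i - a n)"
proof -
  define a' where "a' = a(n := a n - 1)"
  have ex: "excess n a' b = excess n a b + 1" unfolding a'_def by (rule excess_shift)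
  have d1: "detf 1 A = A 0 0" for A :: "nat \<Rightarrow> nat \<Rightarrow> complex"
    using detf_upper_triangular[of 1 A] by simp
  \<comment> \<open>The chosen root kills the first product of \<open>Dpoly\<close>, which leaves
    only the product of the b_i - a_n.\<close>
  have A: "(\<Prod>i\<le>n. a' i + (1 - a n)) = 0" by (rule prod_zero) (auto simp: a'_def)
  have "((\<lambda>y. (\<Prod>k<n. bweight n a' b (z k) (y k)) * vand n (\<lambda>k. z k + of_int (y k)) *
      (\<Prod>l<(1::nat). \<Prod>k<n. (1 - a n) - (z k + of_int (y k))) * (vand 1 (\<lambda>_. 1 - a n) * (\<Prod>k<(1::nat). of_nat (n + 1 + k) - excess n a' b)))
    has_sum (detf n (\<lambda>k j. moment n a' b (z k) j) * detf 1 (\<lambda>l k. poly (Dpoly n a' b k) (1 - a n)))) {y. \<forall>k\<ge>n. y k = 0}"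
    using has_sum_vand_roots[of n 1 a' b z "\<lambda>_. 1 - a n"] assms ex by simp
  also have "detf n (\<lambda>k j. moment n a' b (z k) j) * detf 1 (\<lambda>l k. poly (Dpoly n a' b k) (1 - a n)) =
      - (moment_det n a' b z * (\<Prod>i\<le>n. b i - a n))"
    unfolding d1 poly_Dpoly A by (simp add: moment_det_def)
  also have "(\<lambda>y. (\<Prod>k<n. bweight n a' b (z k) (y k)) * vand n (\<lambda>k. z k + of_int (y k)) *
      (\<Prod>l<(1::nat). \<Prod>k<n. (1 - a n) - (z k + of_int (y k))) * (vand 1 (\<lambda>_. 1 - a n) * (\<Prod>k<(1::nat). of_nat (n + 1 + k) - excess n a' b))) =
      (\<lambda>y. (\<Prod>k<n. bweight n a b (z k) (y k)) * vand n (\<lambda>k. z k + of_int (y k)) * (of_nat n - excess n a b))"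
    unfolding bweight_shift[of n a b, folded a'_def] prod.distrib ex by (simp add: vand_def mult_ac)
  finally have "((\<lambda>y. (\<Prod>k<n. bweight n a b (z k) (y k)) * vand n (\<lambda>k. z k + of_int (y k)) * (of_nat n - excess n a b))
    has_sum - (moment_det n a' b z * (\<Prod>i\<le>n. b i - a n))) {y. \<forall>k\<ge>n. y k = 0}" .
  moreover have "((\<lambda>y. (\<Prod>k<n. bweight n a b (z k) (y k)) * vand n (\<lambda>k. z k + of_int (y k)) * (of_nat n - excess n a b))
    has_sum (moment_det n a b z * (of_nat n - excess n a b))) {y. \<forall>k\<ge>n. y k = 0}"
    by (intro has_sum_cmult_left has_sum_moment_det assms)
  ultimately have "moment_det n a b z * (of_nat n - excess n a b) = - (moment_det n a' b z * (\<Prod>i\<le>n. b i - a n))"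
    by (rule has_sum_unique[rotated])
  then show ?thesis by (simp add: a'_def algebra_simps)
qed

lemma moment_det_shifts:
  assumes "real n < Re (excess n a b)"
  shows "moment_det n a b z * pochhammer (excess n a b - of_nat n) N =
    moment_det n (a(n := a n - of_nat N)) b z * (\<Prod>i\<le>n. pochhammer (b i - a n) N)"
proof (induction N)
  case (Suc N)
  define a' where "a' = a(n := a n - of_nat N)"
  define a2 where "a2 = a(n := a n - of_nat (Suc N))"
  have ex: "excess n a' b = excess n a b + of_nat N" unfolding a'_def by (rule excess_shift)
  have a'': "a'(n := a' n - 1) = a2" by (auto simp: a'_def a2_def)
  have "moment_det n a' b z * (excess n a' b - of_nat n) =
      moment_det n (a'(n := a' n - 1)) b z * (\<Prod>i\<le>n. b i - a' n)"
    by (rule moment_det_shift) (use assms ex in simp)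
  then have step: "moment_det n a' b z * (excess n a b - of_nat n + of_nat N) =
      moment_det n a2 b z * (\<Prod>i\<le>n. b i - a n + of_nat N)"
    unfolding a'' ex by (simp add: a'_def algebra_simps)
  have "moment_det n a b z * pochhammer (excess n a b - of_nat n) (Suc N) =
    (moment_det n a' b z * (excess n a b - of_nat n + of_nat N)) * (\<Prod>i\<le>n. pochhammer (b i - a n) N)"
    unfolding pochhammer_rec' using Suc[folded a'_def] by (simp add: mult_ac)
  then show ?case unfolding step a2_def[symmetric] by (simp add: pochhammer_rec' prod.distrib mult_ac)
qed simp

text \<open>By Gauss's limit, \<open>pochhammer x N\<close> behaves like (N-1)! N^x / Gamma(x).
  Equal numbers of factors cancel the factorials and equal parameter sums cancel the powers of
  \<open>N\<close>. The index is shifted because \<open>rGamma_series\<close> at N contains the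
  symbol of length N+1.\<close>

lemma prod_pochhammer_ratio_tendsto:
  fixes x y :: "nat \<Rightarrow> complex"
  assumes "(\<Sum>i\<le>n. x i) = (\<Sum>i\<le>n. y i)" "\<And>i. i \<le> n \<Longrightarrow> y i \<notin> \<int>\<^sub>\<le>\<^sub>0"
  shows "(\<lambda>N. \<Prod>i\<le>n. pochhammer (x i) N / pochhammer (y i) N) \<longlonglongrightarrow> (\<Prod>i\<le>n. rGamma (x i) / rGamma (y i))"
proof (rule LIMSEQ_imp_Suc, rule Lim_transform_eventually)
  show "(\<lambda>N. \<Prod>i\<le>n. rGamma_series (x i) N / rGamma_series (y i) N) \<longlonglongrightarrow> (\<Prod>i\<le>n. rGamma (x i) / rGamma (y i))"
    by (intro tendsto_intros) (use assms in \<open>auto simp: rGamma_eq_zero_iff\<close>)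
  have "(\<Prod>i\<le>n. rGamma_series (x i) N / rGamma_series (y i) N) = (\<Prod>i\<le>n. pochhammer (x i) (Suc N) / pochhammer (y i) (Suc N))"
    for N
  proof -
    define L where "L = complex_of_real (ln (of_nat N))"
    have "(\<Prod>i\<le>n. exp (x i * L)) = (\<Prod>i\<le>n. exp (y i * L))"
      using assms(1) by (simp add: exp_sum[symmetric] sum_distrib_right[symmetric])
    moreover have "(\<Prod>i\<le>n. exp (y i * L)) \<noteq> 0" by simp
    ultimately show ?thesis
      by (simp add: rGamma_series_def L_def[symmetric] prod_dividef prod.distrib del: pochhammer_Suc)
  qed
  then show "\<forall>\<^sub>F N in sequentially. (\<Prod>i\<le>n. rGamma_series (x i) N / rGamma_series (y i) N) =
      (\<Prod>i\<le>n. pochhammer (x i) (Suc N) / pochhammer (y i) (Suc N))" by simp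
qed

lemma Gamma_rGamma_of_nat:
  assumes "\<alpha> \<notin> \<int>\<^sub>\<le>\<^sub>0"
  shows "Gamma \<alpha> * rGamma (\<alpha> + of_nat t) = 1 / pochhammer \<alpha> t" "pochhammer \<alpha> t \<noteq> 0"
proof -
  show nz: "pochhammer \<alpha> t \<noteq> 0" using assms by (auto simp: pochhammer_eq_0_iff)
  show "Gamma \<alpha> * rGamma (\<alpha> + of_nat t) = 1 / pochhammer \<alpha> t"
    using pochhammer_rGamma[of \<alpha> t] assms nz
    by (simp add: rGamma_inverse_Gamma field_simps Gamma_eq_zero_iff)
qed

lemma Re_pos_not_nonpos_Ints: "0 < Re \<beta> \<Longrightarrow> \<beta> \<notin> \<int>\<^sub>\<le>\<^sub>0"
  by (auto elim!: nonpos_Ints_cases)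

lemma not_nonpos_Ints_add_of_nat:
  "(\<alpha> :: complex) \<notin> \<int>\<^sub>\<le>\<^sub>0 \<Longrightarrow> \<alpha> + of_nat N \<notin> \<int>\<^sub>\<le>\<^sub>0"
  using nonpos_Ints_diff_Nats[of "\<alpha> + of_nat N" "of_nat N"] by auto

lemma inverse_pochhammer_shift_tendsto:
  "(\<lambda>N. 1 / pochhammer (\<alpha> + of_nat N :: complex) t) \<longlonglongrightarrow> (if t = 0 then 1 else 0)"
proof -
  have "(\<lambda>N. \<Prod>j<t. 1 / (\<alpha> + of_nat N + of_nat j)) \<longlonglongrightarrow> (\<Prod>j<t. 0)"
  proof (rule tendsto_prod)
    fix j
    have "filterlim (\<lambda>N. (\<alpha> + of_nat j) + of_nat N) at_infinity sequentially"
      by (rule tendsto_add_filterlim_at_infinity[OF tendsto_const tendsto_of_nat])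
    from tendsto_divide_0[OF tendsto_const this]
    show "(\<lambda>N. 1 / (\<alpha> + of_nat N + of_nat j)) \<longlonglongrightarrow> 0" by (simp add: add_ac)
  qed
  then show ?thesis
    by (cases "t = 0") (simp_all add: pochhammer_prod prod_dividef atLeast0LessThan card_gt_0_iff power_0_left)
qed

text \<open>At \<open>z = - a k\<close> the bilateral sum terminates on the right, and as \<open>a n\<close> tends to \<open>- \<infinity>\<close>
  only its term at \<open>0\<close> survives.\<close>
lemma moment_limit:
  assumes ex: "real j + 1 < Re (excess n a b)" and k: "k < n" and \<alpha>: "1 - a n + a k \<notin> \<int>\<^sub>\<le>\<^sub>0"
  shows "(\<lambda>N. Gamma (1 - a n + a k + of_nat N) * moment n (a(n := a n - of_nat N)) b (- a k) j)
    \<longlonglongrightarrow> (\<Prod>i<n. rGamma (1 - a i + a k)) * (\<Prod>i\<le>n. rGamma (b i - a k)) * (- a k) ^ j"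
proof -
  define \<alpha> where "\<alpha> = 1 - a n + a k"
  define aN where "aN = (\<lambda>N. a(n := a n - of_nat N))"
  \<comment> \<open>The factors of the term that do not contain a_n, and hence do not depend on
    \<open>N\<close>.\<close>
  define c where "c = (\<lambda>y::int. ((- 1) ^ (n + 1)) powi y * (\<Prod>i<n. rGamma (1 - a i + a k - of_int y)) *
    (\<Prod>i\<le>n. rGamma (b i - a k + of_int y)) * (- a k + of_int y) ^ j)"
  define f where "f = (\<lambda>y N. Gamma (\<alpha> + of_nat N) * (bweight n (aN N) b (- a k) y * (- a k + of_int y) ^ j))"
  have f: "f y N = (Gamma (\<alpha> + of_nat N) * rGamma (\<alpha> + of_nat N - of_int y)) * c y" for y N
    by (simp add: f_def bweight_def kern_def prod.distrib c_def lessThan_Suc_atMost[symmetric] aN_def \<alpha>_def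
        algebra_simps)
  have \<alpha>N: "\<alpha> + of_nat N \<notin> \<int>\<^sub>\<le>\<^sub>0" for N
    using \<alpha> unfolding \<alpha>_def by (rule not_nonpos_Ints_add_of_nat)
  \<comment> \<open>The factor i = k is 1/Gamma(1-y), which is 0 for positive
    \<open>y\<close>.\<close>
  have c0: "c y = 0" if "y > 0" for y
  proof -
    have "of_int (1 - y) \<in> (\<int>\<^sub>\<le>\<^sub>0 :: complex set)" using that by (intro nonpos_Ints_of_int) simp
    then have "rGamma (1 - a k + a k - of_int y) = 0" by (simp add: rGamma_eq_zero_iff)
    then have "(\<Prod>i<n. rGamma (1 - a i + a k - of_int y)) = 0" using k by (intro prod_zero) (auto intro!: bexI[of _ k])
    then show ?thesis by (simp add: c_def)
  qed
  have fneg: "f (- int t) N = 1 / pochhammer (\<alpha> + of_nat N) t * c (- int t)" for t N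
    unfolding f using Gamma_rGamma_of_nat(1)[OF \<alpha>N[of N], of t] by simp
  have lim: "f y \<longlonglongrightarrow> (if y = 0 then c 0 else 0)" for y
  proof (cases "y > 0")
    case True
    then have "f y = (\<lambda>N. 0)" by (simp add: fun_eq_iff f c0)
    then show ?thesis using True by simp
  next
    case False
    then obtain t where y: "y = - int t" by (metis nonpos_int_cases not_less)
    have "(\<lambda>N. 1 / pochhammer (\<alpha> + of_nat N) t * c y) \<longlonglongrightarrow> (if t = 0 then 1 else 0) * c y"
      by (intro tendsto_mult_right inverse_pochhammer_shift_tendsto)
    then show ?thesis unfolding y fneg by (cases "t = 0") auto
  qed
  \<comment> \<open>From \<open>N0\<close> on the real part of \<open>\<alpha>\<close> + N is
    nonnegative. The moduli of the Pochhammer factors then increase with \<open>N\<close>, so the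
    term at \<open>N0\<close> dominates all later ones.\<close>
  define N0 where "N0 = nat \<lceil>norm \<alpha>\<rceil>"
  have N0: "0 \<le> Re \<alpha> + real N0"
    using real_nat_ceiling_ge[of "norm \<alpha>"] abs_Re_le_cmod[of \<alpha>] unfolding N0_def by linarith
  have bound: "norm (f y N) \<le> norm (f y N0)" if "N \<ge> N0" for y N
  proof (cases "y > 0")
    case True
    then show ?thesis by (simp add: f c0)
  next
    case False
    then obtain t where y: "y = - int t" by (metis nonpos_int_cases not_less)
    have "norm (pochhammer (\<alpha> + of_nat N0) t) \<le> norm (pochhammer (\<alpha> + of_nat N) t)"
      unfolding pochhammer_prod prod_norm[symmetric]
    proof (intro prod_mono conjI)
      fix j
      have "0 \<le> Re (\<alpha> + of_nat N0 + of_nat j)" using N0 by simp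
      moreover have "Re (\<alpha> + of_nat N0 + of_nat j) \<le> Re (\<alpha> + of_nat N + of_nat j)" using that by simp
      ultimately show "norm (\<alpha> + of_nat N0 + of_nat j) \<le> norm (\<alpha> + of_nat N + of_nat j)"
        using power_mono[of "Re (\<alpha> + of_nat N0 + of_nat j)" "Re (\<alpha> + of_nat N + of_nat j)" 2]
        unfolding cmod_def by simp
    qed auto
    moreover have "0 < norm (pochhammer (\<alpha> + of_nat N0) t)"
      using Gamma_rGamma_of_nat(2)[OF \<alpha>N[of N0], of t] by simp
    ultimately have "1 / norm (pochhammer (\<alpha> + of_nat N) t) \<le> 1 / norm (pochhammer (\<alpha> + of_nat N0) t)"
      by (intro divide_left_mono) (auto intro!: mult_pos_pos)
    then show ?thesis unfolding y fneg norm_mult norm_divide by (intro mult_right_mono) auto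
  qed
  have sum0: "(\<lambda>y. norm (f y N0)) summable_on UNIV"
  proof -
    have "real j + 1 < Re (excess n (aN N0) b)" using ex by (simp add: aN_def excess_shift)
    from summable_on_cmult_right[OF abs_summable_bterm[OF this]]
    show ?thesis unfolding f_def norm_mult[of "Gamma _"] by blast
  qed
  have "(\<lambda>N. \<Sum>\<^sub>\<infinity>y. f y N) \<longlonglongrightarrow> (\<Sum>\<^sub>\<infinity>y. if y = (0::int) then c 0 else 0)"
    by (rule tendsto_infsum_dominated[OF lim _ sum0])
       (use bound in \<open>auto intro!: eventually_mono[OF eventually_ge_at_top[of N0]]\<close>)
  moreover have "(\<Sum>\<^sub>\<infinity>y. if y = (0::int) then c 0 else 0) = c 0"
    by (subst infsum_cong_neutral[where T = "{0}" and g = "\<lambda>_. c 0"]) auto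
  moreover have "(\<Sum>\<^sub>\<infinity>y. f y N) = Gamma (1 - a n + a k + of_nat N) * moment n (a(n := a n - of_nat N)) b (- a k) j" for N
    unfolding f_def moment_def aN_def \<alpha>_def by (rule infsum_cmult_right')
  ultimately show ?thesis by (simp add: c_def)
qed

text \<open>By \<open>moment_det_shifts\<close> the determinant at a_n - N, multiplied by suitable
  Gamma functions and Pochhammer quotients, does not depend on \<open>N\<close>. Its limit, computed
  entry by entry with \<open>moment_limit\<close>, is therefore its value at N = 0.\<close>

lemma moment_det_special:
  assumes ex: "real n < Re (excess n a b)" and \<alpha>: "\<And>k. k < n \<Longrightarrow> 1 - a n + a k \<notin> \<int>\<^sub>\<le>\<^sub>0"
  shows "moment_det n a b (\<lambda>k. - a k) =
    Gamma (excess n a b - of_nat n) * (\<Prod>i\<le>n. \<Prod>k\<le>n. rGamma (b i - a k)) * sine_vand n (\<lambda>k. - a k)"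
proof -
  define z where "z = (\<lambda>k. - a k)"
  define \<beta> where "\<beta> = excess n a b - of_nat n"
  have "Re \<beta> > 0" using ex by (simp add: \<beta>_def)
  then have "\<beta> \<notin> \<int>\<^sub>\<le>\<^sub>0" by (rule Re_pos_not_nonpos_Ints)
  define \<alpha> where "\<alpha> = (\<lambda>k. 1 - a n + a k)"
  define D where "D = (\<lambda>N. moment_det n (a(n := a n - of_nat N)) b z)"
  define E where "E = (\<lambda>k. (\<Prod>i<n. rGamma (1 - a i + a k)) * (\<Prod>i\<le>n. rGamma (b i - a k)))"
  \<comment> \<open>The Pochhammer symbols to be divided out: that of \<open>\<beta>\<close> comes
    from the shifts, those of the \<open>\<alpha> k\<close> from the Gamma functions. Their
    parameters have the same sum as the b_i - a_n, as the limit of the quotient requires.\<close>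
  define y where "y = \<alpha>(n := \<beta>)"
  have y: "y i \<notin> \<int>\<^sub>\<le>\<^sub>0" if "i \<le> n" for i
    using that assms(2)[of i] \<open>\<beta> \<notin> \<int>\<^sub>\<le>\<^sub>0\<close> by (auto simp: y_def \<alpha>_def)
  have prod_y: "(\<Prod>i\<le>n. h (y i)) = h \<beta> * (\<Prod>k<n. h (\<alpha> k))" for h :: "complex \<Rightarrow> complex"
    by (simp add: lessThan_Suc_atMost[symmetric] y_def mult.commute)
  have "(\<lambda>N. (\<Prod>k<n. Gamma (\<alpha> k + of_nat N)) * D N) \<longlonglongrightarrow> (\<Prod>k<n. E k) * vand n z"
  proof -
    have "(\<lambda>N. detf n (\<lambda>k j. Gamma (\<alpha> k + of_nat N) * moment n (a(n := a n - of_nat N)) b (z k) j))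
        \<longlonglongrightarrow> detf n (\<lambda>k j. E k * z k ^ j)"
      unfolding detf_leibniz
    proof (intro tendsto_sum tendsto_mult_left tendsto_prod)
      fix p i assume "p \<in> {p. p permutes {..<n}}" "i \<in> {..<n}"
      then have "i < n" "p i < n" using permutes_in_image by fastforce+
      then show "(\<lambda>N. Gamma (\<alpha> i + of_nat N) * moment n (a(n := a n - of_nat N)) b (z i) (p i)) \<longlonglongrightarrow> E i * z i ^ p i"
        unfolding E_def z_def \<alpha>_def by (intro moment_limit) (use ex assms(2) in auto)
    qed
    then show ?thesis unfolding detf_row_scale D_def moment_det_def detf_vandermonde .
  qed
  moreover have "(\<lambda>N. \<Prod>i\<le>n. pochhammer (b i - a n) N / pochhammer (y i) N) \<longlonglongrightarrow> (\<Prod>i\<le>n. rGamma (b i - a n) / rGamma (y i))"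
  proof (rule prod_pochhammer_ratio_tendsto[OF _ y])
    have "(\<Sum>i\<le>n. y i) = \<beta> + (\<Sum>k<n. \<alpha> k)"
      by (simp add: lessThan_Suc_atMost[symmetric] y_def add.commute)
    then show "(\<Sum>i\<le>n. b i - a n) = (\<Sum>i\<le>n. y i)"
      by (simp add: \<beta>_def \<alpha>_def excess_def sum_subtractf sum.distrib lessThan_Suc_atMost[symmetric] algebra_simps)
  qed auto
  ultimately have "(\<lambda>N. ((\<Prod>k<n. Gamma (\<alpha> k + of_nat N)) * D N) * (\<Prod>i\<le>n. pochhammer (b i - a n) N / pochhammer (y i) N))
    \<longlonglongrightarrow> ((\<Prod>k<n. E k) * vand n z) * (\<Prod>i\<le>n. rGamma (b i - a n) / rGamma (y i))"
    by (rule tendsto_mult)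
  moreover have "((\<Prod>k<n. Gamma (\<alpha> k + of_nat N)) * D N) * (\<Prod>i\<le>n. pochhammer (b i - a n) N / pochhammer (y i) N) =
      (\<Prod>k<n. Gamma (\<alpha> k)) * moment_det n a b z" for N
  proof -
    have g: "(\<Prod>k<n. Gamma (\<alpha> k + of_nat N)) = (\<Prod>k<n. Gamma (\<alpha> k)) * (\<Prod>k<n. pochhammer (\<alpha> k) N)"
      unfolding prod.distrib[symmetric]
      using assms(2) by (intro prod.cong refl) (simp add: pochhammer_Gamma \<alpha>_def Gamma_eq_zero_iff)
    have nz: "pochhammer \<beta> N \<noteq> 0" "(\<Prod>k<n. pochhammer (\<alpha> k) N) \<noteq> 0"
      using Gamma_rGamma_of_nat(2)[of _ N] assms(2) \<open>\<beta> \<notin> \<int>\<^sub>\<le>\<^sub>0\<close> by (auto simp: \<alpha>_def)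
    have "D N * (\<Prod>i\<le>n. pochhammer (b i - a n) N) = moment_det n a b z * pochhammer \<beta> N"
      using moment_det_shifts[OF ex, of z N] by (simp add: D_def \<beta>_def)
    then show ?thesis
      using nz unfolding g prod_dividef prod_y[of "\<lambda>x. pochhammer x N"] by (simp add: field_simps)
  qed
  ultimately have "(\<Prod>k<n. Gamma (\<alpha> k)) * moment_det n a b z = ((\<Prod>k<n. E k) * vand n z) * (\<Prod>i\<le>n. rGamma (b i - a n) / rGamma (y i))"
    using LIMSEQ_unique[OF _ tendsto_const] by (simp add: tendsto_const_iff)
  also have "(\<Prod>i\<le>n. rGamma (b i - a n) / rGamma (y i)) = (\<Prod>i\<le>n. rGamma (b i - a n)) * (Gamma \<beta> * (\<Prod>k<n. Gamma (\<alpha> k)))"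
    unfolding prod_dividef prod_y[of rGamma] by (simp add: rGamma_inverse_Gamma prod_inversef[symmetric] divide_inverse flip: prod_inversef)
  finally have "(\<Prod>k<n. Gamma (\<alpha> k)) * moment_det n a b z =
      (\<Prod>k<n. Gamma (\<alpha> k)) * ((\<Prod>k<n. E k) * vand n z * (\<Prod>i\<le>n. rGamma (b i - a n)) * Gamma \<beta>)"
    by (simp only: mult_ac)
  moreover have "(\<Prod>k<n. Gamma (\<alpha> k)) \<noteq> 0" using assms(2) by (auto simp: \<alpha>_def Gamma_eq_zero_iff)
  ultimately have "moment_det n a b z = (\<Prod>k<n. E k) * vand n z * (\<Prod>i\<le>n. rGamma (b i - a n)) * Gamma \<beta>"
    by (metis mult_left_cancel)
  also have "(\<Prod>k<n. E k) = (\<Prod>i<n. \<Prod>k<n. rGamma (1 + z k - z i)) * (\<Prod>k<n. \<Prod>i\<le>n. rGamma (b i - a k))"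
    by (simp add: E_def prod.distrib z_def)
  also have "(\<Prod>k<n. \<Prod>i\<le>n. rGamma (b i - a k)) = (\<Prod>i\<le>n. \<Prod>k<n. rGamma (b i - a k))"
    by (rule prod.swap)
  finally show ?thesis
    unfolding z_def[symmetric] sine_vand_def \<beta>_def[symmetric] lessThan_Suc_atMost[symmetric, of n]
    by (simp add: prod.distrib mult_ac)
qed


lemma rGamma_tendsto:
  fixes f :: "'a \<Rightarrow> complex"
  shows "(f \<longlongrightarrow> l) F \<Longrightarrow> ((\<lambda>x. rGamma (f x)) \<longlongrightarrow> rGamma l) F"
  using continuous_on_rGamma[of UNIV] by (rule continuous_on_tendsto_compose) auto

text \<open>Both sides are multiples of \<open>sine_vand\<close>, so one point with nonzero sines
  decides the constant. The point z = -a is one if no two a_i differ by an integer.\<close>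

lemma moment_det_special_generic:
  assumes n: "n \<ge> 1" and ex: "real n < Re (excess n a b)"
    and dist: "\<And>i j. i \<le> n \<Longrightarrow> j \<le> n \<Longrightarrow> i \<noteq> j \<Longrightarrow> a i - a j \<notin> \<int>"
  shows "moment_det n a b z =
    Gamma (excess n a b - of_nat n) * (\<Prod>i\<le>n. \<Prod>k\<le>n. rGamma (b i - a k)) * sine_vand n z"
proof -
  obtain C where C: "\<And>z. moment_det n a b z = C * sine_vand n z"
    using moment_det_sine_vand[OF n ex] by blast
  have "sine_vand n (\<lambda>k. - a k) \<noteq> 0"
  proof -
    have "sin (of_real pi * (- a j - - a i)) \<noteq> 0" if "j < n" "i < j" for i j
    proof
      assume "sin (of_real pi * (- a j - - a i)) = 0"
      then obtain k :: int where "of_real pi * (- a j - - a i) = of_real (of_int k * pi)"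
        by (auto simp: sin_eq_0)
      then have "of_real pi * (a i - a j) = of_real pi * of_int k" by (simp add: algebra_simps)
      then have "a i - a j = of_int k" by simp
      then show False using dist[of i j] that by simp
    qed
    then show ?thesis unfolding sine_vand_altdef by auto
  qed
  moreover have "1 - a n + a k \<notin> \<int>\<^sub>\<le>\<^sub>0" if "k < n" for k
  proof
    assume "1 - a n + a k \<in> \<int>\<^sub>\<le>\<^sub>0"
    then have "(1 - a n + a k) - 1 \<in> \<int>" by (intro Ints_diff) (auto elim: nonpos_Ints_Int)
    then show False using dist[of k n] that by simp
  qed
  note moment_det_special[OF ex this]
  ultimately have "C = Gamma (excess n a b - of_nat n) * (\<Prod>i\<le>n. \<Prod>k\<le>n. rGamma (b i - a k))"
    unfolding C by (metis mult_right_cancel)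
  then show ?thesis unfolding C by simp
qed

lemma eventually_not_Ints:
  fixes d :: complex and m :: real
  assumes "m \<noteq> 0"
  shows "eventually (\<lambda>\<epsilon>::real. d + of_real (m * \<epsilon>) \<notin> \<int>) (at_right 0)"
proof (cases "d \<in> \<int>")
  case True
  have "eventually (\<lambda>\<epsilon>::real. 0 < \<epsilon> \<and> \<epsilon> < 1 / \<bar>m\<bar>) (at_right 0)"
    using assms by (intro eventually_conj eventually_at_right_less eventually_at_right_real[THEN eventually_mono]) auto
  then show ?thesis
  proof eventually_elim
    case (elim \<epsilon>)
    show ?case
    proof
      assume "d + of_real (m * \<epsilon>) \<in> \<int>"
      then have "d + of_real (m * \<epsilon>) - d \<in> \<int>" using True by (rule Ints_diff)
      then obtain k :: int where "complex_of_real (m * \<epsilon>) = of_int k" by (auto elim: Ints_cases)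
      then have k: "m * \<epsilon> = of_int k" by (metis of_real_eq_iff of_real_of_int_eq)
      have "\<bar>m * \<epsilon>\<bar> < 1" "m * \<epsilon> \<noteq> 0" using elim assms by (auto simp: abs_mult field_simps)
      then show False unfolding k by simp
    qed
  qed
next
  case False
  have "((\<lambda>\<epsilon>::real. d + of_real (m * \<epsilon>)) \<longlongrightarrow> d + of_real (m * 0)) (at_right 0)"
    by (intro tendsto_intros)
  from topological_tendstoD[OF this, of "- \<int>"] show ?thesis using False by (simp add: open_Compl)
qed

text \<open>Perturbing \<open>a\<close> removes the genericity hypothesis.\<close>
lemma moment_det_eq:
  assumes n: "n \<ge> 1" and ex: "real n < Re (excess n a b)"
  shows "moment_det n a b z =
    Gamma (excess n a b - of_nat n) * (\<Prod>i\<le>n. \<Prod>k\<le>n. rGamma (b i - a k)) * sine_vand n z"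
proof -
  \<comment> \<open>The slopes are distinct, so for all small positive \<open>\<epsilon>\<close> no
    two perturbed parameters differ by an integer.\<close>
  define A where "A = (\<lambda>\<epsilon>::real. \<lambda>i. a i + of_real (real i * \<epsilon>))"
  let ?F = "at_right (0::real)"
  have A_lim: "((\<lambda>\<epsilon>. A \<epsilon> i) \<longlongrightarrow> a i) ?F" for i
  proof -
    have "((\<lambda>\<epsilon>. A \<epsilon> i) \<longlongrightarrow> a i + of_real (real i * 0)) ?F" unfolding A_def by (intro tendsto_intros)
    then show ?thesis by simp
  qed
  have ex_lim: "((\<lambda>\<epsilon>. excess n (A \<epsilon>) b) \<longlongrightarrow> excess n a b) ?F"
    unfolding excess_def by (intro tendsto_intros A_lim)
  \<comment> \<open>An exponent strictly between \<open>n\<close> and the limiting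
    \<open>excess\<close>, so that a single summable majorant serves all small
    perturbations.\<close>
  obtain \<sigma> where \<sigma>: "real n < \<sigma>" "\<sigma> < Re (excess n a b)" using ex dense by blast
  have ev_ex: "eventually (\<lambda>\<epsilon>. \<sigma> < Re (excess n (A \<epsilon>) b)) ?F"
    by (rule order_tendstoD(1)[OF tendsto_Re[OF ex_lim] \<sigma>(2)])
  have ev_dist: "eventually (\<lambda>\<epsilon>. \<forall>i\<in>{..n}. \<forall>j\<in>{..n}. i \<noteq> j \<longrightarrow> A \<epsilon> i - A \<epsilon> j \<notin> \<int>) ?F"
  proof (intro eventually_ball_finite finite_atMost ballI)
    fix i j
    show "eventually (\<lambda>\<epsilon>. i \<noteq> j \<longrightarrow> A \<epsilon> i - A \<epsilon> j \<notin> \<int>) ?F"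
    proof (cases "i = j")
      case False
      then have "eventually (\<lambda>\<epsilon>::real. (a i - a j) + of_real ((real i - real j) * \<epsilon>) \<notin> \<int>) ?F"
        by (intro eventually_not_Ints) auto
      then show ?thesis by eventually_elim (simp add: A_def algebra_simps)
    qed simp
  qed
  obtain \<rho>0 :: real where \<rho>0: "0 \<le> \<rho>0" "\<forall>i\<le>n. norm (a i) \<le> \<rho>0 \<and> norm (b i) \<le> \<rho>0"
    using bounded_parameters by metis
  define \<rho> where "\<rho> = \<rho>0 + real n"
  have "\<rho> \<ge> 0" using \<rho>0 by (simp add: \<rho>_def)
  have ev_bd: "eventually (\<lambda>\<epsilon>. \<forall>i\<le>n. norm (A \<epsilon> i) \<le> \<rho> \<and> norm (b i) \<le> \<rho>) ?F"
  proof -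
    have "eventually (\<lambda>\<epsilon>. \<epsilon> \<in> {0<..<(1::real)}) ?F" by (intro eventually_at_right_real) simp
    then show ?thesis
    proof eventually_elim
      case (elim \<epsilon>)
      show ?case
      proof (intro allI impI)
      fix i assume "i \<le> n"
      have "norm (A \<epsilon> i) \<le> norm (a i) + norm (complex_of_real (real i * \<epsilon>))"
        unfolding A_def by (rule norm_triangle_ineq)
      also have "norm (complex_of_real (real i * \<epsilon>)) = real i * \<epsilon>" using elim by (simp add: norm_mult)
      also have "\<dots> \<le> real n * 1" using elim \<open>i \<le> n\<close> by (intro mult_mono) auto
      finally show "norm (A \<epsilon> i) \<le> \<rho> \<and> norm (b i) \<le> \<rho>" using \<rho>0(2) \<open>i \<le> n\<close> by (force simp: \<rho>_def)
    qed
  qed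
  qed
  have mom: "((\<lambda>\<epsilon>. moment n (A \<epsilon>) b u j) \<longlongrightarrow> moment n a b u j) ?F" if j: "j < n" for u j
  proof -
    have j\<sigma>: "real j \<le> \<sigma>" using j \<sigma>(1) by simp
    obtain K where K: "\<And>a b z y. (\<forall>i\<le>n. norm (a i) \<le> \<rho> \<and> norm (b i) \<le> \<rho>) \<Longrightarrow> norm z \<le> norm u \<Longrightarrow> \<sigma> \<le> Re (excess n a b) \<Longrightarrow>
      norm (bweight n a b z y * (z + of_int y) ^ j) \<le> K * (1 + \<bar>real_of_int y\<bar>) powr (real j - \<sigma>)"
      using bterm_bound[OF \<open>\<rho> \<ge> 0\<close> norm_ge_zero[of u] j\<sigma>, of n] by blast
    show ?thesis unfolding moment_def
    proof (rule tendsto_infsum_dominated)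
      show "((\<lambda>\<epsilon>. bweight n (A \<epsilon>) b u y * (u + of_int y) ^ j) \<longlongrightarrow> bweight n a b u y * (u + of_int y) ^ j) ?F" for y
        unfolding bweight_def kern_def by (intro tendsto_intros rGamma_tendsto A_lim)
      show "eventually (\<lambda>\<epsilon>. \<forall>y\<in>UNIV. norm (bweight n (A \<epsilon>) b u y * (u + of_int y) ^ j) \<le> K * (1 + \<bar>real_of_int y\<bar>) powr (real j - \<sigma>)) ?F"
        using ev_bd ev_ex by eventually_elim (intro ballI K, auto)
      show "(\<lambda>y::int. K * (1 + \<bar>real_of_int y\<bar>) powr (real j - \<sigma>)) summable_on UNIV"
        using j \<sigma>(1) by (intro summable_on_cmult_right summable_on_int_powr) auto
    qed simp
  qed
  have "((\<lambda>\<epsilon>. moment_det n (A \<epsilon>) b z) \<longlongrightarrow> moment_det n a b z) ?F"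
    unfolding moment_det_def detf_leibniz
  proof (intro tendsto_intros mom)
    fix p i assume "p \<in> {p. p permutes {..<n}}" "i \<in> {..<n}"
    then show "p i < n" using permutes_in_image by fastforce
  qed
  moreover have "((\<lambda>\<epsilon>. moment_det n (A \<epsilon>) b z) \<longlongrightarrow>
    Gamma (excess n a b - of_nat n) * (\<Prod>i\<le>n. \<Prod>k\<le>n. rGamma (b i - a k)) * sine_vand n z) ?F"
  proof (rule Lim_transform_eventually)
    have "Re (excess n a b - of_nat n) > 0" using ex by simp
    then have "excess n a b - of_nat n \<notin> \<int>\<^sub>\<le>\<^sub>0" by (rule Re_pos_not_nonpos_Ints)
    then show "((\<lambda>\<epsilon>. Gamma (excess n (A \<epsilon>) b - of_nat n) * (\<Prod>i\<le>n. \<Prod>k\<le>n. rGamma (b i - A \<epsilon> k)) * sine_vand n z) \<longlongrightarrow>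
      Gamma (excess n a b - of_nat n) * (\<Prod>i\<le>n. \<Prod>k\<le>n. rGamma (b i - a k)) * sine_vand n z) ?F"
      by (intro tendsto_intros rGamma_tendsto A_lim ex_lim)
    show "eventually (\<lambda>\<epsilon>. Gamma (excess n (A \<epsilon>) b - of_nat n) * (\<Prod>i\<le>n. \<Prod>k\<le>n. rGamma (b i - A \<epsilon> k)) * sine_vand n z =
      moment_det n (A \<epsilon>) b z) ?F"
      using ev_ex ev_dist
      by eventually_elim (rule moment_det_special_generic[symmetric], use n \<sigma>(1) in auto)
  qed
  ultimately show ?thesis by (rule tendsto_unique[rotated]) simp
qed

section \<open>Block expansion of the finite determinant\<close>

text \<open>Multilinearity in the rows: \<open>T\<close> is the set of rows that contribute their
  first summand.\<close>

lemma detf_binomial_rows: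
  fixes \<alpha> \<beta> u v :: "nat \<Rightarrow> complex"
  shows "detf q (\<lambda>l k. \<alpha> l * u l ^ k + \<beta> l * v l ^ k) =
    (\<Sum>T\<in>Pow {..<q}. (\<Prod>l<q. if l \<in> T then \<alpha> l else \<beta> l) * vand q (\<lambda>l. if l \<in> T then u l else v l))"
proof -
  have expand: "(\<Prod>l<q. f l + g l) = (\<Sum>T\<in>Pow {..<q}. \<Prod>l<q. if l \<in> T then f l else g l)" for f g :: "nat \<Rightarrow> complex"
  proof -
    have "prod f T * prod g ({..<q} - T) = (\<Prod>l<q. if l \<in> T then f l else g l)" if "T \<in> Pow {..<q}" for T
    proof -
      have "(\<Prod>l<q. if l \<in> T then f l else g l) = prod f ({..<q} \<inter> T) * prod g ({..<q} \<inter> - T)"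
        by (subst prod.If_cases) (auto simp: Collect_neg_eq)
      moreover have "{..<q} \<inter> T = T" "{..<q} \<inter> - T = {..<q} - T" using that by auto
      ultimately show ?thesis by simp
    qed
    then show ?thesis by (subst prod_add) auto
  qed
  have "detf q (\<lambda>l k. \<alpha> l * u l ^ k + \<beta> l * v l ^ k) =
    (\<Sum>p | p permutes {..<q}. \<Sum>T\<in>Pow {..<q}. signof p *
      (\<Prod>l<q. if l \<in> T then \<alpha> l * u l ^ p l else \<beta> l * v l ^ p l))"
    unfolding detf_leibniz expand by (simp add: sum_distrib_left)
  also have "\<dots> = (\<Sum>T\<in>Pow {..<q}. \<Sum>p | p permutes {..<q}. signof p *
      (\<Prod>l<q. if l \<in> T then \<alpha> l * u l ^ p l else \<beta> l * v l ^ p l))"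
    by (rule sum.swap)
  also have "\<dots> = (\<Sum>T\<in>Pow {..<q}. detf q (\<lambda>l k. (if l \<in> T then \<alpha> l else \<beta> l) * (if l \<in> T then u l else v l) ^ k))"
    unfolding detf_leibniz by (intro sum.cong refl arg_cong2[of _ _ _ _ "(*)"] prod.cong) auto
  also have "\<dots> = (\<Sum>T\<in>Pow {..<q}. (\<Prod>l<q. if l \<in> T then \<alpha> l else \<beta> l) * vand q (\<lambda>l. if l \<in> T then u l else v l))"
    by (simp only: detf_row_scale detf_vandermonde)
  finally show ?thesis .
qed

section \<open>Rows grouped into blocks\<close>

definition offset :: "(nat \<Rightarrow> nat) \<Rightarrow> nat \<Rightarrow> nat" where
  "offset m i = (\<Sum>k<i. m k)"

lemma offset_Suc: "offset m (Suc i) = offset m i + m i"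
  by (simp add: offset_def)

lemma offset_less:
  assumes "i < p" "t < m i"
  shows "offset m i + t < offset m p"
proof -
  have "offset m (Suc i) \<le> offset m p"
    unfolding offset_def using assms by (intro sum_mono2) auto
  then show ?thesis using assms by (simp add: offset_Suc)
qed

lemma offset_cases:
  assumes "l < offset m p"
  obtains i t where "i < p" "t < m i" "l = offset m i + t"
  using assms
proof (induction p arbitrary: thesis)
  case 0
  then show ?case by (simp add: offset_def)
next
  case (Suc p)
  show ?case
  proof (cases "l < offset m p")
    case True
    show ?thesis
    proof (rule Suc.IH[OF _ True])
      fix i t assume "i < p" "t < m i" "l = offset m i + t"
      then show thesis using Suc.prems(1)[of i t] by simp
    qed
  next
    case False
    then show ?thesis using Suc.prems(1)[of p "l - offset m p"] Suc.prems(2) by (simp add: offset_Suc)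
  qed
qed

lemma block_enumeration: "\<exists>e. \<forall>i<p. \<forall>t<m i. e (offset m i + t) = (i, t)"
proof (induction p)
  case (Suc p)
  then obtain e where e: "\<forall>i<p. \<forall>t<m i. e (offset m i + t) = (i, t)" by blast
  show ?case
  proof (intro exI[of _ "\<lambda>l. if l < offset m p then e l else (p, l - offset m p)"] allI impI)
    fix i t assume "i < Suc p" "t < m i"
    then show "(if offset m i + t < offset m p then e (offset m i + t) else (p, offset m i + t - offset m p)) = (i, t)"
      using e offset_less[of i p t m] by (cases "i = p") auto
  qed
qed auto

lemma prod_blocks:
  "(\<Prod>l<offset m p. f l :: 'a :: comm_monoid_mult) = (\<Prod>i<p. \<Prod>t<m i. f (offset m i + t))"
  by (induction p) (simp_all add: offset_Suc prod_lessThan_add, simp add: offset_def)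

lemma vand_blocks:
  fixes s :: "nat \<Rightarrow> 'a :: comm_ring_1"
  shows "vand (offset m p) s = (\<Prod>j<p. vand (m j) (\<lambda>t. s (offset m j + t))) *
    (\<Prod>j<p. \<Prod>i<j. \<Prod>t<m j. \<Prod>t'<m i. s (offset m j + t) - s (offset m i + t'))"
proof (induction p)
  case (Suc p)
  have "(\<Prod>l<m p. \<Prod>k<offset m p. s (offset m p + l) - s k) =
    (\<Prod>i<p. \<Prod>t<m p. \<Prod>t'<m i. s (offset m p + t) - s (offset m i + t'))"
    unfolding prod_blocks by (rule prod.swap)
  with Suc show ?case by (simp add: offset_Suc vand_append mult_ac)
qed (simp add: offset_def vand_def)

section \<open>Vandermonde products with one node missing from each block\<close>

definition skip :: "nat \<Rightarrow> nat \<Rightarrow> nat" where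
  "skip x t = (if t < x then t else Suc t)"

lemma prod_skip:
  fixes f :: "nat \<Rightarrow> 'a :: comm_monoid_mult"
  assumes "x \<le> m"
  shows "(\<Prod>u<Suc m. f u) = f x * (\<Prod>t<m. f (skip x t))"
proof -
  have "(\<Prod>t<m. f (skip x t)) = (\<Prod>u\<in>{..<Suc m} - {x}. f u)"
    by (rule prod.reindex_bij_witness[of _ "\<lambda>u. if u < x then u else u - 1" "skip x"])
       (use assms in \<open>auto simp: skip_def\<close>)
  then show ?thesis using assms by (subst prod.remove[of _ x]) auto
qed

lemma vand_skip:
  fixes s :: "nat \<Rightarrow> 'a :: comm_ring_1"
  assumes "x \<le> m"
  shows "vand (Suc m) s = vand m (\<lambda>t. s (skip x t)) * (\<Prod>u<x. s x - s u) * (\<Prod>u\<in>{x<..m}. s u - s x)"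
  using assms
proof (induction m)
  case (Suc m)
  show ?case
  proof (cases "x = Suc m")
    case True
    have "vand (Suc m) (\<lambda>t. s (skip x t)) = vand (Suc m) s"
      unfolding vand_def by (intro prod.cong refl) (use True in \<open>auto simp: skip_def\<close>)
    then show ?thesis using True by (simp add: vand_def)
  next
    case False
    then have x: "x \<le> m" using Suc.prems by simp
    have Q: "(\<Prod>t<m. s (skip x m) - s (skip x t)) * (s (Suc m) - s x) = (\<Prod>u<Suc m. s (Suc m) - s u)"
      using prod_skip[OF x, of "\<lambda>u. s (Suc m) - s u"] x by (simp add: skip_def mult.commute)
    have "{x<..Suc m} = insert (Suc m) {x<..m}" using x by auto
    then have U: "(\<Prod>u\<in>{x<..Suc m}. s u - s x) = (s (Suc m) - s x) * (\<Prod>u\<in>{x<..m}. s u - s x)" by simp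
    have V1: "vand (Suc (Suc m)) s = vand (Suc m) s * (\<Prod>u<Suc m. s (Suc m) - s u)" by (simp add: vand_def)
    have V2: "vand (Suc m) (\<lambda>t. s (skip x t)) = vand m (\<lambda>t. s (skip x t)) * (\<Prod>t<m. s (skip x m) - s (skip x t))"
      by (simp add: vand_def)
    show ?thesis unfolding V1 V2 U Suc.IH[OF x] Q[symmetric] by (simp only: mult_ac)
  qed
qed (simp add: vand_def)

text \<open>Adding row \<open>x\<close> and column \<open>x'\<close> back to the grid counts their
  crossing point twice, hence the extra \<open>g x x'\<close>.\<close>

lemma prod_skip_skip:
  fixes g :: "nat \<Rightarrow> nat \<Rightarrow> 'a :: comm_monoid_mult"
  assumes "x \<le> m" "x' \<le> m'"
  shows "(\<Prod>t<m. \<Prod>t'<m'. g (skip x t) (skip x' t')) * (\<Prod>u'<Suc m'. g x u') * (\<Prod>u<Suc m. g u x') =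
    (\<Prod>u<Suc m. \<Prod>u'<Suc m'. g u u') * g x x'"
proof -
  have "(\<Prod>u<Suc m. \<Prod>u'<Suc m'. g u u') = (\<Prod>u'<Suc m'. g x u') *
      ((\<Prod>t<m. g (skip x t) x') * (\<Prod>t<m. \<Prod>t'<m'. g (skip x t) (skip x' t')))"
    unfolding prod_skip[OF assms(1)] prod_skip[OF assms(2), of "g (skip x _)"] prod.distrib ..
  moreover have "(\<Prod>u<Suc m. g u x') = g x x' * (\<Prod>t<m. g (skip x t) x')" by (rule prod_skip[OF assms(1)])
  ultimately show ?thesis by (simp only: mult_ac)
qed

text \<open>Both sides are the Pochhammer symbol of d - m of length m+1+x, cut after m+1 factors and
  after x factors. A quotient of products of length m+1 thus becomes one of length x.\<close>

lemma pochhammer_exchange: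
  "pochhammer (d - of_nat m) (Suc m) * pochhammer (1 + d) x =
   pochhammer (d - of_nat m) x * pochhammer (d + of_nat x - of_nat m :: complex) (Suc m)"
  using pochhammer_product'[of "d - of_nat m" "Suc m" x] pochhammer_product'[of "d - of_nat m" x "Suc m"]
  by (simp add: algebra_simps del: pochhammer_Suc)

lemma prod_descending: "(\<Prod>u<Suc m. d - of_nat u) = pochhammer (d - of_nat m :: complex) (Suc m)"
  unfolding pochhammer_prod
  by (rule prod.reindex_bij_witness[of _ "\<lambda>i. m - i" "\<lambda>i. m - i"]) (auto simp: of_nat_diff)

text \<open>Omitting node \<open>x\<close> instead of node 0 from m+1 equally spaced nodes
  multiplies the product by a binomial coefficient. Written with Pochhammer symbols it is, up to
  sign, the factor i = k of the last product in the theorem.\<close>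

lemma vand_block_ratio:
  fixes c :: complex
  assumes "x \<le> m"
  defines "s \<equiv> \<lambda>u. 1 - c - of_nat u"
  shows "vand m (\<lambda>t. s (skip x t)) = vand m (\<lambda>t. s (skip 0 t)) * ((- 1) ^ x * pochhammer (- of_nat m) x / fact x)"
proof -
  have 1: "(\<Prod>u<x. s x - s u) * (\<Prod>u\<in>{x<..m}. s u - s x) = (- 1) ^ m * fact x * fact (m - x)" if "x \<le> m" for x
  proof -
    have "(\<Prod>u<x. s x - s u) = (\<Prod>j\<in>{1..x}. - of_nat j)"
      by (rule prod.reindex_bij_witness[of _ "\<lambda>j. x - j" "\<lambda>u. x - u"]) (auto simp: s_def of_nat_diff)
    moreover have "(\<Prod>u\<in>{x<..m}. s u - s x) = (\<Prod>j\<in>{1..m - x}. - of_nat j)"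
      by (rule prod.reindex_bij_witness[of _ "\<lambda>j. x + j" "\<lambda>u. u - x"]) (auto simp: s_def of_nat_diff)
    moreover have "(\<Prod>j\<in>{1..k}. - of_nat j) = (- 1) ^ k * (fact k :: complex)" for k
      by (simp add: fact_prod prod_uminus of_nat_prod)
    moreover have "(- 1 :: complex) ^ m = (- 1) ^ x * (- 1) ^ (m - x)" using that by (simp add: power_add[symmetric])
    ultimately show ?thesis by (simp add: mult_ac)
  qed
  have "vand m (\<lambda>t. s (skip x t)) * ((- 1) ^ m * fact x * fact (m - x)) = vand (Suc m) s"
    using vand_skip[OF assms(1), of s] 1[OF assms(1)] by (simp add: mult.assoc)
  also have "\<dots> = vand m (\<lambda>t. s (skip 0 t)) * ((- 1) ^ m * fact m)"
    using vand_skip[of 0 m s] 1[of 0] by (simp add: mult.assoc)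
  finally have "vand m (\<lambda>t. s (skip x t)) = vand m (\<lambda>t. s (skip 0 t)) * (fact m / (fact x * fact (m - x)))"
    by (simp add: field_simps)
  also have "fact m / (fact x * fact (m - x)) = (of_nat (m choose x) :: complex)"
    using assms(1) by (simp add: binomial_fact)
  also have "\<dots> = (- 1) ^ x * pochhammer (- of_nat m) x / fact x"
    unfolding binomial_gbinomial gbinomial_pochhammer ..
  finally show ?thesis .
qed

lemma nonzero_add_of_nat:
  fixes d :: complex
  assumes "d \<noteq> 0" "\<And>j. j \<le> m \<Longrightarrow> pochhammer (1 + d) j \<noteq> 0" "j \<le> m"
  shows "d + of_nat j \<noteq> 0"
proof (cases j)
  case (Suc i)
  then have "pochhammer (1 + d) i * (1 + d + of_nat i) \<noteq> 0"
    using assms(2)[OF assms(3)] by (simp only: pochhammer_Suc not_False_eq_True)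
  then have "1 + d + of_nat i \<noteq> 0" by simp
  moreover have "d + of_nat j = 1 + d + of_nat i" by (simp add: Suc)
  ultimately show ?thesis by metis
qed (use assms(1) in simp)

text \<open>By \<open>prod_skip_skip\<close> the punctured grid times its missing row and column is
  the full grid times the crossing entry. Comparison with x = x' = 0 eliminates the full grid: the
  crossing entries give a factor of Delta(c+x)/Delta(c), the row and column products the two
  Pochhammer quotients.\<close>

lemma cross_block_ratio:
  fixes c c' :: complex
  assumes x: "x \<le> m" "x' \<le> m'"
    and nz: "c \<noteq> c'" "\<And>j. j \<le> m \<Longrightarrow> pochhammer (1 + c - c') j \<noteq> 0" "\<And>j. j \<le> m' \<Longrightarrow> pochhammer (1 + c' - c) j \<noteq> 0"
  defines "g \<equiv> \<lambda>u u'. (1 - c - of_nat u) - (1 - c' - of_nat u')"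
  shows "(\<Prod>t<m. \<Prod>t'<m'. g (skip x t) (skip x' t')) = (\<Prod>t<m. \<Prod>t'<m'. g (skip 0 t) (skip 0 t')) *
    ((c' + of_nat x' - c - of_nat x) / (c' - c) *
     (pochhammer (c - c' - of_nat m') x / pochhammer (1 + c - c') x) *
     (pochhammer (c' - c - of_nat m) x' / pochhammer (1 + c' - c) x'))"
proof -
  define d where "d = c - c'"
  define R where "R = (\<lambda>x. \<Prod>u'<Suc m'. g x u')"
  define C where "C = (\<lambda>x'. \<Prod>u<Suc m. g u x')"
  define N where "N = (\<lambda>x x'. \<Prod>t<m. \<Prod>t'<m'. g (skip x t) (skip x' t'))"
  have nz_add: "d + of_nat j \<noteq> 0" if "j \<le> m" for j
    using nonzero_add_of_nat[of d m j] nz that by (simp add: d_def add_diff_eq)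
  have nz_sub: "d - of_nat j \<noteq> 0" if "j \<le> m'" for j
  proof -
    have "- d + of_nat j \<noteq> 0" using nonzero_add_of_nat[of "- d" m' j] nz that by (simp add: d_def add_diff_eq)
    then show ?thesis by (simp add: add.commute)
  qed
  \<comment> \<open>Only integer shifts of \<open>d\<close> between -m' and m occur, and the two
    Pochhammer hypotheses exclude zeros on either side.\<close>
  have nz_all: "d + of_nat j - of_nat k \<noteq> 0" if "j \<le> m" "k \<le> m'" for j k
  proof (cases "k \<le> j")
    case True
    then have *: "d + of_nat j - of_nat k = d + of_nat (j - k)" by (simp add: of_nat_diff)
    show ?thesis unfolding * using that by (intro nz_add) simp
  next
    case False
    then have *: "d + of_nat j - of_nat k = d - of_nat (k - j)" by (simp add: of_nat_diff)
    show ?thesis unfolding * using that by (intro nz_sub) simp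
  qed
  have R: "R x = (- 1) ^ Suc m' * pochhammer (d + of_nat x - of_nat m') (Suc m')" for x
  proof -
    have "R x = (\<Prod>u'<Suc m'. (- 1) * ((d + of_nat x) - of_nat u'))"
      unfolding R_def by (intro prod.cong) (auto simp: g_def d_def algebra_simps)
    then show ?thesis unfolding prod.distrib prod_descending by simp
  qed
  have C: "C x' = pochhammer (- d + of_nat x' - of_nat m) (Suc m)" for x'
  proof -
    have "C x' = (\<Prod>u<Suc m. ((- d + of_nat x') - of_nat u))"
      unfolding C_def by (intro prod.cong) (auto simp: g_def d_def algebra_simps)
    then show ?thesis unfolding prod_descending .
  qed
  have g_nz: "g u u' \<noteq> 0" if "u \<le> m" "u' \<le> m'" for u u'
  proof -
    have "g u u' = - (d + of_nat u - of_nat u')" by (simp add: g_def d_def)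
    then show ?thesis using nz_all[OF that] by (metis neg_equal_0_iff_equal)
  qed
  have R0: "R x \<noteq> 0" "R 0 \<noteq> 0" and C0: "C x' \<noteq> 0" "C 0 \<noteq> 0"
    unfolding R_def C_def by (simp_all only: prod_zero_iff finite_lessThan, auto simp: less_Suc_eq_le g_nz x)
  have main: "N x x' * R x * C x' = (\<Prod>u<Suc m. \<Prod>u'<Suc m'. g u u') * g x x'" if "x \<le> m" "x' \<le> m'" for x x'
    unfolding N_def R_def C_def by (rule prod_skip_skip[OF that])
  have g0: "g 0 0 \<noteq> 0" using nz(1) by (simp add: g_def)
  have "N x x' * R x * C x' * g 0 0 = N 0 0 * R 0 * C 0 * g x x'"
    using main[OF x] main[of 0 0] by (simp add: mult_ac)
  then have "N x x' = N 0 0 * (g x x' / g 0 0 * (R 0 / R x) * (C 0 / C x'))"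
  proof -
    have gen: "N1 * r1 * c1 * g1 = N2 * r2 * c2 * g2 \<Longrightarrow> r1 \<noteq> 0 \<Longrightarrow> c1 \<noteq> 0 \<Longrightarrow> g1 \<noteq> 0 \<Longrightarrow>
      N1 = N2 * (g2 / g1 * (r2 / r1) * (c2 / c1))" for N1 N2 r1 r2 c1 c2 g1 g2 :: complex
      by (simp add: field_simps)
    show ?thesis
      by (rule gen) (use R0 C0 g0 \<open>N x x' * R x * C x' * g 0 0 = N 0 0 * R 0 * C 0 * g x x'\<close> in auto)
  qed
  also have "R 0 / R x = pochhammer (c - c' - of_nat m') x / pochhammer (1 + c - c') x"
  proof -
    define e :: complex where "e = (- 1) ^ Suc m'"
    have "e \<noteq> 0" by (simp add: e_def)
    have D0: "pochhammer (d + of_nat x - of_nat m') (Suc m') \<noteq> 0" using R0(1) unfolding R by (rule contrapos_nn) simp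
    have "R 0 / R x = (e * pochhammer (d - of_nat m') (Suc m')) / (e * pochhammer (d + of_nat x - of_nat m') (Suc m'))"
      unfolding R e_def by (simp only: of_nat_0 add_0_right)
    also have "\<dots> = pochhammer (d - of_nat m') (Suc m') / pochhammer (d + of_nat x - of_nat m') (Suc m')"
      using \<open>e \<noteq> 0\<close> by (rule mult_divide_mult_cancel_left)
    also have "\<dots> = pochhammer (d - of_nat m') x / pochhammer (1 + d) x"
      using pochhammer_exchange[of d m' x] D0 nz(2)[OF x(1)]
      by (subst frac_eq_eq) (simp_all only: d_def add_diff_eq not_False_eq_True)
    finally show ?thesis by (simp only: d_def add_diff_eq)
  qed
  also have "C 0 / C x' = pochhammer (c' - c - of_nat m) x' / pochhammer (1 + c' - c) x'"
  proof -
    have D0: "pochhammer (- d + of_nat x' - of_nat m) (Suc m) \<noteq> 0" using C0(1) unfolding C .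
    have d': "- d = c' - c" "1 + - d = 1 + c' - c" by (simp_all add: d_def)
    have nz': "pochhammer (1 + - d) x' \<noteq> 0" using nz(3)[OF x(2)] unfolding d'(2) .
    have "C 0 / C x' = pochhammer (- d - of_nat m) (Suc m) / pochhammer (- d + of_nat x' - of_nat m) (Suc m)"
      unfolding C by (simp only: of_nat_0 add_0_right)
    also have "\<dots> = pochhammer (- d - of_nat m) x' / pochhammer (1 + - d) x'"
      using pochhammer_exchange[of "- d" m x'] D0 nz'
      by (subst frac_eq_eq) (simp_all only: not_False_eq_True)
    finally show ?thesis unfolding d'(2) unfolding d'(1) .
  qed
  also have "g x x' / g 0 0 = (c' + of_nat x' - c - of_nat x) / (c' - c)" by (simp add: g_def)
  finally show ?thesis by (simp add: N_def)
qed


lemma initial_segment: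
  assumes "\<And>t. Suc t < m \<Longrightarrow> P (Suc t) \<Longrightarrow> P t"
  shows "\<exists>x\<le>m. \<forall>t<m. P t \<longleftrightarrow> t < x"
  using assms
proof (induction m)
  case (Suc m)
  then obtain x where x: "x \<le> m" "\<forall>t<m. P t \<longleftrightarrow> t < x" by force
  show ?case
  proof (cases "P m")
    case True
    have "x = m"
    proof (rule ccontr)
      assume "x \<noteq> m"
      then have "\<not> P (m - 1)" "0 < m" using x by auto
      then show False using Suc.prems[of "m - 1"] True by simp
    qed
    then show ?thesis using x True by (intro exI[of _ "Suc m"]) (auto simp: less_Suc_eq)
  next
    case False
    then show ?thesis using x by (intro exI[of _ x]) (auto simp: less_Suc_eq)
  qed
qed auto

lemma vand_eq_0:
  fixes s :: "nat \<Rightarrow> 'a :: comm_ring_1"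
  assumes "i < j" "j < q" "s i = s j"
  shows "vand q s = 0"
proof -
  have "(\<Prod>i<j. s j - s i) = 0" using assms by (intro prod_zero) (auto intro!: bexI[of _ i])
  then show ?thesis unfolding vand_def using assms by (intro prod_zero) auto
qed

definition box :: "nat \<Rightarrow> (nat \<Rightarrow> nat) \<Rightarrow> (nat \<Rightarrow> nat) set" where
  "box p m = {x. (\<forall>i<p. x i \<le> m i) \<and> (\<forall>i\<ge>p. x i = 0)}"

text \<open>Row \<open>(i, t)\<close> of the determinant mixes the points \<open>1 - c i - t\<close> and \<open>- c i - t\<close>. Adjacent rows of a
  block share a point, so a choice of one point per row gives distinct points only if in every block it is an initial
  segment of first points followed by second ones; that segment has length \<open>x i\<close> and the block
  then misses the single point \<open>1 - c i - x i\<close>.\<close>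
lemma detf_blocks:
  fixes c :: "nat \<Rightarrow> complex" and \<alpha> \<beta> :: "complex \<Rightarrow> complex" and m :: "nat \<Rightarrow> nat" and p :: nat
  defines "q \<equiv> offset m p"
  assumes r: "\<And>i t. i < p \<Longrightarrow> t < m i \<Longrightarrow> r (offset m i + t) = - c i - of_nat t"
  shows "detf q (\<lambda>l k. \<alpha> (r l) * (r l + 1) ^ k + \<beta> (r l) * r l ^ k) =
    (\<Sum>x\<in>box p m. (\<Prod>i<p. \<Prod>t<m i. if t < x i then \<alpha> (- c i - of_nat t) else \<beta> (- c i - of_nat t)) *
      ((\<Prod>j<p. vand (m j) (\<lambda>t. 1 - c j - of_nat (skip (x j) t))) *
       (\<Prod>j<p. \<Prod>i<j. \<Prod>t<m j. \<Prod>t'<m i.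
          (1 - c j - of_nat (skip (x j) t)) - (1 - c i - of_nat (skip (x i) t')))))"
proof -
  obtain e where e: "\<And>i t. i < p \<Longrightarrow> t < m i \<Longrightarrow> e (offset m i + t) = (i, t)"
    using block_enumeration[of p m] by blast
  define F where "F = (\<lambda>T. (\<Prod>l<q. if l \<in> T then \<alpha> (r l) else \<beta> (r l)) * vand q (\<lambda>l. if l \<in> T then r l + 1 else r l))"
  define S where "S = (\<lambda>x. {l. l < q \<and> snd (e l) < (x (fst (e l)) :: nat)})"
  have S: "offset m i + t \<in> S x \<longleftrightarrow> t < x i" if "i < p" "t < m i" for i t x
    using e[OF that] offset_less[of i p t m] that by (simp add: S_def q_def)
  have inj: "inj_on S (box p m)"
  proof (rule inj_onI, rule ext)
    fix x x' i assume x: "x \<in> box p m" "x' \<in> box p m" "S x = S x'"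
    show "x i = x' i"
    proof (cases "i < p")
      case True
      have "t < x i \<longleftrightarrow> t < x' i" if "t < m i" for t
        using S[OF True that, of x] S[OF True that, of x'] x(3) by simp
      moreover have "x i \<le> m i" "x' i \<le> m i" using x True by (auto simp: box_def)
      ultimately show ?thesis by (metis linorder_neqE_nat order_less_le_trans less_irrefl)
    qed (use x in \<open>simp add: box_def\<close>)
  qed
  have zero: "F T = 0" if T: "T \<in> Pow {..<q} - S ` box p m" for T
  proof -
    \<comment> \<open>A set without such a pair is an initial segment in every block, hence some
      \<open>S x\<close>. In such a pair, row t+1 with its first point and row t with its second
      share the node -c_i - t.\<close>
    have "\<exists>i<p. \<exists>t. Suc t < m i \<and> offset m i + Suc t \<in> T \<and> offset m i + t \<notin> T"
    proof (rule ccontr)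
      assume neg: "\<not> ?thesis"
      have "\<forall>i. \<exists>x. i < p \<longrightarrow> x \<le> m i \<and> (\<forall>t<m i. offset m i + t \<in> T \<longleftrightarrow> t < x)"
      proof
        fix i
        show "\<exists>x. i < p \<longrightarrow> x \<le> m i \<and> (\<forall>t<m i. offset m i + t \<in> T \<longleftrightarrow> t < x)"
          using initial_segment[of "m i" "\<lambda>t. offset m i + t \<in> T"] neg by blast
      qed
      then obtain X where X: "\<And>i. i < p \<Longrightarrow> X i \<le> m i \<and> (\<forall>t<m i. offset m i + t \<in> T \<longleftrightarrow> t < X i)" by metis
      define x where "x = (\<lambda>i. if i < p then X i else 0)"
      have "x \<in> box p m" using X by (auto simp: x_def box_def)
      moreover have "T = S x"
      proof (intro Set.set_eqI iffI)
        fix l assume l: "l \<in> T"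
        then have "l < offset m p" using T by (auto simp: q_def)
        then obtain i t where it: "i < p" "t < m i" "l = offset m i + t" by (rule offset_cases)
        then have "t < X i" using X[of i] l by blast
        then show "l \<in> S x" using S[OF it(1,2), of x] it by (simp add: x_def)
      next
        fix l assume l: "l \<in> S x"
        then have "l < offset m p" by (auto simp: S_def q_def)
        then obtain i t where it: "i < p" "t < m i" "l = offset m i + t" by (rule offset_cases)
        then have "t < X i" using S[OF it(1,2), of x] l by (simp add: x_def)
        then show "l \<in> T" using X[of i] it by blast
      qed
      ultimately show False using T by blast
    qed
    then obtain i t where it: "i < p" "Suc t < m i" "offset m i + Suc t \<in> T" "offset m i + t \<notin> T" by blast
    have "vand q (\<lambda>l. if l \<in> T then r l + 1 else r l) = 0"
    proof (rule vand_eq_0)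
      show "offset m i + t < offset m i + Suc t" by simp
      show "offset m i + Suc t < q" unfolding q_def using it by (intro offset_less)
      show "(if offset m i + t \<in> T then r (offset m i + t) + 1 else r (offset m i + t)) =
        (if offset m i + Suc t \<in> T then r (offset m i + Suc t) + 1 else r (offset m i + Suc t))"
        using it r[of i t] r[of i "Suc t"] by simp
    qed
    then show ?thesis by (simp add: F_def)
  qed
  have "detf q (\<lambda>l k. \<alpha> (r l) * (r l + 1) ^ k + \<beta> (r l) * r l ^ k) = (\<Sum>T\<in>Pow {..<q}. F T)"
    unfolding F_def by (rule detf_binomial_rows)
  also have "\<dots> = (\<Sum>T\<in>S ` box p m. F T)"
    by (rule sum.mono_neutral_right) (use zero in \<open>auto simp: S_def\<close>)
  also have "\<dots> = (\<Sum>x\<in>box p m. F (S x))"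
    by (rule sum.reindex[OF inj, unfolded o_def])
  also have "\<dots> = (\<Sum>x\<in>box p m. (\<Prod>i<p. \<Prod>t<m i. if t < x i then \<alpha> (- c i - of_nat t) else \<beta> (- c i - of_nat t)) *
      ((\<Prod>j<p. vand (m j) (\<lambda>t. 1 - c j - of_nat (skip (x j) t))) *
       (\<Prod>j<p. \<Prod>i<j. \<Prod>t<m j. \<Prod>t'<m i.
          (1 - c j - of_nat (skip (x j) t)) - (1 - c i - of_nat (skip (x i) t')))))"
  proof (intro sum.cong refl)
    fix x
    \<comment> \<open>Beyond the segment the point is -c_i - t = 1 - c_i - (t+1), which is the jump
      in \<open>skip\<close>.\<close>
    have pt: "(if offset m i + t \<in> S x then r (offset m i + t) + 1 else r (offset m i + t)) = 1 - c i - of_nat (skip (x i) t)"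
      if "i < p" "t < m i" for i t
      using that by (simp add: S r skip_def)
    have 1: "(\<Prod>l<q. if l \<in> S x then \<alpha> (r l) else \<beta> (r l)) =
      (\<Prod>i<p. \<Prod>t<m i. if t < x i then \<alpha> (- c i - of_nat t) else \<beta> (- c i - of_nat t))"
      unfolding q_def prod_blocks by (intro prod.cong refl) (simp add: S r)
    have 2: "(\<Prod>j<p. vand (m j) (\<lambda>t. if offset m j + t \<in> S x then r (offset m j + t) + 1 else r (offset m j + t))) =
      (\<Prod>j<p. vand (m j) (\<lambda>t. 1 - c j - of_nat (skip (x j) t)))"
      unfolding vand_def by (intro prod.cong refl) (simp add: pt)
    have 3: "(\<Prod>j<p. \<Prod>i<j. \<Prod>t<m j. \<Prod>t'<m i.
        (if offset m j + t \<in> S x then r (offset m j + t) + 1 else r (offset m j + t)) -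
        (if offset m i + t' \<in> S x then r (offset m i + t') + 1 else r (offset m i + t'))) =
      (\<Prod>j<p. \<Prod>i<j. \<Prod>t<m j. \<Prod>t'<m i.
          (1 - c j - of_nat (skip (x j) t)) - (1 - c i - of_nat (skip (x i) t')))"
      by (intro prod.cong refl) (simp only: pt lessThan_iff order.strict_trans)
    show "F (S x) = (\<Prod>i<p. \<Prod>t<m i. if t < x i then \<alpha> (- c i - of_nat t) else \<beta> (- c i - of_nat t)) *
      ((\<Prod>j<p. vand (m j) (\<lambda>t. 1 - c j - of_nat (skip (x j) t))) *
       (\<Prod>j<p. \<Prod>i<j. \<Prod>t<m j. \<Prod>t'<m i.
          (1 - c j - of_nat (skip (x j) t)) - (1 - c i - of_nat (skip (x i) t'))))"
      unfolding F_def 1 unfolding q_def vand_blocks 2 3 ..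
  qed
  finally show ?thesis .
qed


text \<open>The points \<open>r l\<close> themselves are the choice x = 0, where block i misses 1 -
  c_i. Relative to \<open>vand q r\<close> the factors within blocks are given by
  \<open>vand_block_ratio\<close> and those between blocks by
  \<open>cross_block_ratio\<close>.\<close>

lemma detf_blocks_ratio:
  fixes c :: "nat \<Rightarrow> complex" and \<alpha> \<beta> :: "complex \<Rightarrow> complex" and m :: "nat \<Rightarrow> nat" and p :: nat
  defines "q \<equiv> offset m p"
  assumes r: "\<And>i t. i < p \<Longrightarrow> t < m i \<Longrightarrow> r (offset m i + t) = - c i - of_nat t"
    and c_dist: "\<And>i j. i < p \<Longrightarrow> j < p \<Longrightarrow> i \<noteq> j \<Longrightarrow> c i \<noteq> c j"
    and cc: "\<And>i k x. i < p \<Longrightarrow> k < p \<Longrightarrow> x \<le> m i \<Longrightarrow> pochhammer (1 + c i - c k) x \<noteq> 0"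
  shows "detf q (\<lambda>l k. \<alpha> (r l) * (r l + 1) ^ k + \<beta> (r l) * r l ^ k) = vand q r *
    (\<Sum>x\<in>box p m. (\<Prod>i<p. \<Prod>t<m i. if t < x i then \<alpha> (- c i - of_nat t) else \<beta> (- c i - of_nat t)) *
      ((\<Prod>i<p. (- 1) ^ x i) * vdm_ratio p c (\<lambda>i. of_nat (x i)) *
       (\<Prod>i<p. \<Prod>k<p. pochhammer (c i - c k - of_nat (m k)) (x i) / pochhammer (1 + c i - c k) (x i))))"
    (is "_ = _ * (\<Sum>x\<in>_. ?A x * (?S x * ?V x * ?P x))")
    and "vand q r \<noteq> 0"
proof -
  define N where "N = (\<lambda>j. vand (m j) (\<lambda>t. 1 - c j - of_nat (skip 0 t)))"
  define M where "M = (\<lambda>j i. \<Prod>t<m j. \<Prod>t'<m i. (1 - c j - of_nat (skip 0 t)) - (1 - c i - of_nat (skip 0 t')))"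
  have r0: "r (offset m i + t) = 1 - c i - of_nat (skip 0 t)" if "i < p" "t < m i" for i t
    using r[OF that] by (simp add: skip_def)
  have vr: "vand q r = (\<Prod>j<p. N j) * (\<Prod>j<p. \<Prod>i<j. M j i)"
  proof -
    have 1: "(\<Prod>j<p. vand (m j) (\<lambda>t. r (offset m j + t))) = (\<Prod>j<p. N j)"
      unfolding N_def vand_def by (intro prod.cong refl) (simp add: r0)
    have 2: "(\<Prod>j<p. \<Prod>i<j. \<Prod>t<m j. \<Prod>t'<m i. r (offset m j + t) - r (offset m i + t')) = (\<Prod>j<p. \<Prod>i<j. M j i)"
      unfolding M_def by (intro prod.cong refl) (simp only: r0 lessThan_iff order.strict_trans)
    show ?thesis unfolding q_def vand_blocks 1 2 ..
  qed
  define Q where "Q = (\<lambda>x i k. pochhammer (c i - c k - of_nat (m k)) (x i) / pochhammer (1 + c i - c k) (x i))"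
  have "(\<Prod>j<p. vand (m j) (\<lambda>t. 1 - c j - of_nat (skip (x j) t))) *
       (\<Prod>j<p. \<Prod>i<j. \<Prod>t<m j. \<Prod>t'<m i. (1 - c j - of_nat (skip (x j) t)) - (1 - c i - of_nat (skip (x i) t')))
      = vand q r * (?S x * ?V x * ?P x)" if x: "x \<in> box p m" for x
  proof -
    have xm: "x i \<le> m i" if "i < p" for i using x that by (simp add: box_def)
    have 1: "(\<Prod>j<p. vand (m j) (\<lambda>t. 1 - c j - of_nat (skip (x j) t))) = (\<Prod>j<p. N j * ((- 1) ^ x j * Q x j j))"
    proof (intro prod.cong refl)
      fix j assume "j \<in> {..<p}"
      then have j: "j < p" by simp
      show "vand (m j) (\<lambda>t. 1 - c j - of_nat (skip (x j) t)) = N j * ((- 1) ^ x j * Q x j j)"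
        using vand_block_ratio[OF xm[OF j], of "c j"] by (simp add: N_def Q_def pochhammer_fact)
    qed
    have 2: "(\<Prod>j<p. \<Prod>i<j. \<Prod>t<m j. \<Prod>t'<m i. (1 - c j - of_nat (skip (x j) t)) - (1 - c i - of_nat (skip (x i) t'))) =
      (\<Prod>j<p. \<Prod>i<j. M j i * ((c i + of_nat (x i) - c j - of_nat (x j)) / (c i - c j) * (Q x i j * Q x j i)))"
    proof (intro prod.cong refl)
      fix j i assume "j \<in> {..<p}" "i \<in> {..<j}"
      then have ji: "j < p" "i < p" "i \<noteq> j" by auto
      show "(\<Prod>t<m j. \<Prod>t'<m i. (1 - c j - of_nat (skip (x j) t)) - (1 - c i - of_nat (skip (x i) t'))) =
        M j i * ((c i + of_nat (x i) - c j - of_nat (x j)) / (c i - c j) * (Q x i j * Q x j i))"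
        using cross_block_ratio[OF xm[OF ji(1)] xm[OF ji(2)] c_dist[OF ji(1,2) ji(3)[symmetric]] cc[OF ji(1,2)] cc[OF ji(2,1)]]
        by (simp only: M_def Q_def mult_ac)
    qed
    have V: "?V x = (\<Prod>j<p. \<Prod>i<j. (c i + of_nat (x i) - c j - of_nat (x j)) / (c i - c j))"
      by (simp add: vdm_ratio_def)
    have P: "?P x = (\<Prod>i<p. Q x i i) * (\<Prod>j<p. \<Prod>i<j. Q x i j * Q x j i)"
      unfolding Q_def by (rule prod_square_pairs)
    show ?thesis unfolding 1 2 V vr P prod.distrib by (simp only: mult_ac)
  qed
  then show "detf q (\<lambda>l k. \<alpha> (r l) * (r l + 1) ^ k + \<beta> (r l) * r l ^ k) = vand q r * (\<Sum>x\<in>box p m. ?A x * (?S x * ?V x * ?P x))"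
    using detf_blocks[of p m r c \<alpha> \<beta>] r by (simp add: q_def sum_distrib_left mult_ac)
  show "vand q r \<noteq> 0"
  proof -
    have *: "r l \<noteq> r l'" if ll: "l < q" "l' < q" "l' \<noteq> l" for l l'
    proof -
      obtain i t where it: "i < p" "t < m i" "l = offset m i + t"
        using ll(1) unfolding q_def by (rule offset_cases)
      obtain i' t' where it': "i' < p" "t' < m i'" "l' = offset m i' + t'"
        using ll(2) unfolding q_def by (rule offset_cases)
      have aux: "- c i - of_nat t \<noteq> - c j - of_nat u" if "i < p" "j < p" "i \<noteq> j" "t < m i" "u \<le> t" for i j t u
      proof -
        have "(c i - c j) + of_nat (t - u) \<noteq> 0"
          using c_dist[OF that(1-3)] cc[OF that(1,2)] that(4,5)
          by (intro nonzero_add_of_nat[of _ "m i"]) (auto simp: add_diff_eq)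
        then show ?thesis using that(5) by (auto simp: of_nat_diff algebra_simps)
      qed
      show ?thesis
      proof (cases "i = i'")
        case True
        then show ?thesis using it it' ll(3) by (simp add: r)
      next
        case False
        then show ?thesis using aux[of i i' t t'] aux[of i' i t' t] it it' by (cases "t' \<le> t") (auto simp: r)
      qed
    qed
    show ?thesis unfolding vand_def using * by (auto simp: less_imp_neq)
  qed
qed

section \<open>The multilateral sum\<close>

lemma poch_int_nonneg: "poch_int w (int Y) = pochhammer w Y"
  by (simp add: poch_int_def)

lemma poch_int_neg: "poch_int w (- int Y) = 1 / pochhammer (w - of_nat Y) Y"
proof (cases "Y = 0")
  case False
  have "(\<Prod>j = 1..Y. w - of_nat j) = pochhammer (w - of_nat Y) Y"
    unfolding pochhammer_prod
    by (rule prod.reindex_bij_witness[of _ "\<lambda>i. Y - i" "\<lambda>j. Y - j"]) (auto simp: of_nat_diff)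
  then show ?thesis using False by (simp add: poch_int_def)
qed (simp add: poch_int_def)

lemma int_nonneg_neg_cases:
  obtains Y where "y = int Y" | Y where "y = - int Y"
  by (metis int_cases2)

text \<open>For negative \<open>y\<close> the product in the denominator of \<open>poch_int w y\<close> may vanish; then
  \<open>poch_int w y\<close> is the junk value \<open>1 / 0 = 0\<close>, but its reciprocal has the intended value \<open>0\<close>.\<close>
lemma rGamma_add_int:
  fixes w :: complex
  assumes "w \<notin> \<int>\<^sub>\<le>\<^sub>0"
  shows "rGamma (w + of_int y) = rGamma w / poch_int w y"
proof (cases y rule: int_nonneg_neg_cases)
  case (1 Y)
  then show ?thesis using pochhammer_rGamma[of w Y] Gamma_rGamma_of_nat(2)[OF assms, of Y]
    by (simp add: poch_int_nonneg)
next
  case (2 Y)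
  then show ?thesis using pochhammer_rGamma[of "w - of_nat Y" Y] by (simp add: poch_int_neg)
qed

lemma rGamma_diff_int:
  fixes w :: complex
  assumes "1 - w \<notin> \<int>\<^sub>\<le>\<^sub>0"
  shows "rGamma (1 - w - of_int y) = (- 1) powi y * rGamma (1 - w) * poch_int w y"
proof (cases y rule: int_nonneg_neg_cases)
  case (1 Y)
  then show ?thesis using pochhammer_rGamma[of "1 - w - of_nat Y" Y]
    unfolding pochhammer_reflect by (simp add: poch_int_nonneg mult_ac)
next
  case (2 Y)
  have nz: "pochhammer (1 - w) Y \<noteq> 0" by (rule Gamma_rGamma_of_nat(2)[OF assms])
  have "pochhammer (1 - w) Y = (- 1) ^ Y * pochhammer (w - of_nat Y) Y"
    using pochhammer_reflect[of "w - of_nat Y" Y] by simp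
  moreover have "(- 1 :: complex) powi (- int Y) = (- 1) ^ Y"
    by (simp add: power_int_minus power_inverse[symmetric])
  moreover have "((- 1) ^ Y * (- 1) ^ Y :: complex) = 1" by (simp add: power_mult_distrib[symmetric])
  ultimately show ?thesis using 2 pochhammer_rGamma[of "1 - w" Y] nz
    by (simp add: poch_int_neg field_simps)
qed

text \<open>This identifies each quotient with parameter c_i in the summand as a constant times a
  polynomial in y_k, a factor of \<open>R\<close>. The second hypothesis keeps the denominator of
  \<open>poch_int (w + of_nat m) y\<close> nonzero for negative \<open>y\<close>.\<close>

lemma poch_int_ratio:
  assumes "w \<notin> \<int>\<^sub>\<le>\<^sub>0" "1 - w - of_nat m \<notin> \<int>\<^sub>\<le>\<^sub>0"
  shows "poch_int (w + of_nat m) y / poch_int w y * pochhammer w m = pochhammer (w + of_int y) m"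
proof (cases y rule: int_nonneg_neg_cases)
  case (1 Y)
  have "pochhammer w m * pochhammer (w + of_nat m) Y = pochhammer w Y * pochhammer (w + of_nat Y) m"
    by (metis add.commute pochhammer_product')
  then show ?thesis using 1 Gamma_rGamma_of_nat(2)[OF assms(1), of Y] by (simp add: poch_int_nonneg field_simps)
next
  case (2 Y)
  define v where "v = w - of_nat Y"
  have w: "w = v + of_nat Y" by (simp add: v_def)
  have "pochhammer (1 - w - of_nat m) Y \<noteq> 0" by (rule Gamma_rGamma_of_nat(2)[OF assms(2)])
  moreover have "1 - w - of_nat m = 1 - (v + of_nat m) - of_nat Y" by (simp add: v_def)
  ultimately have nz: "pochhammer (v + of_nat m) Y \<noteq> 0" by (simp only: pochhammer_reflect) simp
  have "pochhammer v Y * pochhammer (v + of_nat Y) m = pochhammer v m * pochhammer (v + of_nat m) Y"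
    by (metis add.commute pochhammer_product')
  moreover have "w + of_nat m - of_nat Y = v + of_nat m" "w - of_nat Y = v" "w + of_int y = v"
    by (simp_all add: v_def 2)
  ultimately show ?thesis unfolding 2 poch_int_neg using nz by (simp add: w field_simps)
qed

lemma vdm_ratio_vand:
  assumes "\<And>i j. i < n \<Longrightarrow> j < n \<Longrightarrow> i \<noteq> j \<Longrightarrow> z i \<noteq> z j"
  shows "vand n z \<noteq> 0" "vdm_ratio n z y * vand n z = vand n (\<lambda>k. z k + y k)"
proof -
  have "z j - z i \<noteq> 0" if "j < n" "i < j" for i j using assms[of j i] that by auto
  then show "vand n z \<noteq> 0" by (auto simp: vand_def)
  show "vdm_ratio n z y * vand n z = vand n (\<lambda>k. z k + y k)"
    unfolding vdm_ratio_def vand_def prod.distrib[symmetric]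
  proof (intro prod.cong refl)
    fix j i assume "j \<in> {..<n}" "i \<in> {..<j}"
    then have "z i - z j \<noteq> 0" using assms[of i j] by auto
    then show "(z i + y i - z j - y j) / (z i - z j) * (z j - z i) = z j + y j - (z i + y i)"
      by (simp add: field_simps)
  qed
qed

text \<open>The sign in \<open>bweight\<close> splits into one (-1)^y for each of the n+1 indices i,
  and each cancels the sign from \<open>rGamma_diff_int\<close>.\<close>

lemma bweight_poch_int:
  assumes "\<And>i. i \<le> n \<Longrightarrow> b i + z \<notin> \<int>\<^sub>\<le>\<^sub>0" "\<And>i. i \<le> n \<Longrightarrow> 1 - a i - z \<notin> \<int>\<^sub>\<le>\<^sub>0"
  shows "bweight n a b z y = (\<Prod>i\<le>n. poch_int (a i + z) y / poch_int (b i + z) y) * kern n a b z"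
proof -
  have e: "((- 1) ^ (n + 1)) powi y = (\<Prod>i\<le>n. (- 1 :: complex) powi y)"
    by (simp only: prod_constant card_atMost Suc_eq_plus1 power_int_power power_int_power' mult.commute)
  have ee: "((- 1) powi y * (- 1) powi y :: complex) = 1"
    by (simp add: power_int_mult_distrib[symmetric])
  have "((- 1) powi y) * (rGamma (1 - a i - (z + of_int y)) * rGamma (b i + (z + of_int y))) =
      poch_int (a i + z) y / poch_int (b i + z) y * (rGamma (1 - a i - z) * rGamma (b i + z))" if "i \<le> n" for i
  proof -
    have 1: "rGamma (1 - a i - (z + of_int y)) = (- 1) powi y * rGamma (1 - a i - z) * poch_int (a i + z) y"
      using rGamma_diff_int[of "a i + z" y] assms(2)[OF that] by (simp add: algebra_simps)
    have 2: "rGamma (b i + (z + of_int y)) = rGamma (b i + z) / poch_int (b i + z) y"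
      using rGamma_add_int[OF assms(1)[OF that], of y] by (simp add: add.assoc)
    show ?thesis unfolding 1 2 using ee by (simp add: mult_ac)
  qed
  then show ?thesis
    unfolding bweight_def kern_def e prod.distrib[symmetric] by (intro prod.cong) auto
qed

lemma prod_threshold:
  fixes f g :: "nat \<Rightarrow> 'a :: comm_monoid_mult"
  assumes "x \<le> m"
  shows "(\<Prod>t<m. if t < x then f t else g t) = (\<Prod>t<x. f t) * (\<Prod>t = x..<m. g t)"
proof -
  have "{..<m} = {..<x} \<union> {x..<m}" using assms by auto
  then show ?thesis by (simp add: prod.union_disjoint ivl_disj_int)
qed

text \<open>Each row costs (-1)^(n+1) for t < x and (-1)^n otherwise. With the (-1)^x from
  \<open>vand_block_ratio\<close> the total no longer depends on \<open>x\<close>, which is why the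
  sum over x in the theorem carries no signs.\<close>

lemma block_product:
  fixes a b :: "nat \<Rightarrow> complex"
  assumes "x \<le> m" "\<And>k. k \<le> n \<Longrightarrow> pochhammer (1 + c - b k) x \<noteq> 0"
  shows "(\<Prod>t<m. if t < x then \<Prod>k\<le>n. a k + (- c - of_nat t) else - (\<Prod>k\<le>n. b k - 1 + (- c - of_nat t))) * (- 1) ^ x =
    (- 1) ^ (n * m) * (\<Prod>k\<le>n. pochhammer (1 + c - b k) m) *
      (\<Prod>k\<le>n. pochhammer (c - a k) x / pochhammer (1 + c - b k) x)"
proof -
  let ?e = "(- 1) ^ (n + 1) :: complex"
  have A: "(\<Prod>k\<le>n. a k + (- c - of_nat t)) = ?e * (\<Prod>k\<le>n. c - a k + of_nat t)" for t
  proof -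
    have "(\<Prod>k\<le>n. a k + (- c - of_nat t)) = (\<Prod>k\<le>n. - (c - a k + of_nat t))" by (simp add: algebra_simps)
    then show ?thesis unfolding prod_uminus by simp
  qed
  have B: "- (\<Prod>k\<le>n. b k - 1 + (- c - of_nat t)) = (- ?e) * (\<Prod>k\<le>n. 1 + c - b k + of_nat t)" for t
  proof -
    have "(\<Prod>k\<le>n. b k - 1 + (- c - of_nat t)) = (\<Prod>k\<le>n. - (1 + c - b k + of_nat t))" by (simp add: algebra_simps)
    then show ?thesis unfolding prod_uminus by simp
  qed
  have PA: "(\<Prod>t<x. \<Prod>k\<le>n. c - a k + of_nat t) = (\<Prod>k\<le>n. pochhammer (c - a k) x)"
    unfolding pochhammer_prod atLeast0LessThan by (rule prod.swap)
  have PB: "(\<Prod>t = x..<m. \<Prod>k\<le>n. 1 + c - b k + of_nat t) = (\<Prod>k\<le>n. pochhammer (1 + c - b k) m / pochhammer (1 + c - b k) x)"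
  proof -
    have "(\<Prod>t = x..<m. 1 + c - b k + of_nat t) = pochhammer (1 + c - b k) m / pochhammer (1 + c - b k) x" if "k \<le> n" for k
    proof -
      have "pochhammer (1 + c - b k) m = pochhammer (1 + c - b k) x * (\<Prod>t = x..<m. 1 + c - b k + of_nat t)"
        unfolding pochhammer_prod using assms(1) by (simp add: prod.atLeastLessThan_concat)
      then show ?thesis using assms(2)[OF that] by (simp add: field_simps)
    qed
    then show ?thesis by (subst prod.swap) simp
  qed
  have sgn: "?e ^ x * (- ?e) ^ (m - x) * (- 1) ^ x = (- 1) ^ (n * m)"
  proof -
    have "- ?e = (- 1) ^ n" by simp
    then have "?e ^ x * (- ?e) ^ (m - x) * (- 1) ^ x = (?e * (- 1)) ^ x * ((- 1) ^ n) ^ (m - x)"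
      by (simp only: power_mult_distrib mult_ac)
    also have "?e * (- 1) = (- 1) ^ n" by simp
    also have "((- 1) ^ n) ^ x * ((- 1) ^ n) ^ (m - x) = (((- 1) ^ n) ^ m :: complex)"
      unfolding power_add[symmetric] using assms(1) by simp
    finally show ?thesis by (simp only: power_mult)
  qed
  have "(\<Prod>t<m. if t < x then \<Prod>k\<le>n. a k + (- c - of_nat t) else - (\<Prod>k\<le>n. b k - 1 + (- c - of_nat t))) * (- 1) ^ x =
    (?e ^ x * (- ?e) ^ (m - x) * (- 1) ^ x) * ((\<Prod>k\<le>n. pochhammer (c - a k) x) * (\<Prod>k\<le>n. pochhammer (1 + c - b k) m / pochhammer (1 + c - b k) x))"
    unfolding A B prod_threshold[OF assms(1)] prod.distrib PA PB by (simp only: prod_constant card_lessThan card_atLeastLessThan mult_ac)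
  then show ?thesis unfolding sgn prod_dividef by (simp add: mult_ac)
qed

text \<open>Nonvanishing denominators are expressed pole by pole: \<open>az\<close> and
  \<open>czm\<close> concern the numerator symbols at negative y_k, \<open>bz\<close> and
  \<open>cz\<close> the denominator symbols at nonnegative y_k. Tuples are functions that are zero
  outside their index range.\<close>

theorem theorem5p2:
  fixes n p :: nat and m :: "nat \<Rightarrow> nat" and a b c z :: "nat \<Rightarrow> complex"
  assumes "n \<ge> 1"
    and z_dist: "\<And>i j. i < n \<Longrightarrow> j < n \<Longrightarrow> i \<noteq> j \<Longrightarrow> z i \<noteq> z j"
    and c_dist: "\<And>i j. i < p \<Longrightarrow> j < p \<Longrightarrow> i \<noteq> j \<Longrightarrow> c i \<noteq> c j"
    and bz: "\<And>i k. i \<le> n \<Longrightarrow> k < n \<Longrightarrow> b i + z k \<notin> \<int>\<^sub>\<le>\<^sub>0"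
    and az: "\<And>i k. i \<le> n \<Longrightarrow> k < n \<Longrightarrow> 1 - a i - z k \<notin> \<int>\<^sub>\<le>\<^sub>0"
    and cz: "\<And>i k. i < p \<Longrightarrow> k < n \<Longrightarrow> c i + z k \<notin> \<int>\<^sub>\<le>\<^sub>0"
    and czm: "\<And>i k. i < p \<Longrightarrow> k < n \<Longrightarrow> 1 - c i - z k - of_nat (m i) \<notin> \<int>\<^sub>\<le>\<^sub>0"
    and cb: "\<And>i k x. i < p \<Longrightarrow> k \<le> n \<Longrightarrow> x \<le> m i \<Longrightarrow> pochhammer (1 + c i - b k) x \<noteq> 0"
    and cc: "\<And>i k x. i < p \<Longrightarrow> k < p \<Longrightarrow> x \<le> m i \<Longrightarrow> pochhammer (1 + c i - c k) x \<noteq> 0"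
    and re: "Re ((\<Sum>i\<le>n. b i) - (\<Sum>i\<le>n. a i)) > real n + real (\<Sum>i<p. m i)"
  shows "((\<lambda>y::nat \<Rightarrow> int.
            vdm_ratio n z (\<lambda>k. of_int (y k))
          * (\<Prod>k<n. \<Prod>i<p. poch_int (c i + z k + of_nat (m i)) (y k) / poch_int (c i + z k) (y k))
          * (\<Prod>k<n. \<Prod>i\<le>n. poch_int (a i + z k) (y k) / poch_int (b i + z k) (y k)))
         has_sum
          ((-1) ^ (\<Sum>i<p. m i)
           * Gamma ((\<Sum>i\<le>n. b i) - (\<Sum>i\<le>n. a i) - of_nat (\<Sum>i<p. m i) - of_nat n)
           / ((\<Prod>i\<le>n. \<Prod>k\<le>n. Gamma (b i - a k)) * (\<Prod>i<n. \<Prod>k<n. Gamma (1 + z k - z i)))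
           * (\<Prod>k<n. \<Prod>i\<le>n. Gamma (1 - a i - z k) * Gamma (b i + z k))
           * (\<Prod>i<p. (\<Prod>k\<le>n. pochhammer (1 + c i - b k) (m i))
                      / (\<Prod>k<n. pochhammer (c i + z k) (m i)))
           * (\<Sum>x \<in> {x :: nat \<Rightarrow> nat. (\<forall>i<p. x i \<le> m i) \<and> (\<forall>i\<ge>p. x i = 0)}.
                vdm_ratio p c (\<lambda>i. of_nat (x i))
              * (\<Prod>k\<le>n. \<Prod>i<p. pochhammer (c i - a k) (x i) / pochhammer (1 + c i - b k) (x i))
              * (\<Prod>i<p. \<Prod>k<p. pochhammer (c i - c k - of_nat (m k)) (x i)
                                   / pochhammer (1 + c i - c k) (x i)))))
        {y. \<forall>k\<ge>n. y k = 0}"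
proof -
  define q where "q = offset m p"
  have q: "q = (\<Sum>i<p. m i)" by (simp add: q_def offset_def)
  define E where "E = excess n a b"
  have E: "E = (\<Sum>i\<le>n. b i) - (\<Sum>i\<le>n. a i)" by (simp add: E_def excess_def)
  have ex: "real (n + q) < Re E" using re by (simp add: E q)
  obtain e where e: "\<And>i t. i < p \<Longrightarrow> t < m i \<Longrightarrow> e (offset m i + t) = (i, t)"
    using block_enumeration[of p m] by blast
  define r where "r = (\<lambda>l. - c (fst (e l)) - of_nat (snd (e l)))"
  have r: "r (offset m i + t) = - c i - of_nat t" if "i < p" "t < m i" for i t
    using e[OF that] by (simp add: r_def)
  define P where "P = (\<Prod>k<n. \<Prod>i<p. pochhammer (c i + z k) (m i))"
  define W where "W = (\<Prod>k<n. kern n a b (z k))"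
  define \<Lambda> where "\<Lambda> = (\<Prod>k<q. of_nat (n + 1 + k) - E)"
  define X where "X = (\<Sum>x\<in>box p m. vdm_ratio p c (\<lambda>i. of_nat (x i))
              * (\<Prod>k\<le>n. \<Prod>i<p. pochhammer (c i - a k) (x i) / pochhammer (1 + c i - b k) (x i))
              * (\<Prod>i<p. \<Prod>k<p. pochhammer (c i - c k - of_nat (m k)) (x i) / pochhammer (1 + c i - c k) (x i)))"
  define BB where "BB = (\<Prod>i<p. \<Prod>k\<le>n. pochhammer (1 + c i - b k) (m i))"
  define f where "f = (\<lambda>y::nat \<Rightarrow> int. vdm_ratio n z (\<lambda>k. of_int (y k))
          * (\<Prod>k<n. \<Prod>i<p. poch_int (c i + z k + of_nat (m i)) (y k) / poch_int (c i + z k) (y k))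
          * (\<Prod>k<n. \<Prod>i\<le>n. poch_int (a i + z k) (y k) / poch_int (b i + z k) (y k)))"
  have vr: "vand q r \<noteq> 0"
    and det: "detf q (\<lambda>l k. poly (Dpoly n a b k) (r l)) = vand q r * ((- 1) ^ (n * q) * BB * X)"
  proof -
    define \<alpha> \<beta> where "\<alpha> = (\<lambda>s. \<Prod>k\<le>n. a k + s)" and "\<beta> = (\<lambda>s. - (\<Prod>k\<le>n. b k - 1 + s))"
    note D = detf_blocks_ratio(1)[of p m r c \<alpha> \<beta>, OF r c_dist cc, folded q_def]
    show "vand q r \<noteq> 0" unfolding q_def by (rule detf_blocks_ratio(2)[of p m r c, OF r c_dist cc])
    have "(\<lambda>l k. poly (Dpoly n a b k) (r l)) = (\<lambda>l k. \<alpha> (r l) * (r l + 1) ^ k + \<beta> (r l) * r l ^ k)"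
      by (simp add: poly_Dpoly \<alpha>_def \<beta>_def fun_eq_iff)
    moreover have "(\<Prod>i<p. \<Prod>t<m i. if t < x i then \<alpha> (- c i - of_nat t) else \<beta> (- c i - of_nat t)) * (\<Prod>i<p. (- 1) ^ x i) =
      (- 1) ^ (n * q) * BB * (\<Prod>k\<le>n. \<Prod>i<p. pochhammer (c i - a k) (x i) / pochhammer (1 + c i - b k) (x i))"
      if "x \<in> box p m" for x
    proof -
      have "(\<Prod>t<m i. if t < x i then \<alpha> (- c i - of_nat t) else \<beta> (- c i - of_nat t)) * (- 1) ^ x i =
        (- 1) ^ (n * m i) * (\<Prod>k\<le>n. pochhammer (1 + c i - b k) (m i)) *
        (\<Prod>k\<le>n. pochhammer (c i - a k) (x i) / pochhammer (1 + c i - b k) (x i))" if "i < p" for i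
        unfolding \<alpha>_def \<beta>_def using \<open>x \<in> box p m\<close> that cb
        by (intro block_product) (auto simp: box_def)
      then have "(\<Prod>i<p. (\<Prod>t<m i. if t < x i then \<alpha> (- c i - of_nat t) else \<beta> (- c i - of_nat t)) * (- 1) ^ x i) =
        (\<Prod>i<p. (- 1) ^ (n * m i) * (\<Prod>k\<le>n. pochhammer (1 + c i - b k) (m i)) *
        (\<Prod>k\<le>n. pochhammer (c i - a k) (x i) / pochhammer (1 + c i - b k) (x i)))"
        by (intro prod.cong) auto
      moreover have "(\<Prod>i<p. (- 1) ^ (n * m i)) = ((- 1) ^ (n * q) :: complex)"
        by (simp add: power_sum[symmetric] q sum_distrib_left)
      ultimately show ?thesis
        unfolding prod.distrib BB_def by (simp add: prod.swap[of _ "{..n}" "{..<p}"])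
    qed
    then have "(\<Sum>x\<in>box p m. (\<Prod>i<p. \<Prod>t<m i. if t < x i then \<alpha> (- c i - of_nat t) else \<beta> (- c i - of_nat t)) *
      ((\<Prod>i<p. (- 1) ^ x i) * vdm_ratio p c (\<lambda>i. of_nat (x i)) *
       (\<Prod>i<p. \<Prod>k<p. pochhammer (c i - c k - of_nat (m k)) (x i) / pochhammer (1 + c i - c k) (x i)))) =
      (- 1) ^ (n * q) * BB * X"
      unfolding X_def sum_distrib_left mult.assoc[symmetric]
      by (intro sum.cong refl) (simp only: mult_ac)
    ultimately show "detf q (\<lambda>l k. poly (Dpoly n a b k) (r l)) = vand q r * ((- 1) ^ (n * q) * BB * X)"
      using D by simp
  qed
  have vz: "vand n z \<noteq> 0" by (rule vdm_ratio_vand(1)[OF z_dist])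
  have P0: "P \<noteq> 0" unfolding P_def using Gamma_rGamma_of_nat(2)[OF cz] by auto
  have W0: "W \<noteq> 0" unfolding W_def kern_def using bz az by (auto simp: rGamma_eq_zero_iff)
  \<comment> \<open>The product is read backwards. Its Pochhammer part takes Gamma(E-n) down to
    Gamma(E-q-n), and its sign becomes the factor (-1)^|m|.\<close>
  have \<Lambda>: "\<Lambda> = (- 1) ^ q * pochhammer (E - of_nat q - of_nat n) q"
  proof -
    have "\<Lambda> = (\<Prod>k<q. - (E - of_nat n - 1 - of_nat k))"
      unfolding \<Lambda>_def by (intro prod.cong) (auto simp: algebra_simps)
    also have "\<dots> = (- 1) ^ q * (\<Prod>k<q. E - of_nat n - 1 - of_nat k)" unfolding prod_uminus by simp
    also have "(\<Prod>k<q. E - of_nat n - 1 - of_nat k) = pochhammer (E - of_nat q - of_nat n) q"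
      unfolding pochhammer_prod
      by (rule prod.reindex_bij_witness[of _ "\<lambda>i. q - 1 - i" "\<lambda>i. q - 1 - i"]) (auto simp: of_nat_diff algebra_simps)
    finally show ?thesis .
  qed
  have E0: "E - of_nat q - of_nat n \<notin> \<int>\<^sub>\<le>\<^sub>0" by (rule Re_pos_not_nonpos_Ints) (use ex in simp)
  have \<Lambda>0: "\<Lambda> \<noteq> 0" unfolding \<Lambda> using Gamma_rGamma_of_nat(2)[OF E0, of q] by simp
  \<comment> \<open>Passing from r_l - s to Pochhammer factors costs (-1)^(n q); the same sign
    occurs in \<open>det\<close>, and the two cancel.\<close>
  have fy: "f y * (vand n z * W * P * (- 1) ^ (n * q)) =
    (\<Prod>k<n. bweight n a b (z k) (y k)) * vand n (\<lambda>k. z k + of_int (y k)) * (\<Prod>l<q. \<Prod>k<n. r l - (z k + of_int (y k)))" for y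
  proof -
    have 1: "(\<Prod>k<n. bweight n a b (z k) (y k)) = (\<Prod>k<n. \<Prod>i\<le>n. poch_int (a i + z k) (y k) / poch_int (b i + z k) (y k)) * W"
      unfolding W_def prod.distrib[symmetric] using bz az by (intro prod.cong refl bweight_poch_int) auto
    have 2: "(\<Prod>l<q. \<Prod>k<n. r l - (z k + of_int (y k))) =
      (- 1) ^ (n * q) * ((\<Prod>k<n. \<Prod>i<p. poch_int (c i + z k + of_nat (m i)) (y k) / poch_int (c i + z k) (y k)) * P)"
    proof -
      have "(\<Prod>l<q. r l - s) = (- 1) ^ q * (\<Prod>i<p. pochhammer (c i + s) (m i))" for s
      proof -
        have "(\<Prod>l<q. r l - s) = (\<Prod>i<p. \<Prod>t<m i. - (c i + s + of_nat t))"
          unfolding q_def prod_blocks by (intro prod.cong refl) (simp add: r)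
        also have "\<dots> = (\<Prod>i<p. (- 1) ^ m i * pochhammer (c i + s) (m i))"
          unfolding prod_uminus pochhammer_prod atLeast0LessThan by simp
        also have "\<dots> = (- 1) ^ q * (\<Prod>i<p. pochhammer (c i + s) (m i))"
          by (simp add: prod.distrib power_sum[symmetric] q)
        finally show ?thesis .
      qed
      then have "(\<Prod>l<q. \<Prod>k<n. r l - (z k + of_int (y k))) =
        (\<Prod>k<n. (- 1) ^ q * (\<Prod>i<p. pochhammer (c i + (z k + of_int (y k))) (m i)))"
        by (subst prod.swap) simp
      also have "\<dots> = (- 1) ^ (n * q) * (\<Prod>k<n. \<Prod>i<p. pochhammer (c i + z k + of_int (y k)) (m i))"
        by (simp add: prod.distrib power_mult[symmetric] mult.commute add.assoc)
      also have "(\<Prod>k<n. \<Prod>i<p. pochhammer (c i + z k + of_int (y k)) (m i)) =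
        (\<Prod>k<n. \<Prod>i<p. poch_int (c i + z k + of_nat (m i)) (y k) / poch_int (c i + z k) (y k)) * P"
        unfolding P_def prod.distrib[symmetric]
      proof (intro prod.cong refl)
        fix k i assume "k \<in> {..<n}" "i \<in> {..<p}"
        then have "c i + z k \<notin> \<int>\<^sub>\<le>\<^sub>0" "1 - (c i + z k) - of_nat (m i) \<notin> \<int>\<^sub>\<le>\<^sub>0"
          using cz[of i k] czm[of i k] by (simp_all add: diff_diff_eq)
        from poch_int_ratio[OF this, of "y k"]
        show "pochhammer (c i + z k + of_int (y k)) (m i) =
          poch_int (c i + z k + of_nat (m i)) (y k) / poch_int (c i + z k) (y k) * pochhammer (c i + z k) (m i)" ..
      qed
      finally show ?thesis .
    qed
    have 3: "vand n (\<lambda>k. z k + of_int (y k)) = vdm_ratio n z (\<lambda>k. of_int (y k)) * vand n z"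
      by (rule vdm_ratio_vand(2)[OF z_dist, symmetric])
    show ?thesis unfolding f_def 1 2 3 by (simp only: mult_ac)
  qed
  define Z where "Z = vand n z * W * P * (- 1) ^ (n * q) * (vand q r * \<Lambda>)"
  have "Z \<noteq> 0" using vz W0 P0 vr \<Lambda>0 by (simp add: Z_def)
  have "((\<lambda>y. f y * Z) has_sum (moment_det n a b z * (vand q r * ((- 1) ^ (n * q) * BB * X)))) {y. \<forall>k\<ge>n. y k = 0}"
    using has_sum_vand_roots[of n q a b z r] ex
    unfolding moment_det_def[symmetric] det fy[symmetric] E_def[symmetric] \<Lambda>_def[symmetric] Z_def by (simp add: mult_ac)
  then have "((\<lambda>y. f y * Z / Z) has_sum (moment_det n a b z * (vand q r * ((- 1) ^ (n * q) * BB * X)) / Z)) {y. \<forall>k\<ge>n. y k = 0}"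
    by (rule has_sum_divide_const)
  then have fsum: "(f has_sum (moment_det n a b z * (vand q r * ((- 1) ^ (n * q) * BB * X)) / Z)) {y. \<forall>k\<ge>n. y k = 0}"
    using \<open>Z \<noteq> 0\<close> by simp
  define RG where "RG = (\<Prod>i\<le>n. \<Prod>k\<le>n. rGamma (b i - a k))"
  define RZ where "RZ = (\<Prod>i<n. \<Prod>k<n. rGamma (1 + z k - z i))"
  have mom: "moment_det n a b z = Gamma (E - of_nat q - of_nat n) * pochhammer (E - of_nat q - of_nat n) q * RG * (vand n z * RZ)"
  proof -
    have "E - of_nat q - of_nat n + of_nat q = E - of_nat n" by simp
    then have "Gamma (E - of_nat n) = Gamma (E - of_nat q - of_nat n) * pochhammer (E - of_nat q - of_nat n) q"
      using pochhammer_Gamma[OF E0, of q] E0 by (simp add: Gamma_eq_zero_iff field_simps)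
    then show ?thesis using moment_det_eq[OF assms(1), of a b z] ex
      by (simp add: E_def RG_def RZ_def sine_vand_def)
  qed
  have "moment_det n a b z * (vand q r * ((- 1) ^ (n * q) * BB * X)) / Z =
    (- 1) ^ q * Gamma (E - of_nat q - of_nat n) * RG * RZ * (1 / W) * (BB / P) * X"
  proof -
    have "((- 1) ^ q * (- 1) ^ q :: complex) = 1" by (simp add: power_mult_distrib[symmetric])
    then have \<Lambda>': "pochhammer (E - of_nat q - of_nat n) q = (- 1) ^ q * \<Lambda>" unfolding \<Lambda> by simp
    show ?thesis unfolding mom \<Lambda>' Z_def using vz W0 P0 vr \<Lambda>0 by (simp add: field_simps)
  qed
  also have "1 / W = (\<Prod>k<n. \<Prod>i\<le>n. Gamma (1 - a i - z k) * Gamma (b i + z k))"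
    by (simp add: W_def kern_def rGamma_inverse_Gamma prod_dividef inverse_eq_divide)
  also have "BB / P = (\<Prod>i<p. (\<Prod>k\<le>n. pochhammer (1 + c i - b k) (m i)) / (\<Prod>k<n. pochhammer (c i + z k) (m i)))"
    unfolding BB_def P_def prod_dividef by (simp add: prod.swap[of _ "{..<n}" "{..<p}"])
  finally have val: "moment_det n a b z * (vand q r * ((- 1) ^ (n * q) * BB * X)) / Z =
    (- 1) ^ q * Gamma (E - of_nat q - of_nat n) * RG * RZ *
     (\<Prod>k<n. \<Prod>i\<le>n. Gamma (1 - a i - z k) * Gamma (b i + z k)) *
     (\<Prod>i<p. (\<Prod>k\<le>n. pochhammer (1 + c i - b k) (m i)) / (\<Prod>k<n. pochhammer (c i + z k) (m i))) * X" .
  \<comment> \<open>At poles \<open>Gamma\<close> is 0 and division by 0 gives 0, which agrees with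
    \<open>rGamma\<close>.\<close>
  have inv: "RG * RZ = 1 / ((\<Prod>i\<le>n. \<Prod>k\<le>n. Gamma (b i - a k)) * (\<Prod>i<n. \<Prod>k<n. Gamma (1 + z k - z i)))"
    by (simp add: RG_def RZ_def rGamma_inverse_Gamma prod_dividef inverse_eq_divide)
  have pref: "(- 1) ^ q * Gamma (E - of_nat q - of_nat n) * RG * RZ =
    (- 1) ^ q * Gamma (E - of_nat q - of_nat n) /
      ((\<Prod>i\<le>n. \<Prod>k\<le>n. Gamma (b i - a k)) * (\<Prod>i<n. \<Prod>k<n. Gamma (1 + z k - z i)))"
    unfolding mult.assoc[of _ RG RZ] inv by simp
  show ?thesis using fsum unfolding val pref unfolding f_def X_def box_def E q .
qed

end
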